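(* Let $G$ be a connected $n$-node graph denoting the underlying network of the $\mathsf{CONGEST}$ model, and let $\lambda=1/\mathrm{poly}(n)$. Then one round of the $\mathsf{GOSSIP}(\lambda)$ model on the $n$ nodes of $G$ can be emulated in $\tilde{O}(\tau_G)$ rounds of the $\mathsf{CONGEST}$ model on $G$ (w.h.p.); that is, in $\tilde O(\tau_G)$ rounds every node $u$ obtains a node $t(u)$ whose distribution satisfies the $\mathsf{GOSSIP}(\lambda)$ condition, and each $u$ can push an $O(\log n)$-bit message to $t(u)$ or pull an $O(\log n)$-bit message from $t(u)$.
   Context: $\mathsf{CONGEST}$ model: in each synchronous round, each node of $G$ may send an $O(\log n)$-bit message to each neighbor and then compute locally. $\mathsf{GOSSIP}(\lambda)$ model with $n$ nodes: in each synchronous round each node $u$ samples a node $t(u)$ such that for any node $v$ and any set of nodes $Z$ with $u\notin Z$, $\Pr\big(t(u)=v \mid \bigwedge_{z\in Z} t(z)\big)\in\big[\tfrac{1-\lambda}{n},\tfrac{1+\lambda}{n}\big]$, where the conditioning is on any assignment of the $t(z)$, $z\in Z$; then $u$ may PUSH an $O(\log n)$-bit message to $t(u)$ or PULL an $O(\log n)$-bit message from $t(u)$, then compute locally. Mixing time: with $m=|E|$ and $P^t_u(w)$ the probability that a lazy random walk (stay with probability $1/2$, otherwise move to a uniform random neighbor) started at $u$ is at $w$ after $t$ steps, $\tau_G$ is the minimum $t$ such that $|P^t_u(w)-\deg(w)/(2m)|\le\deg(w)/(2mn)$ for all $u,w$. $\tilde O$ hides $\mathrm{polylog}(n)$ factors.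 W.h.p. means with probability $1-1/\mathrm{poly}(n)$. *)

theory Defs
  imports "HOL-Probability.Probability" "Graph_Theory.Graph_Theory"
begin

section \<open>Networks and mixing time\<close>

text \<open>
  A network is a finite simple undirected graph in the sense of \<^locale>\<open>pair_graph\<close>: a symmetric,
  loop-free set of arcs.  Every undirected edge contributes two arcs, and the vertices are the
  node identifiers.
\<close>

type_synonym network = "nat pair_pre_digraph"

definition num_edges :: "network \<Rightarrow> nat" where
  "num_edges G = card (parcs G) div 2"

definition neighbours :: "network \<Rightarrow> nat \<Rightarrow> nat set" where
  "neighbours G u = {w. (u, w) \<in> parcs G}"

definition lazy_step :: "network \<Rightarrow> nat \<Rightarrow> nat pmf" where
  "lazy_step G u =
     bernoulli_pmf (1 / 2) \<bind> (\<lambda>stay. if stay then return_pmf u else pmf_of_set (neighbours G u))"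

primrec lazy_walk :: "network \<Rightarrow> nat \<Rightarrow> nat \<Rightarrow> nat pmf" where
  "lazy_walk G u 0 = return_pmf u"
| "lazy_walk G u (Suc t) = lazy_walk G u t \<bind> lazy_step G"

definition mixing_time :: "network \<Rightarrow> nat" where
  "mixing_time G = (LEAST t. \<forall>u\<in>pverts G. \<forall>w\<in>pverts G.
     \<bar>pmf (lazy_walk G u t) w - real (out_degree G w) / (2 * real (num_edges G))\<bar>
       \<le> real (out_degree G w) / (2 * real (num_edges G) * real (card (pverts G))))"


section \<open>The CONGEST model\<close>

type_synonym msg = "bool list"

text \<open>
  The initial knowledge of a node: the number of nodes, its own identifier, the identifiers of its
  neighbours, and its local input.  Nothing else about the network is known to a node.
\<close>

record 'i local_view =
  view_size :: nat
  view_id :: nat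
  view_nbrs :: "nat set"
  view_input :: 'i

definition local_view :: "network \<Rightarrow> (nat \<Rightarrow> 'i) \<Rightarrow> nat \<Rightarrow> 'i local_view" where
  "local_view G inp u =
     \<lparr>view_size = card (pverts G), view_id = u, view_nbrs = neighbours G u, view_input = inp u\<rparr>"

text \<open>
  One and the same program runs at every node.  In a round a node sends to each neighbour a message
  determined by its state (the empty bit string stands for silence), and then computes its next
  state from its state, the messages received (indexed by the identifier of the sender), and
  private randomness.
\<close>

record ('s, 'i, 'o) congest_alg =
  alg_init :: "'i local_view \<Rightarrow> 's pmf"
  alg_send :: "'i local_view \<Rightarrow> 's \<Rightarrow> nat \<Rightarrow> msg"
  alg_compute :: "'i local_view \<Rightarrow> 's \<Rightarrow> (nat \<Rightarrow> msg) \<Rightarrow> 's pmf"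
  alg_output :: "'i local_view \<Rightarrow> 's \<Rightarrow> 'o"

definition inbox ::
  "('s, 'i, 'o) congest_alg \<Rightarrow> network \<Rightarrow> (nat \<Rightarrow> 'i) \<Rightarrow> (nat \<Rightarrow> 's) \<Rightarrow> nat \<Rightarrow> nat \<Rightarrow> msg" where
  "inbox A G inp \<sigma> u =
     (\<lambda>w. if w \<in> neighbours G u then alg_send A (local_view G inp w) (\<sigma> w) u else [])"

primrec congest_run ::
  "('s, 'i, 'o) congest_alg \<Rightarrow> network \<Rightarrow> (nat \<Rightarrow> 'i) \<Rightarrow> nat \<Rightarrow> (nat \<Rightarrow> 's) pmf" where
  "congest_run A G inp 0 =
     Pi_pmf (pverts G) undefined (\<lambda>u. alg_init A (local_view G inp u))"
| "congest_run A G inp (Suc r) =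
     congest_run A G inp r \<bind> (\<lambda>\<sigma>. Pi_pmf (pverts G) undefined
       (\<lambda>u. alg_compute A (local_view G inp u) (\<sigma> u) (inbox A G inp \<sigma> u)))"

definition congest_bandwidth :: "('s, 'i, 'o) congest_alg \<Rightarrow> real \<Rightarrow> bool" where
  "congest_bandwidth A B \<longleftrightarrow> (\<forall>x s w. view_size x \<ge> 2 \<longrightarrow>
     real (length (alg_send A x s w)) \<le> B * log 2 (real (view_size x)))"


section \<open>The GOSSIP model\<close>

text \<open>The conditioning ranges over all assignments that occur with positive probability.\<close>

definition gossip_sampler :: "real \<Rightarrow> nat set \<Rightarrow> (nat \<Rightarrow> nat) pmf \<Rightarrow> bool" where
  "gossip_sampler lam V T \<longleftrightarrow>
     (\<forall>t\<in>set_pmf T. \<forall>u\<in>V. t u \<in> V) \<and>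
     (\<forall>u\<in>V. \<forall>v\<in>V. \<forall>Z\<subseteq>V. \<forall>a. u \<notin> Z \<longrightarrow> \<P>(t in T. \<forall>z\<in>Z. t z = a z) > 0 \<longrightarrow>
        \<P>(t in T. t u = v \<bar> \<forall>z\<in>Z. t z = a z)
          \<in> {(1 - lam) / real (card V) .. (1 + lam) / real (card V)})"

datatype gossip_action = is_Push: Push (payload: msg) | Pull | Idle

text \<open>
  The behaviour of a node \<open>u\<close> in the round: its action as a function of the node \<open>t(u)\<close> it has
  sampled, and the message it hands out to a node that pulls from it, as a function of \<open>t(u)\<close> and
  of the pulling node.
\<close>

record gossip_task =
  task_action :: "nat \<Rightarrow> gossip_action"
  task_reply :: "nat \<Rightarrow> nat \<Rightarrow> msg"

definition gossip_msg_bound :: "real \<Rightarrow> nat set \<Rightarrow> (nat \<Rightarrow> gossip_task) \<Rightarrow> bool" where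
  "gossip_msg_bound K V task \<longleftrightarrow> (\<forall>u\<in>V. \<forall>v\<in>V.
     (\<forall>m. task_action (task u) v = Push m \<longrightarrow> real (length m) \<le> K * log 2 (real (card V))) \<and>
     (\<forall>w\<in>V. real (length (task_reply (task u) v w)) \<le> K * log 2 (real (card V))))"

record gossip_result =
  res_contact :: nat
  res_pushed :: "msg multiset"
  res_pulled :: "msg option"

definition gossip_round ::
  "nat set \<Rightarrow> (nat \<Rightarrow> gossip_task) \<Rightarrow> (nat \<Rightarrow> nat) \<Rightarrow> nat \<Rightarrow> gossip_result" where
  "gossip_round V task t u =
     \<lparr>res_contact = t u,
      res_pushed = image_mset (\<lambda>w. payload (task_action (task w) u))
        (mset_set {w\<in>V. t w = u \<and> is_Push (task_action (task w) u)}),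
      res_pulled = (if task_action (task u) (t u) = Pull
        then Some (task_reply (task (t u)) (t (t u)) u) else None)\<rparr>"


section \<open>Emulation\<close>

text \<open>
  \<open>R\<close> rounds of \<open>A\<close> emulate a GOSSIP round with failure probability at most \<open>\<epsilon>\<close>: together with the
  execution there is a random choice \<open>t\<close> whose law meets the GOSSIP condition exactly, and except
  with probability \<open>\<epsilon>\<close> every node \<open>u\<close> has obtained \<open>t(u)\<close> and all its messages of the GOSSIP round
  determined by \<open>t\<close>.  The law of \<open>t\<close> is not conditioned on success: conditioning on an event of
  probability \<open>1 - \<epsilon>\<close> may destroy the GOSSIP condition, since the latter involves assignments that
  are far less likely than \<open>\<epsilon>\<close>.
\<close>

definition emulates_gossip_round ::
  "('s, gossip_task, gossip_result) congest_alg \<Rightarrow> network \<Rightarrow> (nat \<Rightarrow> gossip_task)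
     \<Rightarrow> real \<Rightarrow> real \<Rightarrow> nat \<Rightarrow> bool" where
  "emulates_gossip_round A G task lam \<epsilon> R \<longleftrightarrow>
     (\<exists>J :: ((nat \<Rightarrow> 's) \<times> (nat \<Rightarrow> nat)) pmf.
        map_pmf fst J = congest_run A G task R \<and>
        gossip_sampler lam (pverts G) (map_pmf snd J) \<and>
        \<P>((\<sigma>, t) in J. \<forall>u\<in>pverts G.
             alg_output A (local_view G task u) (\<sigma> u) = gossip_round (pverts G) task t u)
          \<ge> 1 - \<epsilon>)"

end

theory Submission
  imports Defs
begin

text \<open>
  Every node \<open>v\<close> sends out \<open>O(log n)\<close> lazy random walks of length \<open>T = O(\<tau>)\<close> and makes the endpoint of
  largest degree its home; these homes have at least half the average degree, and no node is home to
  more than \<open>O(log n)\<close> times its fair share \<open>n deg / 2m\<close> of nodes.  Then every node \<open>u\<close> sends out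
  \<open>O(log\<^sup>2 n)\<close> request walks.  A request ending at \<open>w\<close> is answered by each resident of \<open>w\<close> with
  probability proportional to \<open>1 / deg w\<close>, with a common constant obtained by flooding a maximum.
  Since the walk ends at \<open>w\<close> with probability proportional to \<open>deg w\<close>, up to a relative error
  \<open>n\<^sup>-\<^sup>k\<close>, all nodes are equally likely answers, independently for all \<open>u\<close> once the homes are fixed.
  So the contacts are a mixture of products of almost uniform laws, which gives the GOSSIP condition.
  Messages between \<open>u\<close> and its contact \<open>v\<close> follow the walk of \<open>u\<close> to the home of \<open>v\<close> and the walk of \<open>v\<close>
  backwards.  By stationarity an arc carries at most one half of a token of each kind per step in
  expectation, and Chernoff bounds the congestion by a power of \<open>log n\<close>.

  As \<open>\<tau>\<close> is unknown to the nodes, \<open>T\<close> runs through the powers of two, and the result of the last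
  completed attempt is the output.  The messages are defined globally, as functions of the network
  and of all seeds; a node can compute what it has to send because any two executions in which it has
  seen the same make it send the same.
\<close>

section \<open>Independence of disjoint blocks of coordinates\<close>

text \<open>Endpoints of walks are biased by degree. Undoing the bias directly, by accepting an
  endpoint with probability proportional to the inverse of its degree, may accept only one walk in
  about \<open>n\<close> on a dense irregular network. Homes remove this obstacle: every node is
  represented at a place of at least half the average degree, so a request is answered with
  probability of order 1 / log n. The second obstacle is that the GOSSIP condition conditions on
  assignments of arbitrarily small probability, for which closeness in total variation says nothing.
  What survives such conditioning is a relative error in every single probability together with
  independence. Hence mixing is measured relatively, to precision \<open>n ^ (a + 2)\<close>, and
  the law of the contacts is never conditioned on success: a node without an answer receives a
  uniform contact in the coupling, which keeps the law an exact mixture of products and is charged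
  to the failure probability. The spectral estimate serves only to make the mixing time polynomial,
  so that the walk lengths that matter fit into a seed space known in advance and a union bound over
  all steps is affordable.\<close>

lemma Pi_pmf_blocks:
  fixes F :: "'k \<Rightarrow> ('i \<Rightarrow> 'v) \<Rightarrow> 'w"
  assumes "finite K" and "finite I"
    and "\<And>k. k \<in> K \<Longrightarrow> B k \<subseteq> I" and "disjoint_family_on B K"
    and "\<And>k f g. k \<in> K \<Longrightarrow> (\<And>i. i \<in> B k \<Longrightarrow> f i = g i) \<Longrightarrow> F k f = F k g"
  shows "map_pmf (\<lambda>f k. if k \<in> K then F k f else d) (Pi_pmf I e p) =
    Pi_pmf K d (\<lambda>k. map_pmf (F k) (Pi_pmf I e p))"
  using assms
proof (induction K arbitrary: I rule: finite_induct)
  case empty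
  then show ?case by (simp add: map_pmf_const)
next
  case (insert k K)
  define C where "C = I - B k"
  have fin: "finite (B k)" "finite C" "B k \<inter> C = {}" and I: "I = B k \<union> C"
    using insert.prems(1,2) finite_subset[of "B k" I] by (auto simp: C_def)
  have sub: "B k' \<subseteq> C" if "k' \<in> K" for k'
    using that insert.prems(2,3) insert.hyps(2) by (force simp: disjoint_family_on_def C_def)
  let ?P = "Pi_pmf (B k) e p" and ?Q = "Pi_pmf C e p"
  let ?m = "\<lambda>(f, g) i. if i \<in> B k then f i else g i"
  have split: "Pi_pmf I e p = map_pmf ?m (pair_pmf ?P ?Q)"
    unfolding I by (rule Pi_pmf_union) (use fin in auto)
  have Fk: "F k (?m (f, g)) = F k f" for f g
    by (rule insert.prems(4)) auto
  have FK: "F k' (?m (f, g)) = F k' g" if "k' \<in> K" for k' f g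
    by (rule insert.prems(4)) (use that sub C_def in auto)
  have "map_pmf (\<lambda>f k'. if k' \<in> insert k K then F k' f else d) (Pi_pmf I e p) =
      map_pmf (\<lambda>(y, h). h(k := y))
        (map_pmf (\<lambda>(f, g). (F k f, \<lambda>k'. if k' \<in> K then F k' g else d)) (pair_pmf ?P ?Q))"
    unfolding split pmf.map_comp
  proof (intro map_pmf_cong refl ext)
    fix fg :: "('i \<Rightarrow> 'v) \<times> ('i \<Rightarrow> 'v)" and k'
    obtain f g where fg: "fg = (f, g)" by (cases fg)
    show "((\<lambda>f k'. if k' \<in> insert k K then F k' f else d) \<circ> ?m) fg k' =
      ((\<lambda>(y, h). h(k := y)) \<circ> (\<lambda>(f, g). (F k f, \<lambda>k'. if k' \<in> K then F k' g else d))) fg k'"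
      using insert.hyps(2) Fk[of f g] FK[of k' f g] unfolding fg
      by (cases "k' = k") (simp_all del: split_paired_All)
  qed
  also have "\<dots> = map_pmf (\<lambda>(y, h). h(k := y)) (pair_pmf (map_pmf (F k) ?P)
      (Pi_pmf K d (\<lambda>k. map_pmf (F k) ?Q)))"
    unfolding map_pair
  proof (subst insert.IH[OF fin(2) sub])
    show "disjoint_family_on B K"
      using insert.prems(3) by (auto simp: disjoint_family_on_def)
    show "F k' f = F k' g" if "k' \<in> K" "\<And>i. i \<in> B k' \<Longrightarrow> f i = g i" for k' f g
      using that by (intro insert.prems(4)) auto
  qed auto
  also have "map_pmf (F k) ?P = map_pmf (F k) (Pi_pmf I e p)"
  proof -
    have "map_pmf (F k) (Pi_pmf I e p) = map_pmf (F k) (map_pmf fst (pair_pmf ?P ?Q))"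
      unfolding split pmf.map_comp by (intro map_pmf_cong refl) (use Fk in auto)
    then show ?thesis by (simp add: map_fst_pair_pmf)
  qed
  also have "Pi_pmf K d (\<lambda>k. map_pmf (F k) ?Q) = Pi_pmf K d (\<lambda>k. map_pmf (F k) (Pi_pmf I e p))"
  proof (intro Pi_pmf_cong refl)
    fix k' assume k': "k' \<in> K"
    have "map_pmf (F k') (Pi_pmf I e p) = map_pmf (F k') (map_pmf snd (pair_pmf ?P ?Q))"
      unfolding split pmf.map_comp by (intro map_pmf_cong refl) (use FK[OF k'] in auto)
    then show "map_pmf (F k') ?Q = map_pmf (F k') (Pi_pmf I e p)" by (simp add: map_snd_pair_pmf)
  qed
  also have "map_pmf (\<lambda>(y, h). h(k := y)) (pair_pmf (map_pmf (F k) (Pi_pmf I e p))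
      (Pi_pmf K d (\<lambda>k. map_pmf (F k) (Pi_pmf I e p)))) =
      Pi_pmf (insert k K) d (\<lambda>k. map_pmf (F k) (Pi_pmf I e p))"
    by (rule Pi_pmf_insert[symmetric]) (use insert.hyps in auto)
  finally show ?case .
qed

text \<open>Lifts the condition that blocks lie in \<open>I\<close>: on the support the sampled
  function is \<open>e\<close> outside \<open>I\<close>, so \<open>cut\<close> alters nothing there.
  The block of a token can then be a full product such as
  \<open>UNIV \<times> {l} \<times> UNIV\<close>.\<close>

lemma Pi_pmf_blocks':
  fixes F :: "'k \<Rightarrow> ('i \<Rightarrow> 'v) \<Rightarrow> 'w"
  assumes K: "finite K" and I: "finite I" and disj: "disjoint_family_on B K"
    and F: "\<And>k f g. k \<in> K \<Longrightarrow> (\<And>i. i \<in> B k \<Longrightarrow> f i = g i) \<Longrightarrow> F k f = F k g"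
  shows "map_pmf (\<lambda>f k. if k \<in> K then F k f else d) (Pi_pmf I e p) =
    Pi_pmf K d (\<lambda>k. map_pmf (F k) (Pi_pmf I e p))"
proof -
  define cut where "cut f = (\<lambda>i. if i \<in> I then f i else e)" for f :: "'i \<Rightarrow> 'v"
  have cut: "cut f = f" if "f \<in> set_pmf (Pi_pmf I e p)" for f
    using set_Pi_pmf_subset[OF I, of e p] that by (auto simp: cut_def fun_eq_iff)
  have "map_pmf (\<lambda>f k. if k \<in> K then F k f else d) (Pi_pmf I e p) =
      map_pmf (\<lambda>f k. if k \<in> K then F k (cut f) else d) (Pi_pmf I e p)"
    by (intro map_pmf_cong refl ext) (simp add: cut)
  also have "\<dots> = Pi_pmf K d (\<lambda>k. map_pmf (\<lambda>f. F k (cut f)) (Pi_pmf I e p))"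
  proof (rule Pi_pmf_blocks[OF K I, where B = "\<lambda>k. B k \<inter> I"])
    show "F k (cut f) = F k (cut g)" if "k \<in> K" "\<And>i. i \<in> B k \<inter> I \<Longrightarrow> f i = g i" for k f g
      by (rule F[OF that(1)]) (use that(2) in \<open>auto simp: cut_def\<close>)
  qed (use disj in \<open>auto simp: disjoint_family_on_def\<close>)
  also have "\<dots> = Pi_pmf K d (\<lambda>k. map_pmf (F k) (Pi_pmf I e p))"
    by (intro Pi_pmf_cong map_pmf_cong refl) (simp add: cut)
  finally show ?thesis .
qed

lemma Pi_pmf_reindex:
  assumes "finite I" and "finite A" and "h ` A \<subseteq> I" and "inj_on h A"
  shows "map_pmf (\<lambda>f a. if a \<in> A then f (h a) else d) (Pi_pmf I e p) = Pi_pmf A d (p \<circ> h)"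
proof -
  have "map_pmf (\<lambda>f a. if a \<in> A then f (h a) else d) (Pi_pmf I e p) =
      Pi_pmf A d (\<lambda>a. map_pmf (\<lambda>f. f (h a)) (Pi_pmf I e p))"
    by (rule Pi_pmf_blocks[where B = "\<lambda>a. {h a}"])
      (use assms in \<open>auto simp: disjoint_family_on_def inj_on_def\<close>)
  also have "\<dots> = Pi_pmf A d (p \<circ> h)"
    by (intro Pi_pmf_cong refl) (use assms in \<open>auto simp: Pi_pmf_component\<close>)
  finally show ?thesis .
qed

section \<open>A Chernoff bound\<close>

text \<open>The rough bound e at most 4 puts every tail in base 2, ready for comparison with
  \<open>2 ^ lg n\<close>.\<close>

lemma exp_le_2_powr:
  assumes "0 \<le> (x::real)"
  shows "exp x \<le> 2 powr (2 * x)"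
proof -
  have "exp x = exp 1 powr x" by (simp add: powr_def)
  also have "\<dots> \<le> 4 powr x"
    using assms exp_le by (intro powr_mono2) auto
  also have "(4::real) powr x = 2 powr (2 * x)"
    by (simp add: powr_powr[symmetric])
  finally show ?thesis .
qed

text \<open>Markov's inequality for 2 to the power of the count. By independence its expectation is
  a product of factors \<open>1 + p\<close>, each at most \<open>exp p\<close>. Only an upper bound
  on the mean enters, so means may be estimated generously.\<close>

lemma Pi_pmf_count_tail:
  fixes P :: "'k \<Rightarrow> 'v \<Rightarrow> bool"
  assumes fin: "finite K"
    and mu: "(\<Sum>k\<in>K. measure_pmf.prob (p k) {v. P k v}) \<le> \<mu>"
  shows "measure_pmf.prob (Pi_pmf K d p) {f. q \<le> card {k\<in>K. P k (f k)}} \<le> 2 powr (2 * \<mu> - real q)"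
proof -
  let ?M = "Pi_pmf K d p"
  let ?g = "\<lambda>k v. if P k v then 2 else (1::real)"
  have int: "integrable (measure_pmf (p k)) (?g k)" for k
    by (rule measure_pmf.integrable_const_bound[where B = 2]) auto
  have one: "measure_pmf.expectation (p k) (?g k) = 1 + measure_pmf.prob (p k) {v. P k v}" for k
  proof -
    have "?g k = (\<lambda>v. 1 + indicator {v. P k v} v)"
      by (auto simp: indicator_def fun_eq_iff)
    moreover have "integrable (measure_pmf (p k)) (indicat_real {v. P k v})"
      by (rule measure_pmf.integrable_const_bound[where B = 1]) auto
    ultimately show ?thesis by simp
  qed
  have pow: "(\<Prod>k\<in>K. ?g k (f k)) = 2 ^ card {k\<in>K. P k (f k)}" for f
    using fin by (simp add: prod.If_cases Collect_conj_eq)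
  have "measure_pmf.prob ?M {f. q \<le> card {k\<in>K. P k (f k)}} =
      measure_pmf.prob ?M {f\<in>space ?M. 2 ^ q \<le> (\<Prod>k\<in>K. ?g k (f k))}"
    unfolding pow by simp
  also have "\<dots> \<le> measure_pmf.expectation ?M (\<lambda>f. \<Prod>k\<in>K. ?g k (f k)) / 2 ^ q"
    by (rule integral_Markov_inequality_measure[where A = "{}"])
      (use fin int in \<open>auto intro!: integrable_prod_Pi_pmf prod_nonneg AE_I2\<close>)
  also have "measure_pmf.expectation ?M (\<lambda>f. \<Prod>k\<in>K. ?g k (f k)) =
      (\<Prod>k\<in>K. 1 + measure_pmf.prob (p k) {v. P k v})"
    unfolding one[symmetric] by (rule expectation_prod_Pi_pmf[OF fin int]) auto
  also have "\<dots> \<le> (\<Prod>k\<in>K. exp (measure_pmf.prob (p k) {v. P k v}))"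
    by (intro prod_mono conjI exp_ge_add_one_self add_nonneg_nonneg) auto
  also have "\<dots> = exp (\<Sum>k\<in>K. measure_pmf.prob (p k) {v. P k v})"
    using fin by (simp add: exp_sum)
  also have "\<dots> \<le> exp \<mu>" using mu by simp
  also have "exp \<mu> \<le> 2 powr (2 * \<mu>)"
    using mu sum_nonneg[of K "\<lambda>k. measure_pmf.prob (p k) {v. P k v}"]
    by (intro exp_le_2_powr) auto
  finally show ?thesis
    by (simp add: powr_diff powr_realpow divide_right_mono)
qed

section \<open>The lazy random walk\<close>

definition dg :: "network \<Rightarrow> nat \<Rightarrow> nat" where
  "dg G x = card (neighbours G x)"

locale connected_network =
  fixes G :: network
  assumes graph: "pair_graph G"
    and conn: "Digraph_Component.connected G"
    and two: "2 \<le> card (pverts G)"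
begin

abbreviation V :: "nat set" where "V \<equiv> pverts G"
abbreviation nb :: "nat \<Rightarrow> nat set" where "nb \<equiv> neighbours G"

section \<open>Degrees, volume and arcs of a connected network\<close>

definition n :: real where "n = real (card V)"
definition vol :: real where "vol = real (card (parcs G))"

lemma n_ge_2: "2 \<le> n"
  using two by (simp add: n_def)

lemma finite_V: "finite V" and finite_arcs: "finite (parcs G)"
  using graph by (auto simp: pair_graph_def pair_digraph_def pair_fin_digraph_def
      pair_fin_digraph_axioms_def)

lemma arc_sym: "(x, y) \<in> parcs G \<Longrightarrow> (y, x) \<in> parcs G"
  using pair_sym_digraph.pair_sym_arcs[of G] graph
  by (auto simp: pair_graph_def pair_pseudo_graph_def symmetric_def dest: symD)

lemma arc_V: "(x, y) \<in> parcs G \<Longrightarrow> x \<in> V \<and> y \<in> V"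
  using pair_wf_digraph.in_arcsD1[of G] pair_wf_digraph.in_arcsD2[of G] graph
  by (auto simp: pair_graph_def pair_pseudo_graph_def pair_sym_digraph_def)

lemma no_loop: "(x, x) \<notin> parcs G"
  using pair_loopfree_digraph.pair_no_loops[of G "(x, x)"] graph
  by (auto simp: pair_graph_def pair_digraph_def)

lemma nb_iff: "y \<in> nb x \<longleftrightarrow> (x, y) \<in> parcs G"
  by (simp add: neighbours_def)

lemma nb_sym: "y \<in> nb x \<longleftrightarrow> x \<in> nb y"
  by (auto simp: nb_iff intro: arc_sym)

lemma nb_subset: "nb x \<subseteq> V"
  using arc_V by (auto simp: nb_iff)

lemma finite_nb [simp]: "finite (nb x)"
  using nb_subset finite_V by (rule finite_subset)

lemma nb_irrefl: "x \<notin> nb x"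
  by (simp add: nb_iff no_loop)

lemma reach:
  assumes "x \<in> V" "y \<in> V"
  shows "(x, y) \<in> (parcs G)\<^sup>*"
proof -
  have "(x, y) \<in> rtrancl_on V ((parcs G)\<^sup>s)"
    using conn assms by (simp add: connected_conv)
  then have "(x, y) \<in> ((parcs G)\<^sup>s)\<^sup>*"
    by (rule rtrancl_on_rtranclI)
  moreover have "(parcs G)\<^sup>s = parcs G"
    by (auto simp: symcl_def intro: arc_sym)
  ultimately show ?thesis by simp
qed

text \<open>This makes \<open>pmf_of_set (nb x)\<close> in a lazy step a genuine uniform
  law.\<close>

lemma nb_nonempty:
  assumes "x \<in> V"
  shows "nb x \<noteq> {}"
proof -
  obtain y where "y \<in> V" "y \<noteq> x"
    using two assms finite_V by (metis card_le_Suc0_iff_eq not_less_eq_eq numeral_2_eq_2)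
  with reach[OF assms] show ?thesis
    by (metis converse_rtranclE empty_iff nb_iff)
qed

lemma dg_pos: "x \<in> V \<Longrightarrow> 0 < dg G x"
  using nb_nonempty by (simp add: dg_def card_gt_0_iff)

lemma dg_less: "x \<in> V \<Longrightarrow> dg G x < card V"
  unfolding dg_def using nb_subset[of x] nb_irrefl[of x] finite_V
  by (intro psubset_card_mono) auto

lemma out_degree_eq: "out_degree G x = dg G x"
proof -
  have "out_arcs G x = Pair x ` nb x"
    by (auto simp: out_arcs_def nb_iff)
  then show ?thesis
    by (simp add: out_degree_def dg_def card_image inj_on_def)
qed

lemma parcs_Sigma: "parcs G = Sigma V nb"
  using arc_V by (auto simp: nb_iff)

lemma sum_dg: "(\<Sum>x\<in>V. real (dg G x)) = vol"
  unfolding vol_def by (subst parcs_Sigma) (simp add: finite_V dg_def)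

lemma vol_edges: "2 * real (num_edges G) = vol"
proof -
  let ?A = "{(x, y). (x, y) \<in> parcs G \<and> x < y}"
  have fin: "finite ?A" using finite_arcs by (rule rev_finite_subset) auto
  have "parcs G = ?A \<union> prod.swap ` ?A"
  proof (intro equalityI subsetI)
    fix e assume "e \<in> parcs G"
    then show "e \<in> ?A \<union> prod.swap ` ?A"
      using no_loop[of "fst e"] arc_sym[of "fst e" "snd e"]
      by (cases e; cases "fst e" "snd e" rule: linorder_cases) (auto simp: image_iff)
  qed (auto dest: arc_sym)
  then have "card (parcs G) = card (?A \<union> prod.swap ` ?A)" by (rule arg_cong)
  also have "\<dots> = card ?A + card (prod.swap ` ?A)"
    using fin by (intro card_Un_disjoint) auto
  finally have "card (parcs G) = 2 * card ?A"
    by (simp add: card_image)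
  then show ?thesis by (simp add: num_edges_def vol_def)
qed

lemma vol_ge_n: "n \<le> vol"
proof -
  have "n = (\<Sum>x\<in>V. 1)" by (simp add: n_def)
  also have "\<dots> \<le> (\<Sum>x\<in>V. real (dg G x))"
    by (intro sum_mono) (use dg_pos in \<open>force simp: Suc_le_eq\<close>)
  finally show ?thesis by (simp add: sum_dg)
qed

lemma vol_pos: "0 < vol"
  using vol_ge_n n_ge_2 by linarith

lemma vol_le: "vol \<le> n ^ 2"
proof -
  have "vol \<le> (\<Sum>x\<in>V. n)"
    unfolding sum_dg[symmetric] n_def
    by (intro sum_mono) (use dg_less in \<open>force intro: less_imp_le\<close>)
  then show ?thesis by (simp add: n_def power2_eq_square)
qed

definition stat :: "nat \<Rightarrow> real" where
  "stat w = real (dg G w) / vol"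

lemma stat_pos: "w \<in> V \<Longrightarrow> 0 < stat w"
  using dg_pos vol_pos by (simp add: stat_def)

lemma sum_stat: "(\<Sum>w\<in>V. stat w) = 1"
  using sum_dg vol_pos by (simp add: stat_def flip: sum_divide_distrib)

section \<open>Laws of the walk, reversibility and stationarity\<close>

lemma pmf_lazy_step:
  assumes "x \<in> V"
  shows "pmf (lazy_step G x) y =
    (if x = y then 1 / 2 else 0) + (if y \<in> nb x then 1 / (2 * real (dg G x)) else 0)"
  using nb_nonempty[OF assms]
  by (auto simp: lazy_step_def pmf_bind integral_bernoulli_pmf dg_def indicator_def)

lemma set_lazy_step:
  assumes "x \<in> V"
  shows "set_pmf (lazy_step G x) = insert x (nb x)"
proof -
  have "set_pmf (lazy_step G x) = set_pmf (return_pmf x) \<union> set_pmf (pmf_of_set (nb x))"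
    by (simp add: lazy_step_def UNIV_bool Un_commute)
  then show ?thesis
    using nb_nonempty[OF assms] by simp
qed

lemma set_lazy_walk:
  assumes "u \<in> V"
  shows "set_pmf (lazy_walk G u t) \<subseteq> V"
proof (induction t)
  case (Suc t)
  then show ?case using set_lazy_step nb_subset by fastforce
qed (use assms in simp)

lemma pmf_bind_V:
  assumes "set_pmf p \<subseteq> V"
  shows "pmf (p \<bind> f) y = (\<Sum>x\<in>V. pmf p x * pmf (f x) y)"
  unfolding pmf_bind
  by (subst integral_measure_pmf_real[where A = V]) (use assms finite_V in \<open>auto simp: mult.commute\<close>)

lemma sum_pmf_V:
  assumes "set_pmf p \<subseteq> V"
  shows "(\<Sum>x\<in>V. pmf p x) = 1"
  using assms finite_V by (rule sum_pmf_eq_1[rotated])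

lemma lazy_walk_add: "lazy_walk G u (s + t) = lazy_walk G u s \<bind> (\<lambda>x. lazy_walk G x t)"
  by (induction t) (simp_all add: bind_return_pmf' bind_assoc_pmf)

lemma pmf_lazy_walk_add:
  assumes "u \<in> V"
  shows "pmf (lazy_walk G u (s + t)) w = (\<Sum>x\<in>V. pmf (lazy_walk G u s) x * pmf (lazy_walk G x t) w)"
  unfolding lazy_walk_add by (rule pmf_bind_V) (rule set_lazy_walk[OF assms])

lemma lazy_step_reversible:
  assumes "x \<in> V" "y \<in> V"
  shows "real (dg G x) * pmf (lazy_step G x) y = real (dg G y) * pmf (lazy_step G y) x"
  using assms dg_pos[of x] dg_pos[of y] nb_sym[of x y] by (simp add: pmf_lazy_step)

text \<open>Detailed balance turns the last step from \<open>x\<close> to \<open>w\<close> into one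
  from \<open>w\<close> to \<open>x\<close>, and the probabilities of the steps from
  \<open>w\<close> add up to 1.\<close>

lemma stationary:
  assumes "w \<in> V"
  shows "(\<Sum>u\<in>V. real (dg G u) * pmf (lazy_walk G u t) w) = real (dg G w)"
  using assms
proof (induction t arbitrary: w)
  case 0
  have "(\<Sum>u\<in>V. real (dg G u) * pmf (lazy_walk G u 0) w) = (\<Sum>u\<in>V. if u = w then real (dg G w) else 0)"
    by (intro sum.cong) (auto simp: indicator_def)
  then show ?case using 0 finite_V by simp
next
  case (Suc t)
  have "(\<Sum>u\<in>V. real (dg G u) * pmf (lazy_walk G u (Suc t)) w) =
      (\<Sum>u\<in>V. \<Sum>x\<in>V. real (dg G u) * pmf (lazy_walk G u t) x * pmf (lazy_step G x) w)"
    by (intro sum.cong refl) (simp add: pmf_bind_V set_lazy_walk sum_distrib_left mult.assoc)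
  also have "\<dots> = (\<Sum>x\<in>V. (\<Sum>u\<in>V. real (dg G u) * pmf (lazy_walk G u t) x) * pmf (lazy_step G x) w)"
    by (subst sum.swap) (simp add: sum_distrib_right)
  also have "\<dots> = (\<Sum>x\<in>V. real (dg G x) * pmf (lazy_step G x) w)"
    by (intro sum.cong refl) (use Suc.IH in simp)
  also have "\<dots> = (\<Sum>x\<in>V. real (dg G w) * pmf (lazy_step G w) x)"
    by (intro sum.cong refl lazy_step_reversible Suc.prems)
  also have "\<dots> = real (dg G w)"
    using sum_pmf_V[of "lazy_step G w"] set_lazy_step[OF Suc.prems] nb_subset Suc.prems
    by (simp flip: sum_distrib_left)
  finally show ?case .
qed

subsection \<open>Contraction\<close>

definition energy :: "(nat \<Rightarrow> real) \<Rightarrow> real" where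
  "energy f = (\<Sum>x\<in>V. real (dg G x) * (f x)\<^sup>2)"

text \<open>Both directions of an edge contribute, so this is twice the usual sum over
  edges.\<close>

definition dirichlet :: "(nat \<Rightarrow> real) \<Rightarrow> real" where
  "dirichlet f = (\<Sum>x\<in>V. \<Sum>y\<in>nb x. (f x - f y)\<^sup>2)"

definition walk_op :: "(nat \<Rightarrow> real) \<Rightarrow> nat \<Rightarrow> real" where
  "walk_op f x = (\<Sum>y\<in>V. pmf (lazy_step G x) y * f y)"

lemma walk_op_eq:
  assumes "x \<in> V"
  shows "walk_op f x = f x / 2 + (\<Sum>y\<in>nb x. f y) / (2 * real (dg G x))"
proof -
  have "walk_op f x = (\<Sum>y\<in>V. (if y = x then f x / 2 else 0) +
      (if y \<in> nb x then f y / (2 * real (dg G x)) else 0))"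
    unfolding walk_op_def by (intro sum.cong refl) (auto simp: pmf_lazy_step assms algebra_simps)
  also have "\<dots> = f x / 2 + (\<Sum>y\<in>V \<inter> nb x. f y / (2 * real (dg G x)))"
    using assms finite_V by (simp add: sum.distrib sum.inter_restrict)
  also have "V \<inter> nb x = nb x" using nb_subset by blast
  finally show ?thesis by (simp add: sum_divide_distrib)
qed

lemma sum_nb_swap: "(\<Sum>x\<in>V. \<Sum>y\<in>nb x. g y) = (\<Sum>y\<in>V. real (dg G y) * g y)" for g :: "nat \<Rightarrow> real"
proof -
  have "(\<Sum>x\<in>V. \<Sum>y\<in>nb x. g y) = (\<Sum>x\<in>V. \<Sum>y\<in>{y\<in>V. y \<in> nb x}. g y)"
    using nb_subset by (intro sum.cong) auto
  also have "\<dots> = (\<Sum>y\<in>V. \<Sum>x\<in>{x\<in>V. y \<in> nb x}. g y)"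
    using finite_V by (rule sum.swap_restrict[OF _ finite_V])
  also have "\<dots> = (\<Sum>y\<in>V. \<Sum>x\<in>nb y. g y)"
    using nb_subset nb_sym by (intro sum.cong) auto
  finally show ?thesis by (simp add: dg_def)
qed

text \<open>At \<open>x\<close> the operator returns the mean of \<open>f x\<close> and the average
  over the neighbours. Cauchy-Schwarz handles the square of that average, and the cross term is
  traded for squared differences along the arcs at \<open>x\<close>. Without the lazy half there
  would be no loss on bipartite networks.\<close>

lemma energy_walk_op: "energy (walk_op f) \<le> energy f - dirichlet f / 4"
proof -
  have "real (dg G x) * (walk_op f x)\<^sup>2 \<le>
      real (dg G x) * (f x)\<^sup>2 / 2 + (\<Sum>y\<in>nb x. (f y)\<^sup>2) / 2 - (\<Sum>y\<in>nb x. (f x - f y)\<^sup>2) / 4"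
    if x: "x \<in> V" for x
  proof -
    define d s q where "d = real (dg G x)" and "s = (\<Sum>y\<in>nb x. f y)" and "q = (\<Sum>y\<in>nb x. (f y)\<^sup>2)"
    have d: "0 < d" using dg_pos[OF x] by (simp add: d_def)
    have "s\<^sup>2 \<le> d * q"
      using sum_squared_le_sum_of_squares[of f "nb x"] by (simp add: d_def s_def q_def dg_def mult.commute)
    then have "s\<^sup>2 / d \<le> q" using d by (simp add: divide_le_eq mult.commute)
    moreover have "(\<Sum>y\<in>nb x. (f x - f y)\<^sup>2) = d * (f x)\<^sup>2 - 2 * f x * s + q"
      by (simp add: power2_diff sum.distrib sum_subtractf d_def s_def q_def dg_def sum_distrib_left)
    moreover have "d * (walk_op f x)\<^sup>2 = d * (f x)\<^sup>2 / 4 + f x * s / 2 + s\<^sup>2 / d / 4"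
      using d unfolding walk_op_eq[OF x] d_def[symmetric] s_def[symmetric]
      by (simp add: field_simps power2_eq_square)
    ultimately show ?thesis
      unfolding d_def[symmetric] q_def[symmetric] by (simp add: field_simps)
  qed
  then have "energy (walk_op f) \<le> (\<Sum>x\<in>V. real (dg G x) * (f x)\<^sup>2 / 2 + (\<Sum>y\<in>nb x. (f y)\<^sup>2) / 2 -
      (\<Sum>y\<in>nb x. (f x - f y)\<^sup>2) / 4)"
    unfolding energy_def by (rule sum_mono)
  also have "\<dots> = energy f - dirichlet f / 4"
    using sum_nb_swap[of "\<lambda>y. (f y)\<^sup>2"]
    by (simp add: sum.distrib sum_subtractf energy_def dirichlet_def flip: sum_divide_distrib)
  finally show ?thesis .
qed

lemma dirichlet_nonneg: "0 \<le> dirichlet f"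
  unfolding dirichlet_def by (intro sum_nonneg) auto

lemma arc_diff_le:
  assumes "(x, y) \<in> parcs G"
  shows "\<bar>f x - f y\<bar> \<le> sqrt (dirichlet f)"
proof -
  have x: "x \<in> V" and y: "y \<in> nb x" using assms arc_V by (auto simp: nb_iff)
  have "(f x - f y)\<^sup>2 \<le> (\<Sum>y\<in>nb x. (f x - f y)\<^sup>2)"
    using y by (intro member_le_sum) auto
  also have "\<dots> \<le> dirichlet f"
    unfolding dirichlet_def using x finite_V
    by (intro member_le_sum[where f = "\<lambda>x. \<Sum>y\<in>nb x. (f x - f y)\<^sup>2"] sum_nonneg) auto
  finally show ?thesis by (simp add: real_le_rsqrt)
qed

text \<open>A connecting path has at most \<open>card (parcs G)\<close> arcs, each changing
  \<open>f\<close> by at most \<open>sqrt (dirichlet f)\<close>. The crude length suffices, since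
  only a polynomial is wanted.\<close>

lemma diff_le:
  assumes "x \<in> V" "y \<in> V"
  shows "\<bar>f x - f y\<bar> \<le> vol * sqrt (dirichlet f)"
proof -
  have path: "\<bar>f x - f y\<bar> \<le> real k * sqrt (dirichlet f)" if "(x, y) \<in> parcs G ^^ k" for k y
    using that
  proof (induction k arbitrary: y)
    case (Suc k)
    then obtain z where z: "(x, z) \<in> parcs G ^^ k" "(z, y) \<in> parcs G" by auto
    from Suc.IH[OF z(1)] arc_diff_le[OF z(2), of f] show ?case by (simp add: algebra_simps)
  qed auto
  obtain k where k: "(x, y) \<in> parcs G ^^ k" "k \<le> card (parcs G)"
    using reach[OF assms] by (auto simp: rtrancl_finite_eq_relpow finite_arcs)
  have "real k * sqrt (dirichlet f) \<le> vol * sqrt (dirichlet f)"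
    unfolding vol_def using k(2) dirichlet_nonneg by (intro mult_right_mono) auto
  with path[OF k(1)] show ?thesis by linarith
qed

text \<open>As the weighted mean vanishes, \<open>vol * f u\<close> is the weighted sum of the
  differences \<open>f u - f x\<close>, so \<open>diff_le\<close> bounds \<open>f u\<close> itself.
  The exponent 6 comes from \<open>vol ^ 3\<close> and \<open>vol_le\<close>.\<close>

lemma poincare:
  assumes mean: "(\<Sum>x\<in>V. real (dg G x) * f x) = 0"
  shows "energy f \<le> n ^ 6 * dirichlet f"
proof -
  have *: "\<bar>f u\<bar> \<le> vol * sqrt (dirichlet f)" if u: "u \<in> V" for u
  proof -
    have "vol * f u = (\<Sum>x\<in>V. real (dg G x) * (f u - f x))"
      using mean sum_dg by (simp add: right_diff_distrib sum_subtractf flip: sum_distrib_right)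
    then have "vol * \<bar>f u\<bar> = \<bar>\<Sum>x\<in>V. real (dg G x) * (f u - f x)\<bar>"
      using vol_pos by (metis abs_mult abs_of_pos)
    also have "\<dots> \<le> (\<Sum>x\<in>V. \<bar>real (dg G x) * (f u - f x)\<bar>)"
      by (rule sum_abs)
    also have "\<dots> \<le> (\<Sum>x\<in>V. real (dg G x) * (vol * sqrt (dirichlet f)))"
      by (intro sum_mono) (use diff_le u in \<open>auto simp: abs_mult intro!: mult_left_mono\<close>)
    also have "\<dots> = vol * (vol * sqrt (dirichlet f))"
      using sum_dg by (simp flip: sum_distrib_right)
    finally show ?thesis using vol_pos by simp
  qed
  have "(f u)\<^sup>2 \<le> vol\<^sup>2 * dirichlet f" if "u \<in> V" for u
  proof -
    have "(f u)\<^sup>2 \<le> (vol * sqrt (dirichlet f))\<^sup>2"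
      using *[OF that] by (metis abs_ge_zero power2_abs power_mono)
    then show ?thesis using dirichlet_nonneg by (simp add: power_mult_distrib)
  qed
  then have "energy f \<le> (\<Sum>x\<in>V. real (dg G x) * (vol\<^sup>2 * dirichlet f))"
    unfolding energy_def by (intro sum_mono mult_left_mono) auto
  also have "\<dots> = vol ^ 3 * dirichlet f"
    using sum_dg by (simp add: power2_eq_square power3_eq_cube flip: sum_distrib_right)
  also have "\<dots> \<le> (n\<^sup>2) ^ 3 * dirichlet f"
    using vol_le vol_pos dirichlet_nonneg by (intro mult_right_mono power_mono) auto
  finally show ?thesis by (simp flip: power_mult)
qed

lemma gap_le_1: "1 / (4 * n ^ 6) \<le> 1"
proof -
  have "1 \<le> n ^ 6" using n_ge_2 by (intro one_le_power) simp
  then show ?thesis by (simp add: divide_le_eq_1)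
qed

lemma energy_contract:
  assumes "(\<Sum>x\<in>V. real (dg G x) * f x) = 0"
  shows "energy (walk_op f) \<le> (1 - 1 / (4 * n ^ 6)) * energy f"
proof -
  have "energy f / (4 * n ^ 6) \<le> dirichlet f / 4"
    using poincare[OF assms] n_ge_2 by (simp add: divide_simps mult.commute)
  with energy_walk_op[of f] show ?thesis by (simp add: algebra_simps)
qed

text \<open>Read as a function of the start \<open>x\<close> with the end \<open>w\<close> fixed:
  then the first step of the walk acts by \<open>walk_op\<close>, and stationarity gives weighted
  mean 0, as the contraction requires.\<close>

definition excess :: "nat \<Rightarrow> nat \<Rightarrow> nat \<Rightarrow> real" where
  "excess w t x = pmf (lazy_walk G x t) w - stat w"

lemma excess_mean:
  assumes "w \<in> V"
  shows "(\<Sum>x\<in>V. real (dg G x) * excess w t x) = 0"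
proof -
  have "(\<Sum>x\<in>V. real (dg G x) * excess w t x) = real (dg G w) - (\<Sum>x\<in>V. real (dg G x)) * stat w"
    using stationary[OF assms, of t]
    by (simp add: excess_def right_diff_distrib sum_subtractf sum_distrib_right)
  then show ?thesis using vol_pos by (simp add: sum_dg stat_def)
qed

lemma excess_Suc:
  assumes "u \<in> V"
  shows "excess w (Suc t) u = walk_op (excess w t) u"
proof -
  have "lazy_walk G u 1 = lazy_step G u" by (simp add: bind_return_pmf)
  then have "pmf (lazy_walk G u (Suc t)) w = (\<Sum>x\<in>V. pmf (lazy_step G u) x * pmf (lazy_walk G x t) w)"
    using pmf_lazy_walk_add[OF assms, of 1 t w] by simp
  moreover have "(\<Sum>x\<in>V. pmf (lazy_step G u) x) = 1"
    using set_lazy_step[OF assms] nb_subset assms by (intro sum_pmf_V) auto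
  ultimately show ?thesis
    by (simp add: excess_def walk_op_def right_diff_distrib sum_subtractf flip: sum_distrib_right)
qed

lemma stat_le_1: "w \<in> V \<Longrightarrow> stat w \<le> 1"
  using sum_stat member_le_sum[of w V stat] stat_pos finite_V by (metis DiffD1 less_imp_le)

lemma energy_excess:
  assumes w: "w \<in> V"
  shows "energy (excess w t) \<le> (1 - 1 / (4 * n ^ 6)) ^ t * n\<^sup>2"
proof (induction t)
  case 0
  have "\<bar>excess w 0 x\<bar> \<le> 1" if "x \<in> V" for x
    using stat_pos[OF w] stat_le_1[OF w] by (auto simp: excess_def indicator_def)
  then have "(excess w 0 x)\<^sup>2 \<le> 1" if "x \<in> V" for x
    using that by (simp add: abs_square_le_1)
  then have "energy (excess w 0) \<le> (\<Sum>x\<in>V. real (dg G x) * 1)"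
    unfolding energy_def by (intro sum_mono mult_left_mono) auto
  then show ?case using vol_le by (simp add: sum_dg)
next
  case (Suc t)
  have "(1 - 1 / (4 * n ^ 6)) * energy (excess w t) \<le>
      (1 - 1 / (4 * n ^ 6)) * ((1 - 1 / (4 * n ^ 6)) ^ t * n\<^sup>2)"
    using Suc.IH gap_le_1 by (intro mult_left_mono) auto
  moreover have "energy (excess w (Suc t)) = energy (walk_op (excess w t))"
    unfolding energy_def by (intro sum.cong refl) (simp add: excess_Suc)
  ultimately show ?case
    using energy_contract[OF excess_mean[OF w, of t]] by (simp add: mult.assoc)
qed

subsection \<open>Mixing time\<close>

definition mixed :: "nat \<Rightarrow> nat \<Rightarrow> bool" where
  "mixed k t \<longleftrightarrow> (\<forall>u\<in>V. \<forall>w\<in>V. \<bar>excess w t u\<bar> \<le> stat w / n ^ k)"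

lemma mixing_time_eq: "mixing_time G = (LEAST t. mixed 1 t)"
  unfolding mixing_time_def mixed_def excess_def out_degree_eq vol_edges stat_def n_def
  by (simp add: divide_divide_eq_left)

text \<open>Guarantees that the LEAST in \<open>mixing_time\<close> is attained, and bounds it by a
  polynomial.\<close>

lemma mixed_poly: "mixed 1 (32 * card V ^ 7)"
  unfolding mixed_def
proof (intro ballI)
  fix u w assume u: "u \<in> V" and w: "w \<in> V"
  define t where "t = 32 * card V ^ 7"
  have n1: "1 \<le> n" using n_ge_2 by simp
  have "(1 - 1 / (4 * n ^ 6)) ^ t \<le> exp (- (1 / (4 * n ^ 6))) ^ t"
    using gap_le_1 exp_ge_add_one_self[of "- (1 / (4 * n ^ 6))"] by (intro power_mono) auto
  \<comment> \<open>\<open>t / (4 * n ^ 6)\<close> is \<open>8 * n\<close>. Of the resulting eight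
    powers of \<open>n\<close>, two are spent on the initial energy; the other six give the error
    \<open>1 / n ^ 3\<close>, which \<open>stat w / n\<close> dominates because
    \<open>stat w\<close> is at least \<open>1 / n ^ 2\<close>.\<close>
  also have "\<dots> = exp (- (8 * n))"
    using n_ge_2 unfolding exp_of_nat_mult[symmetric] t_def n_def by (simp add: field_simps flip: power_Suc)
  also have "\<dots> = 1 / exp n ^ 8"
    by (simp add: exp_minus field_simps exp_of_nat_mult[symmetric])
  also have "\<dots> \<le> 1 / n ^ 8"
  proof -
    have "n \<le> exp n" using exp_ge_add_one_self[of n] by linarith
    then show ?thesis using n1 by (intro divide_left_mono power_mono mult_pos_pos) auto
  qed
  finally have "(1 - 1 / (4 * n ^ 6)) ^ t * n\<^sup>2 \<le> 1 / n ^ 8 * n\<^sup>2"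
    by (intro mult_right_mono) auto
  also have "\<dots> = (1 / n ^ 3)\<^sup>2"
    using n1 by (simp add: field_simps flip: power_mult power_add)
  finally have "energy (excess w t) \<le> (1 / n ^ 3)\<^sup>2"
    using energy_excess[OF w, of t] by linarith
  moreover have "(excess w t u)\<^sup>2 \<le> energy (excess w t)"
  proof -
    have "(excess w t u)\<^sup>2 \<le> real (dg G u) * (excess w t u)\<^sup>2"
      using dg_pos[OF u] by (simp add: mult_le_cancel_right1)
    also have "\<dots> \<le> energy (excess w t)"
      unfolding energy_def using u finite_V
      by (intro member_le_sum[where f = "\<lambda>x. real (dg G x) * (excess w t x)\<^sup>2"]) auto
    finally show ?thesis .
  qed
  ultimately have "\<bar>excess w t u\<bar> \<le> \<bar>1 / n ^ 3\<bar>"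
    by (meson abs_le_square_iff order_trans)
  also have "\<dots> \<le> stat w / n ^ 1"
  proof -
    have "1 / n\<^sup>2 \<le> 1 / vol"
      using vol_le vol_pos n1 by (intro divide_left_mono) auto
    also have "\<dots> \<le> stat w"
      using dg_pos[OF w] vol_pos by (simp add: stat_def divide_right_mono)
    finally show ?thesis using n1 by (simp add: field_simps power2_eq_square power3_eq_cube)
  qed
  finally show "\<bar>excess w (32 * card V ^ 7) u\<bar> \<le> stat w / n ^ 1"
    by (simp add: t_def)
qed

lemma mixing_time_mixed: "mixed 1 (mixing_time G)"
  unfolding mixing_time_eq using mixed_poly by (rule LeastI)

lemma mixing_time_le: "mixing_time G \<le> card V ^ 12"
proof -
  have "mixing_time G \<le> 32 * card V ^ 7"
    unfolding mixing_time_eq using mixed_poly by (rule Least_le)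
  also have "\<dots> \<le> card V ^ 5 * card V ^ 7"
    using power_mono[OF two, of 5] by (intro mult_right_mono) auto
  finally show ?thesis by (simp flip: power_add)
qed

text \<open>At time 0 two distinct nodes refute mixing. Positivity later absorbs additive constants
  into multiples of the mixing time.\<close>

lemma mixing_time_pos: "0 < mixing_time G"
proof (rule ccontr)
  assume "\<not> 0 < mixing_time G"
  then have m: "mixed 1 0" using mixing_time_mixed by simp
  obtain u w where uw: "u \<in> V" "w \<in> V" "u \<noteq> w"
    using two finite_V by (metis card_le_Suc0_iff_eq not_less_eq_eq numeral_2_eq_2)
  then have "\<bar>excess w 0 u\<bar> \<le> stat w / n" using m by (auto simp: mixed_def)
  then have "stat w \<le> stat w / n" using uw stat_pos by (simp add: excess_def)
  then show False using stat_pos[OF uw(2)] n_ge_2 by (simp add: le_divide_eq)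
qed

text \<open>The stationary part of the first \<open>s\<close> steps contributes 0, because
  \<open>excess w t\<close> has weighted mean 0. What remains is a sum of products of two excesses,
  so relative errors multiply.\<close>

lemma mixed_add:
  assumes s: "mixed k s" and t: "mixed l t"
  shows "mixed (k + l) (s + t)"
  unfolding mixed_def
proof (intro ballI)
  fix u w assume u: "u \<in> V" and w: "w \<in> V"
  have "(\<Sum>x\<in>V. stat x * excess w t x) = 0"
    using excess_mean[OF w, of t] vol_pos by (simp add: stat_def flip: sum_divide_distrib)
  moreover have "(\<Sum>x\<in>V. pmf (lazy_walk G u s) x * excess w t x) = excess w (s + t) u"
    using pmf_lazy_walk_add[OF u, of s t w] sum_pmf_V[OF set_lazy_walk[OF u, of s]]
    by (simp add: excess_def right_diff_distrib sum_subtractf flip: sum_distrib_right)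
  ultimately have "excess w (s + t) u = (\<Sum>x\<in>V. excess x s u * excess w t x)"
    by (simp add: excess_def[of _ s] left_diff_distrib sum_subtractf)
  also have "\<bar>\<dots>\<bar> \<le> (\<Sum>x\<in>V. \<bar>excess x s u * excess w t x\<bar>)"
    by (rule sum_abs)
  also have "\<dots> \<le> (\<Sum>x\<in>V. stat x / n ^ k * (stat w / n ^ l))"
    unfolding abs_mult
    by (intro sum_mono mult_mono) (use s t u w stat_pos n_ge_2 in \<open>auto simp: mixed_def less_imp_le\<close>)
  also have "\<dots> = stat w / n ^ (k + l)"
    using sum_stat by (simp add: power_add flip: sum_distrib_right sum_divide_distrib)
  finally show "\<bar>excess w (s + t) u\<bar> \<le> stat w / n ^ (k + l)" .
qed

text \<open>Averaging over the first \<open>s\<close> steps cannot enlarge the maximal error. Hence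
  a walk length may be rounded up to a power of two.\<close>

lemma mixed_later:
  assumes t: "mixed k t"
  shows "mixed k (s + t)"
  unfolding mixed_def
proof (intro ballI)
  fix u w assume u: "u \<in> V" and w: "w \<in> V"
  have one: "(\<Sum>x\<in>V. pmf (lazy_walk G u s) x) = 1"
    by (rule sum_pmf_V[OF set_lazy_walk[OF u]])
  then have "excess w (s + t) u = (\<Sum>x\<in>V. pmf (lazy_walk G u s) x * excess w t x)"
    using pmf_lazy_walk_add[OF u, of s t w]
    by (simp add: excess_def right_diff_distrib sum_subtractf flip: sum_distrib_right)
  also have "\<bar>\<dots>\<bar> \<le> (\<Sum>x\<in>V. \<bar>pmf (lazy_walk G u s) x * excess w t x\<bar>)"
    by (rule sum_abs)
  also have "\<dots> \<le> (\<Sum>x\<in>V. pmf (lazy_walk G u s) x * (stat w / n ^ k))"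
    unfolding abs_mult by (intro sum_mono mult_mono) (use t w in \<open>auto simp: mixed_def\<close>)
  also have "\<dots> = stat w / n ^ k"
    using one by (simp flip: sum_distrib_right sum_divide_distrib)
  finally show "\<bar>excess w (s + t) u\<bar> \<le> stat w / n ^ k" .
qed

lemma mixed_iterate:
  assumes "Suc k * mixing_time G \<le> t"
  shows "mixed (Suc k) t"
proof -
  have "mixed (Suc k) (Suc k * mixing_time G)"
  proof (induction k)
    case (Suc k)
    from mixed_add[OF mixing_time_mixed this] show ?case by simp
  qed (use mixing_time_mixed in simp)
  from mixed_later[OF this, of "t - Suc k * mixing_time G"] assms show ?thesis
    by simp
qed

end

section \<open>Encodings\<close>

text \<open>Choosing the list by \<open>SOME\<close> makes it a function of the set alone: whoever
  knows the set knows the list, in any execution.\<close>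

definition enum :: "'a set \<Rightarrow> 'a list" where
  "enum A = (SOME xs. distinct xs \<and> set xs = A)"

lemma enum:
  assumes "finite A"
  shows distinct_enum: "distinct (enum A)" and set_enum: "set (enum A) = A"
proof -
  have "\<exists>xs. distinct xs \<and> set xs = A"
    using finite_distinct_list[OF assms] by blast
  from someI_ex[OF this] show "distinct (enum A)" "set (enum A) = A"
    by (simp_all add: enum_def)
qed

lemma length_enum: "finite A \<Longrightarrow> length (enum A) = card A"
  by (metis distinct_card distinct_enum set_enum)

text \<open>The number with binary digits \<open>bs\<close>, lowest first, followed by a leading 1
  that records the length.\<close>

primrec mcode :: "msg \<Rightarrow> nat" where
  "mcode [] = 1"
| "mcode (b # bs) = of_bool b + 2 * mcode bs"

lemma mcode_pos: "0 < mcode bs"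
  by (induction bs) auto

lemma mcode_inj: "mcode xs = mcode ys \<Longrightarrow> xs = ys"
proof (induction xs arbitrary: ys)
  case Nil
  then show ?case using mcode_pos[of "tl ys"] by (cases ys) auto
next
  case (Cons x xs)
  then obtain y ys' where ys: "ys = y # ys'"
    using mcode_pos[of xs] by (cases ys) (auto simp: of_bool_def split: if_splits)
  from Cons.prems have "of_bool x + 2 * mcode xs = of_bool y + 2 * mcode ys'" by (simp add: ys)
  then have "x = y \<and> mcode xs = mcode ys'"
    by (cases x; cases y; simp; presburger)
  with Cons.IH show ?case by (simp add: ys)
qed

lemma mcode_surj: "0 < k \<Longrightarrow> \<exists>bs. mcode bs = k"
proof (induction k rule: less_induct)
  case (less k)
  show ?case
  proof (cases "k = 1")
    case True
    then show ?thesis by (intro exI[of _ "[]"]) simp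
  next
    case False
    then obtain bs where "mcode bs = k div 2" using less by force
    then have "mcode (odd k # bs) = k" by simp
    then show ?thesis ..
  qed
qed

lemma mcode_lower: "2 ^ length bs \<le> mcode bs"
proof (induction bs)
  case (Cons b bs)
  then have "2 * 2 ^ length bs \<le> 2 * mcode bs" by simp
  then show ?case by simp
qed simp

lemma mcode_upper: "mcode bs < 2 ^ Suc (length bs)"
proof (induction bs)
  case (Cons b bs)
  have "mcode (b # bs) \<le> 1 + 2 * mcode bs" by simp
  also have "\<dots> < 2 * 2 ^ Suc (length bs)" using Cons.IH by linarith
  finally show ?case by simp
qed simp

text \<open>The offset 2 skips code 1, the empty string, which means silence in the CONGEST model.
  Every number is therefore audible, at a logarithmic cost.\<close>

definition bits :: "nat \<Rightarrow> msg" where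
  "bits k = (SOME bs. mcode bs = k + 2)"

lemma mcode_bits: "mcode (bits k) = k + 2"
proof -
  have "\<exists>bs. mcode bs = k + 2" by (rule mcode_surj) simp
  then show ?thesis unfolding bits_def by (rule someI_ex)
qed

lemma bits_inj: "bits k = bits l \<Longrightarrow> k = l"
  by (metis add_right_cancel mcode_bits)

lemma bits_not_Nil: "bits k \<noteq> []"
  by (metis mcode.simps(1) mcode_bits add_2_eq_Suc' nat.distinct(1) nat.inject One_nat_def)

lemma length_bits: "2 ^ length (bits k) \<le> k + 2"
  by (metis mcode_bits mcode_lower)

primrec actcode :: "gossip_action \<Rightarrow> nat" where
  "actcode (Push m) = 2 + mcode m"
| "actcode Pull = 1"
| "actcode Idle = 0"

lemma actcode_inj: "actcode a = actcode b \<Longrightarrow> a = b"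
  by (cases a; cases b) (auto dest: mcode_inj)

text \<open>Entries are shifted by one so that 0 marks the end of a record.\<close>

definition flat_record :: "(nat \<times> nat) \<times> nat list \<Rightarrow> nat list" where
  "flat_record r = Suc (fst (fst r)) # Suc (snd (fst r)) # map Suc (snd r) @ [0]"

definition flat_records :: "((nat \<times> nat) \<times> nat list) list \<Rightarrow> nat list" where
  "flat_records rs = concat (map flat_record rs)"

lemma map_Suc_0_append:
  "map Suc xs @ 0 # as = map Suc ys @ 0 # bs \<Longrightarrow> xs = ys \<and> as = bs"
proof (induction xs arbitrary: ys)
  case Nil
  then show ?case by (cases ys) auto
next
  case (Cons x xs)
  then show ?case by (cases ys) auto
qed

lemma flat_records_inj: "flat_records rs = flat_records ss \<Longrightarrow> rs = ss"
proof (induction rs arbitrary: ss)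
  case Nil
  then show ?case by (cases ss) (auto simp: flat_records_def flat_record_def)
next
  case (Cons r rs)
  then obtain s ss' where ss: "ss = s # ss'"
    by (cases ss) (auto simp: flat_records_def flat_record_def)
  have eq: "fst r = fst s" "map Suc (snd r) @ 0 # flat_records rs = map Suc (snd s) @ 0 # flat_records ss'"
    using Cons.prems by (auto simp: ss flat_records_def flat_record_def prod_eq_iff)
  from map_Suc_0_append[OF eq(2)] eq(1) Cons.IH[of ss'] show ?case
    by (simp add: ss prod_eq_iff)
qed

lemma concat_pairs_inj:
  assumes "concat (map (\<lambda>u. [u, f u]) xs) = concat (map (\<lambda>u. [u, g u]) ys)"
  shows "xs = ys \<and> (\<forall>u\<in>set xs. f u = g u)"
  using assms
proof (induction xs arbitrary: ys)
  case Nil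
  then show ?case by (cases ys) auto
next
  case (Cons x xs)
  then show ?case by (cases ys) auto
qed

section \<open>The token protocol\<close>

type_synonym seeds = "nat \<times> (nat \<times> nat) \<times> nat \<Rightarrow> nat"

text \<open>
  Token \<open>(u, j)\<close> starts at \<open>u\<close> and takes \<open>T\<close> lazy steps, the \<open>s\<close>-th of them at node \<open>x\<close> being
  \<open>\<omega> (x, (u, j), s)\<close>.  Tokens with \<open>j < S\<close> look for a home of \<open>u\<close>, the others carry requests of \<open>u\<close>.
  The seed at position \<open>Tm + q\<close> is a uniform number below \<open>q\<close>.
\<close>

locale token_protocol =
  fixes S J Tm T :: nat
  assumes S_pos: "0 < S" and S_le_J: "S \<le> J" and T_pos: "0 < T"
begin

primrec path :: "seeds \<Rightarrow> nat \<times> nat \<Rightarrow> nat \<Rightarrow> nat" where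
  "path \<omega> l 0 = fst l"
| "path \<omega> l (Suc s) = \<omega> (path \<omega> l s, l, s)"

definition dest :: "seeds \<Rightarrow> nat \<times> nat \<Rightarrow> nat" where
  "dest \<omega> l = path \<omega> l T"

definition tokens :: "network \<Rightarrow> (nat \<times> nat) set" where
  "tokens G = pverts G \<times> {..<J}"

text \<open>Ties are broken by the LEAST index, so \<open>v\<close> needs to learn nothing but the
  degrees of its destinations.\<close>

definition home_index :: "network \<Rightarrow> seeds \<Rightarrow> nat \<Rightarrow> nat" where
  "home_index G \<omega> v =
     (LEAST j. j < S \<and> (\<forall>i<S. dg G (dest \<omega> (v, i)) \<le> dg G (dest \<omega> (v, j))))"

definition home :: "network \<Rightarrow> seeds \<Rightarrow> nat \<Rightarrow> nat" where
  "home G \<omega> v = dest \<omega> (v, home_index G \<omega> v)"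

definition residents :: "network \<Rightarrow> seeds \<Rightarrow> nat \<Rightarrow> nat set" where
  "residents G \<omega> w = {v\<in>pverts G. home G \<omega> v = w}"

text \<open>A positive integer strictly above the ratio. Multiplied by the degree it exceeds
  \<open>card (pverts G) * card (residents G \<omega> w)\<close>, so a coin below
  \<open>dg G w * peak G \<omega>\<close> has room for \<open>card (pverts G)\<close> values per
  resident.\<close>

definition density :: "network \<Rightarrow> seeds \<Rightarrow> nat \<Rightarrow> nat" where
  "density G \<omega> w = card (pverts G) * card (residents G \<omega> w) div dg G w + 1"

primrec flood :: "network \<Rightarrow> seeds \<Rightarrow> nat \<Rightarrow> nat \<Rightarrow> nat" where
  "flood G \<omega> 0 w = density G \<omega> w"
| "flood G \<omega> (Suc s) w = Max (flood G \<omega> s ` insert w (neighbours G w))"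

definition peak :: "network \<Rightarrow> seeds \<Rightarrow> nat" where
  "peak G \<omega> = Max (density G \<omega> ` pverts G)"

text \<open>
  A request at \<open>w\<close> is answered by each resident of \<open>w\<close> with probability \<open>n / (deg w * peak)\<close>; since a
  walk ends at \<open>w\<close> with probability about \<open>deg w / 2 m\<close>, all nodes are equally likely answers.
\<close>

definition answer :: "network \<Rightarrow> seeds \<Rightarrow> nat \<times> nat \<Rightarrow> nat option" where
  "answer G \<omega> l = (let w = dest \<omega> l; c = \<omega> (w, l, Tm + dg G w * peak G \<omega>) in
     if c < card (pverts G) * card (residents G \<omega> w)
     then Some (enum (residents G \<omega> w) ! (c div card (pverts G))) else None)"

definition hits :: "network \<Rightarrow> seeds \<Rightarrow> nat \<Rightarrow> nat set" where
  "hits G \<omega> u = {j\<in>{S..<J}. answer G \<omega> (u, j) \<noteq> None}"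

text \<open>Taking the largest index lets the law of the result be computed by recursion on the
  number of requests, see \<open>last_hit\<close>.\<close>

definition chosen :: "network \<Rightarrow> seeds \<Rightarrow> nat \<Rightarrow> nat" where
  "chosen G \<omega> u = Max (hits G \<omega> u)"

definition target :: "network \<Rightarrow> seeds \<Rightarrow> nat \<Rightarrow> nat" where
  "target G \<omega> u = the (answer G \<omega> (u, chosen G \<omega> u))"

definition callers :: "network \<Rightarrow> seeds \<Rightarrow> nat \<Rightarrow> nat set" where
  "callers G \<omega> v = {u\<in>pverts G. target G \<omega> u = v}"

definition act :: "network \<Rightarrow> (nat \<Rightarrow> gossip_task) \<Rightarrow> seeds \<Rightarrow> nat \<Rightarrow> nat" where
  "act G task \<omega> u = actcode (task_action (task u) (target G \<omega> u))"

definition response :: "network \<Rightarrow> (nat \<Rightarrow> gossip_task) \<Rightarrow> seeds \<Rightarrow> nat \<Rightarrow> nat \<Rightarrow> nat" where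
  "response G task \<omega> v u = mcode (task_reply (task v) (target G \<omega> v) u)"

text \<open>
  There are nine passes of \<open>T\<close> rounds.  In passes 0, 2, 5, 7 the tokens retrace their walks from
  origin to destination, in passes 1, 4, 6, 8 backwards; pass 3 floods the maximal density.  The
  payload of token \<open>l\<close> in pass \<open>k\<close> is \<open>pay k l\<close>.
\<close>

definition pay :: "network \<Rightarrow> (nat \<Rightarrow> gossip_task) \<Rightarrow> seeds \<Rightarrow> nat \<Rightarrow> nat \<times> nat \<Rightarrow> nat list" where
  "pay G task \<omega> k l =
     (if k = 1 then [dg G (dest \<omega> l)]
      else if k = 2 then [if snd l = home_index G \<omega> (fst l) then 1 else 0]
      else if k = 4 then (case answer G \<omega> l of None \<Rightarrow> [] | Some v \<Rightarrow> [v])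
      else if k = 5 then (if snd l = chosen G \<omega> (fst l) then [act G task \<omega> (fst l)] else [])
      else if k = 6 then (if snd l = home_index G \<omega> (fst l)
        then concat (map (\<lambda>u. [u, act G task \<omega> u]) (enum (callers G \<omega> (fst l)))) else [])
      else if k = 7 then (if snd l = home_index G \<omega> (fst l)
        then concat (map (\<lambda>u. [u, response G task \<omega> (fst l) u]) (enum (callers G \<omega> (fst l)))) else [])
      else if k = 8 then (if snd l = chosen G \<omega> (fst l)
        then [response G task \<omega> (target G \<omega> (fst l)) (fst l)] else [])
      else [])"

definition pos :: "seeds \<Rightarrow> nat \<Rightarrow> nat \<Rightarrow> nat \<times> nat \<Rightarrow> nat" where
  "pos \<omega> k s l = (if k \<in> {0, 2, 5, 7} then path \<omega> l s else path \<omega> l (T - s))"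

definition crossing :: "network \<Rightarrow> seeds \<Rightarrow> nat \<Rightarrow> nat \<Rightarrow> nat \<Rightarrow> nat \<Rightarrow> (nat \<times> nat) set" where
  "crossing G \<omega> k s x y = {l\<in>tokens G. pos \<omega> k s l = x \<and> pos \<omega> k (Suc s) l = y}"

text \<open>A message on a slow clock: tick \<open>f\<close> is step \<open>f mod T\<close> of pass
  \<open>f div T\<close>. It is a list of numbers, which \<open>thin_msg\<close> spreads over
  several rounds, one number per round.\<close>

definition fat :: "network \<Rightarrow> (nat \<Rightarrow> gossip_task) \<Rightarrow> seeds \<Rightarrow> nat \<Rightarrow> nat \<Rightarrow> nat \<Rightarrow> nat list" where
  "fat G task \<omega> f x y =
     (if f div T = 3 then [flood G \<omega> (f mod T) x]
      else flat_records (map (\<lambda>l. (l, pay G task \<omega> (f div T) l)) (enum (crossing G \<omega> (f div T) (f mod T) x y))))"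

text \<open>What the locality argument takes from a successful execution: flooding has told every
  node the global constant \<open>peak\<close>, and \<open>chosen\<close> is the maximum of a
  nonempty set.\<close>

definition sound :: "network \<Rightarrow> seeds \<Rightarrow> bool" where
  "sound G \<omega> \<longleftrightarrow> connected_network G \<and>
     (\<forall>x\<in>pverts G. \<forall>l\<in>tokens G. \<forall>s<T. \<omega> (x, l, s) \<in> insert x (neighbours G x)) \<and>
     (\<forall>x\<in>pverts G. flood G \<omega> T x = peak G \<omega>) \<and>
     (\<forall>u\<in>pverts G. hits G \<omega> u \<noteq> {})"

section \<open>Homes, answers and callers in terms of tokens\<close>

lemma home_index_ex: "\<exists>j<S. \<forall>i<S. dg G (dest \<omega> (v, i)) \<le> dg G (dest \<omega> (v, j))"
proof -
  let ?D = "(\<lambda>i. dg G (dest \<omega> (v, i))) ` {..<S}"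
  have "Max ?D \<in> ?D" using S_pos by (intro Max_in) auto
  then obtain j where "j < S" "dg G (dest \<omega> (v, j)) = Max ?D" by auto
  then show ?thesis by (intro exI[of _ j]) auto
qed

lemma home_index: "home_index G \<omega> v < S"
    "i < S \<Longrightarrow> dg G (dest \<omega> (v, i)) \<le> dg G (home G \<omega> v)"
  using LeastI_ex[OF home_index_ex[of G \<omega> v]] unfolding home_def home_index_def by auto

lemma home_token: "v \<in> pverts G \<Longrightarrow> (v, home_index G \<omega> v) \<in> tokens G"
  using home_index(1)[of G \<omega> v] S_le_J by (simp add: tokens_def)

text \<open>Rephrases residents through the tokens that end at \<open>w\<close>, because these are
  what \<open>w\<close> sees.\<close>

lemma residents_alt:
  "residents G \<omega> w = fst ` {l\<in>tokens G. dest \<omega> l = w \<and> snd l = home_index G \<omega> (fst l)}"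
proof (intro equalityI subsetI)
  fix v assume "v \<in> residents G \<omega> w"
  then show "v \<in> fst ` {l\<in>tokens G. dest \<omega> l = w \<and> snd l = home_index G \<omega> (fst l)}"
    by (intro image_eqI[of _ _ "(v, home_index G \<omega> v)"])
      (auto simp: residents_def home_def intro: home_token)
qed (auto simp: residents_def home_def tokens_def)

lemma answer_Some:
  assumes "finite (pverts G)" "answer G \<omega> l = Some v"
  shows "v \<in> pverts G" "home G \<omega> v = dest \<omega> l"
proof -
  let ?R = "residents G \<omega> (dest \<omega> l)"
  have fin: "finite ?R" using assms(1) by (simp add: residents_def)
  obtain c where c: "c < card (pverts G) * card ?R" "v = enum ?R ! (c div card (pverts G))"
    using assms(2) by (auto simp: answer_def Let_def split: if_splits)
  then have "c div card (pverts G) < length (enum ?R)"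
    by (simp add: length_enum[OF fin] less_mult_imp_div_less mult.commute)
  then have "v \<in> set (enum ?R)" using c(2) nth_mem by simp
  then have "v \<in> ?R" using set_enum[OF fin] by simp
  then show "v \<in> pverts G" "home G \<omega> v = dest \<omega> l" by (auto simp: residents_def)
qed

lemma finite_tokens: "finite (pverts G) \<Longrightarrow> finite (tokens G)"
  by (simp add: tokens_def)

context
  fixes G \<omega>
  assumes sound: "sound G \<omega>"
begin

interpretation connected_network G
  using sound by (simp add: sound_def)

lemma path_in_V:
  assumes "l \<in> tokens G" "s \<le> T"
  shows "path \<omega> l s \<in> pverts G"
  using assms(2)
proof (induction s)
  case (Suc s)
  then have "\<omega> (path \<omega> l s, l, s) \<in> insert (path \<omega> l s) (neighbours G (path \<omega> l s))"
    using sound assms(1) by (simp add: sound_def)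
  then show ?case using Suc nb_subset by auto
qed (use assms(1) in \<open>auto simp: tokens_def\<close>)

lemma path_step:
  assumes "l \<in> tokens G" "s < T"
  shows "path \<omega> l (Suc s) \<in> insert (path \<omega> l s) (neighbours G (path \<omega> l s))"
  using path_in_V[of l s] sound assms by (simp add: sound_def)

lemma pos_step:
  assumes "l \<in> tokens G" "s < T" "pos \<omega> k s l \<noteq> pos \<omega> k (Suc s) l"
  shows "pos \<omega> k s l \<in> neighbours G (pos \<omega> k (Suc s) l)"
proof (cases "k \<in> {0, 2, 5, 7}")
  case True
  then show ?thesis using path_step[OF assms(1,2)] assms(3) nb_sym by (auto simp: pos_def)
next
  case False
  have eq: "T - s = Suc (T - Suc s)" using assms(2) by simp
  show ?thesis
    using False path_step[OF assms(1), of "T - Suc s"] assms(2,3) nb_sym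
    unfolding pos_def eq by (auto simp del: path.simps)
qed

lemma chosen_hit:
  assumes "u \<in> pverts G"
  shows "chosen G \<omega> u \<in> hits G \<omega> u"
  unfolding chosen_def
  by (rule Max_in) (use sound assms in \<open>auto simp: sound_def hits_def\<close>)

lemma chosen_token:
  assumes "u \<in> pverts G"
  shows "(u, chosen G \<omega> u) \<in> tokens G" "answer G \<omega> (u, chosen G \<omega> u) = Some (target G \<omega> u)"
  using chosen_hit[OF assms] assms by (auto simp: hits_def tokens_def target_def)

lemma target_in_V: "u \<in> pverts G \<Longrightarrow> target G \<omega> u \<in> pverts G"
  using answer_Some(1)[OF finite_V chosen_token(2)] .

lemma dest_chosen: "u \<in> pverts G \<Longrightarrow> dest \<omega> (u, chosen G \<omega> u) = home G \<omega> (target G \<omega> u)"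
  using answer_Some(2)[OF finite_V chosen_token(2)] by simp

text \<open>The chosen token of a caller ends at the home of its target, so that home can list the
  callers of each of its residents.\<close>

lemma callers_alt:
  assumes "home G \<omega> v = w"
  shows "callers G \<omega> v = fst ` {l\<in>tokens G. dest \<omega> l = w \<and> snd l = chosen G \<omega> (fst l) \<and>
    answer G \<omega> l = Some v}"
proof (intro equalityI subsetI)
  fix u assume "u \<in> callers G \<omega> v"
  then show "u \<in> fst ` {l\<in>tokens G. dest \<omega> l = w \<and> snd l = chosen G \<omega> (fst l) \<and>
      answer G \<omega> l = Some v}"
    using chosen_token[of u] dest_chosen[of u] assms
    by (intro image_eqI[of _ _ "(u, chosen G \<omega> u)"]) (auto simp: callers_def)
next
  fix u assume "u \<in> fst ` {l\<in>tokens G. dest \<omega> l = w \<and> snd l = chosen G \<omega> (fst l) \<and>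
      answer G \<omega> l = Some v}"
  then show "u \<in> callers G \<omega> v" by (auto simp: callers_def target_def tokens_def)
qed

end

end

subsection \<open>Locality\<close>

text \<open>
  Two executions that look alike to a node \<open>x\<close>: same view, same private seeds, and later on same
  messages received.  Everything that \<open>x\<close> sends is shown to agree in the two executions, hence to be
  a function of what \<open>x\<close> knows.
\<close>

locale token_twins = token_protocol +
  fixes G G' :: network and task task' :: "nat \<Rightarrow> gossip_task" and \<omega> \<omega>' :: seeds and x :: nat
  assumes sound: "sound G \<omega>" and sound': "sound G' \<omega>'"
    and x: "x \<in> pverts G" and x': "x \<in> pverts G'"
    and view: "local_view G task x = local_view G' task' x"
    and seed: "\<And>i. \<omega> (x, i) = \<omega>' (x, i)"
begin

interpretation N: connected_network G using sound by (simp add: sound_def)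
interpretation N': connected_network G' using sound' by (simp add: sound_def)

definition heard :: "nat \<Rightarrow> bool" where
  "heard f \<longleftrightarrow> (\<forall>f'<f. \<forall>y\<in>neighbours G x. fat G task \<omega> f' y x = fat G' task' \<omega>' f' y x)"

lemma heard_mono: "heard f \<Longrightarrow> f' \<le> f \<Longrightarrow> heard f'"
  by (auto simp: heard_def)

lemma view_eqs: "card (pverts G) = card (pverts G')" "neighbours G x = neighbours G' x"
    "task x = task' x" "dg G x = dg G' x"
  using view by (simp_all add: local_view_def dg_def)

lemma div_mod_pass: "s < T \<Longrightarrow> (k * T + s) div T = k" "s < T \<Longrightarrow> (k * T + s) mod T = s"
  by simp_all

section \<open>Positions and payloads of tokens as seen by one node\<close>

lemma heard_crossing:
  assumes "heard f" "k \<noteq> 3" "s < T" "k * T + s < f" "y \<in> neighbours G x"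
  shows "crossing G \<omega> k s y x = crossing G' \<omega>' k s y x"
    and "l \<in> crossing G \<omega> k s y x \<Longrightarrow> pay G task \<omega> k l = pay G' task' \<omega>' k l"
proof -
  let ?A = "crossing G \<omega> k s y x" and ?B = "crossing G' \<omega>' k s y x"
  have fin: "finite ?A" "finite ?B"
    unfolding crossing_def by (simp_all add: finite_tokens N.finite_V N'.finite_V)
  have "fat G task \<omega> (k * T + s) y x = fat G' task' \<omega>' (k * T + s) y x"
    using assms by (auto simp: heard_def)
  then have eq: "map (\<lambda>l. (l, pay G task \<omega> k l)) (enum ?A) = map (\<lambda>l. (l, pay G' task' \<omega>' k l)) (enum ?B)"
    using assms(2,3) by (auto simp: fat_def div_mod_pass dest!: flat_records_inj)
  from arg_cong[OF eq, of "map fst"] have enums: "enum ?A = enum ?B"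
    by (simp add: o_def)
  then show AB: "?A = ?B" using fin by (metis set_enum)
  show "pay G task \<omega> k l = pay G' task' \<omega>' k l" if "l \<in> ?A"
    using eq that unfolding enums[symmetric] by (simp add: set_enum[OF fin(1)])
qed

text \<open>A token is at \<open>x\<close> after a step either because it stayed, which a seed of
  \<open>x\<close> decides, or because it arrived in pass 0, and then the message of the neighbour
  lists it.\<close>

lemma at_eq:
  assumes "heard f" "s \<le> T" "s \<le> f"
  shows "{l\<in>tokens G. path \<omega> l s = x} = {l\<in>tokens G'. path \<omega>' l s = x}"
  using assms(2,3)
proof (induction s)
  case 0
  then show ?case using x x' by (auto simp: tokens_def)
next
  case (Suc s)
  have alt: "{l\<in>tokens H. path z l (Suc s) = x} =
      {l\<in>{l\<in>tokens H. path z l s = x}. z (x, l, s) = x} \<union> (\<Union>y\<in>neighbours H x. crossing H z 0 s y x)"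
    if "sound H z" for H z
  proof -
    interpret H: connected_network H using that by (simp add: sound_def)
    have "path z l s = x \<and> z (x, l, s) = x \<or> path z l s \<in> neighbours H x"
      if "l \<in> tokens H" "path z l (Suc s) = x" for l
      using pos_step[OF \<open>sound H z\<close> that(1), of s 0] Suc.prems that(2)
      by (cases "path z l s = x") (auto simp: pos_def)
    then show ?thesis by (fastforce simp: crossing_def pos_def)
  qed
  have "crossing G \<omega> 0 s y x = crossing G' \<omega>' 0 s y x" if "y \<in> neighbours G x" for y
    by (rule heard_crossing(1)[OF assms(1)]) (use Suc.prems that in auto)
  then show ?case
    unfolding alt[OF sound] alt[OF sound'] using Suc.IH Suc.prems seed view_eqs(2) by auto
qed

text \<open>Makes the backward passes local: a token returns to where it came from, which
  \<open>x\<close> has heard in pass 0 unless the token had stayed.\<close>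

lemma path_prev_eq:
  assumes "heard f" "T \<le> f" "s < T" "l \<in> tokens G" "path \<omega> l (Suc s) = x"
  shows "path \<omega> l s = path \<omega>' l s"
proof (cases "path \<omega> l s = x")
  case True
  moreover have "{l\<in>tokens G. path \<omega> l s = x} = {l\<in>tokens G'. path \<omega>' l s = x}"
    by (rule at_eq[OF assms(1)]) (use assms in auto)
  ultimately have "path \<omega>' l s = x" using assms(4) by blast
  with True show ?thesis by simp
next
  case False
  then have "path \<omega> l s \<in> neighbours G x"
    using pos_step[OF sound assms(4,3), of 0] assms(5) by (simp add: pos_def)
  then have "l \<in> crossing G' \<omega>' 0 s (path \<omega> l s) x"
    using heard_crossing(1)[OF assms(1), of 0 s "path \<omega> l s"] assms
    by (auto simp: crossing_def pos_def)
  then show ?thesis by (simp add: crossing_def pos_def)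
qed

lemma pos_at_eq:
  assumes "heard (k * T + s)" "s \<le> T"
  shows "{l\<in>tokens G. pos \<omega> k s l = x} = {l\<in>tokens G'. pos \<omega>' k s l = x}"
proof (cases "k = 0")
  case True
  then show ?thesis using at_eq[OF assms(1), of s] assms by (simp add: pos_def)
next
  case False
  then have T: "T \<le> k * T + s" by (cases k) auto
  show ?thesis
  proof (cases "k \<in> {0, 2, 5, 7}")
    case True
    then show ?thesis using at_eq[OF assms(1,2)] T assms(2) unfolding pos_def by simp
  next
    case False
    then show ?thesis using at_eq[OF assms(1), of "T - s"] T unfolding pos_def by simp
  qed
qed

lemma pos_next_eq:
  assumes "heard (k * T + s)" "s < T" "l \<in> tokens G" "pos \<omega> k s l = x"
  shows "pos \<omega> k (Suc s) l = pos \<omega>' k (Suc s) l"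
proof -
  have at: "pos \<omega>' k s l = x"
    using pos_at_eq[OF assms(1)] assms(2-4) by auto
  show ?thesis
  proof (cases "k \<in> {0, 2, 5, 7}")
    case True
    then show ?thesis using assms(4) at seed by (simp add: pos_def)
  next
    case False
    then have "T \<le> k * T + s" by (cases k) auto
    moreover have eq: "T - s = Suc (T - Suc s)" using assms(2) by simp
    ultimately show ?thesis
      using False path_prev_eq[OF assms(1) _ _ assms(3), of "T - Suc s"] assms(2,4)
      by (simp add: pos_def del: path.simps)
  qed
qed

text \<open>In a forward pass these are the tokens originating at \<open>x\<close>, in a backward
  pass those whose walks end at \<open>x\<close>. All later holders receive the payload with the
  token, see \<open>carried\<close>.\<close>

definition known :: "nat \<Rightarrow> bool" where
  "known k \<longleftrightarrow> (\<forall>l\<in>tokens G. pos \<omega> k 0 l = x \<longrightarrow> pay G task \<omega> k l = pay G' task' \<omega>' k l)"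

lemma carried:
  assumes "k \<noteq> 3" "known k" "heard (k * T + s)" "s \<le> T" "l \<in> tokens G" "pos \<omega> k s l = x"
  shows "pay G task \<omega> k l = pay G' task' \<omega>' k l"
  using assms(3,4,6)
proof (induction s)
  case 0
  then show ?case using assms(2,5) by (simp add: known_def)
next
  case (Suc s)
  show ?case
  proof (cases "pos \<omega> k s l = x")
    case True
    show ?thesis by (rule Suc.IH) (use Suc.prems True heard_mono in auto)
  next
    case False
    then have nb: "pos \<omega> k s l \<in> neighbours G x"
      using pos_step[OF sound assms(5), of s k] Suc.prems by auto
    show ?thesis
      by (rule heard_crossing(2)[OF Suc.prems(1) assms(1) _ _ nb])
        (use Suc.prems assms(5) in \<open>auto simp: crossing_def\<close>)
  qed
qed

lemma fat_eq:
  assumes "k \<noteq> 3" "known k" "heard (k * T + s)" "s < T"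
  shows "fat G task \<omega> (k * T + s) x y = fat G' task' \<omega>' (k * T + s) x y"
proof -
  have "crossing G \<omega> k s x y = crossing G' \<omega>' k s x y"
    using pos_at_eq[OF assms(3)] pos_next_eq[OF assms(3,4)] assms(4)
    by (auto simp: crossing_def)
  moreover have "pay G task \<omega> k l = pay G' task' \<omega>' k l" if "l \<in> set (enum (crossing G \<omega> k s x y))" for l
  proof -
    have "finite (crossing G \<omega> k s x y)"
      unfolding crossing_def by (simp add: finite_tokens N.finite_V)
    with that have "l \<in> crossing G \<omega> k s x y" by (simp add: set_enum)
    then show ?thesis
      using carried[OF assms(1-3)] assms(4) by (auto simp: crossing_def)
  qed
  ultimately show ?thesis
    using assms(1,4) by (simp add: fat_def cong: map_cong)
qed

lemma arrived:
  assumes "k \<noteq> 3" "known k" "heard ((k + 1) * T)" "l \<in> tokens G" "pos \<omega> k T l = x"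
  shows "pay G task \<omega> k l = pay G' task' \<omega>' k l"
  using carried[OF assms(1,2), of T l] assms(3-5) by (simp add: add.commute)

lemma dest_at_eq:
  assumes "heard T"
  shows "{l\<in>tokens G. dest \<omega> l = x} = {l\<in>tokens G'. dest \<omega>' l = x}"
  using at_eq[OF assms, of T] by (simp add: dest_def)

lemma dest_at_iff:
  assumes "heard T"
  shows "l \<in> tokens G \<and> dest \<omega> l = x \<longleftrightarrow> l \<in> tokens G' \<and> dest \<omega>' l = x"
  using dest_at_eq[OF assms] by blast

lemma own_token: "j < J \<Longrightarrow> (x, j) \<in> tokens G" "j < J \<Longrightarrow> (x, j) \<in> tokens G'"
  using x x' by (auto simp: tokens_def)

section \<open>What a node has learned after each pass\<close>

lemma known_0: "known 0"
  by (simp add: known_def pay_def)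

lemma known_1:
  assumes "heard T"
  shows "known 1"
  unfolding known_def
proof (intro ballI impI)
  fix l assume l: "l \<in> tokens G" "pos \<omega> 1 0 l = x"
  then have "dest \<omega> l = x" by (simp add: pos_def dest_def)
  moreover have "dest \<omega>' l = x" using dest_at_iff[OF assms, of l] l calculation by simp
  ultimately show "pay G task \<omega> 1 l = pay G' task' \<omega>' 1 l" by (simp add: pay_def view_eqs)
qed

lemma home_index_eq:
  assumes "heard (2 * T)"
  shows "home_index G \<omega> x = home_index G' \<omega>' x"
proof -
  have "dg G (dest \<omega> (x, j)) = dg G' (dest \<omega>' (x, j))" if "j < S" for j
    using arrived[of 1 "(x, j)"] known_1 heard_mono[OF assms, of T] assms own_token(1)[of j] that S_le_J
    by (simp add: pay_def pos_def numeral_2_eq_2)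
  then have "(j < S \<and> (\<forall>i<S. dg G (dest \<omega> (x, i)) \<le> dg G (dest \<omega> (x, j)))) =
      (j < S \<and> (\<forall>i<S. dg G' (dest \<omega>' (x, i)) \<le> dg G' (dest \<omega>' (x, j))))" for j
    by auto
  then show ?thesis unfolding home_index_def by simp
qed

lemma known_2: "heard (2 * T) \<Longrightarrow> known 2"
  using home_index_eq by (auto simp: known_def pay_def pos_def)

lemma home_token_eq:
  assumes "heard (3 * T)" "l \<in> tokens G" "dest \<omega> l = x"
  shows "snd l = home_index G \<omega> (fst l) \<longleftrightarrow> snd l = home_index G' \<omega>' (fst l)"
  using arrived[of 2 l] known_2 heard_mono[OF assms(1), of "2 * T"] assms
  by (auto simp: pay_def pos_def dest_def split: if_splits)

lemma residents_eq:
  assumes "heard (3 * T)"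
  shows "residents G \<omega> x = residents G' \<omega>' x"
proof -
  have "{l\<in>tokens G. dest \<omega> l = x \<and> snd l = home_index G \<omega> (fst l)} =
      {l\<in>tokens G'. dest \<omega>' l = x \<and> snd l = home_index G' \<omega>' (fst l)}"
    using dest_at_eq[OF heard_mono[OF assms]] home_token_eq[OF assms] by auto
  then show ?thesis by (simp add: residents_alt)
qed

lemma flood_eq:
  assumes "heard (3 * T + s)" "s \<le> T"
  shows "flood G \<omega> s x = flood G' \<omega>' s x"
  using assms
proof (induction s)
  case 0
  then show ?case using residents_eq view_eqs by (simp add: density_def)
next
  case (Suc s)
  have IH: "flood G \<omega> s x = flood G' \<omega>' s x"
    by (rule Suc.IH) (use Suc.prems heard_mono in auto)
  have "flood G \<omega> s y = flood G' \<omega>' s y" if "y \<in> neighbours G x" for y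
  proof -
    have "fat G task \<omega> (3 * T + s) y x = fat G' task' \<omega>' (3 * T + s) y x"
      using Suc.prems(1) that by (auto simp: heard_def)
    then show ?thesis using Suc.prems(2) by (simp add: fat_def)
  qed
  with IH have "flood G \<omega> s ` insert x (neighbours G x) = flood G' \<omega>' s ` insert x (neighbours G' x)"
    unfolding view_eqs(2)[symmetric] by (intro image_cong) auto
  then show ?case by (simp only: flood.simps)
qed

text \<open>\<open>peak\<close> is a global quantity; \<open>x\<close> has it because soundness
  identifies it with the value flooded to \<open>x\<close> in pass 3. The coin is a seed of
  \<open>x\<close> itself, as the walk ended there.\<close>

lemma answer_eq:
  assumes "heard (4 * T)" "l \<in> tokens G" "dest \<omega> l = x"
  shows "answer G \<omega> l = answer G' \<omega>' l"
proof -
  have "dest \<omega>' l = x"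
    using dest_at_eq[OF heard_mono[OF assms(1)]] assms by auto
  moreover have "peak G \<omega> = peak G' \<omega>'"
    using flood_eq[of T] assms(1) sound sound' x x' by (simp add: sound_def)
  ultimately show ?thesis
    using assms(3) seed view_eqs residents_eq[OF heard_mono[OF assms(1)]]
    by (simp add: answer_def Let_def)
qed

lemma known_4: "heard (4 * T) \<Longrightarrow> known 4"
  using answer_eq by (auto simp: known_def pay_def pos_def dest_def)

lemma own_answer_eq:
  assumes "heard (5 * T)" "j < J"
  shows "answer G \<omega> (x, j) = answer G' \<omega>' (x, j)"
proof -
  have "pay G task \<omega> 4 (x, j) = pay G' task' \<omega>' 4 (x, j)"
    using arrived[of 4 "(x, j)"] known_4 heard_mono[OF assms(1), of "4 * T"] assms own_token(1)[of j]
    by (simp add: pos_def)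
  then show ?thesis by (auto simp: pay_def split: option.splits)
qed

lemma own_target_eq:
  assumes "heard (5 * T)"
  shows "chosen G \<omega> x = chosen G' \<omega>' x" "target G \<omega> x = target G' \<omega>' x"
proof -
  have "hits G \<omega> x = hits G' \<omega>' x"
    using own_answer_eq[OF assms] by (auto simp: hits_def)
  then show "chosen G \<omega> x = chosen G' \<omega>' x" by (simp add: chosen_def)
  then show "target G \<omega> x = target G' \<omega>' x"
    using own_answer_eq[OF assms, of "chosen G \<omega> x"] chosen_token(1)[OF sound x]
    by (simp add: target_def tokens_def)
qed

lemma known_5: "heard (5 * T) \<Longrightarrow> known 5"
  using own_target_eq view_eqs by (auto simp: known_def pay_def pos_def act_def)

lemma chosen_token_eq:
  assumes "heard (6 * T)" "l \<in> tokens G" "dest \<omega> l = x"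
  shows "snd l = chosen G \<omega> (fst l) \<longleftrightarrow> snd l = chosen G' \<omega>' (fst l)"
    and "snd l = chosen G \<omega> (fst l) \<Longrightarrow> act G task \<omega> (fst l) = act G' task' \<omega>' (fst l)"
  using arrived[of 5 l] known_5 heard_mono[OF assms(1), of "5 * T"] assms
  by (auto simp: pay_def pos_def dest_def split: if_splits)

text \<open>About a resident \<open>v\<close> of \<open>x\<close>. A request of \<open>u\<close>
  answered by \<open>v\<close> ended at \<open>x\<close>, so \<open>x\<close> knows the answer it
  gave, and pass 5 has told it whether \<open>u\<close> chose this request and with which
  action.\<close>

lemma callers_eq:
  assumes "heard (6 * T)" "v \<in> pverts G" "home G \<omega> v = x"
  shows "home G' \<omega>' v = x" "home_index G \<omega> v = home_index G' \<omega>' v"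
    "callers G \<omega> v = callers G' \<omega>' v"
    "u \<in> callers G \<omega> v \<Longrightarrow> act G task \<omega> u = act G' task' \<omega>' u"
proof -
  have h: "heard T" "heard (3 * T)" "heard (4 * T)"
    using heard_mono[OF assms(1)] by auto
  show home': "home G' \<omega>' v = x"
    using residents_eq[OF h(2)] assms(2,3) by (auto simp: residents_def)
  show "home_index G \<omega> v = home_index G' \<omega>' v"
    using home_token_eq[OF h(2) home_token[OF assms(2), of \<omega>]] assms(3) by (simp add: home_def)
  have "{l\<in>tokens G. dest \<omega> l = x \<and> snd l = chosen G \<omega> (fst l) \<and> answer G \<omega> l = Some v} =
      {l\<in>tokens G'. dest \<omega>' l = x \<and> snd l = chosen G' \<omega>' (fst l) \<and> answer G' \<omega>' l = Some v}"
    by (intro Collect_cong)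
      (metis dest_at_iff[OF h(1)] chosen_token_eq(1)[OF assms(1)] answer_eq[OF h(3)])
  then show "callers G \<omega> v = callers G' \<omega>' v"
    by (simp add: callers_alt[OF sound assms(3)] callers_alt[OF sound' home'])
  show "act G task \<omega> u = act G' task' \<omega>' u" if "u \<in> callers G \<omega> v"
    using that chosen_token_eq(2)[OF assms(1)]
    unfolding callers_alt[OF sound assms(3)] by auto
qed

lemma known_6:
  assumes "heard (6 * T)"
  shows "known 6"
  unfolding known_def
proof (intro ballI impI)
  fix l assume l: "l \<in> tokens G" "pos \<omega> 6 0 l = x"
  have dest: "dest \<omega> l = x" using l(2) by (simp add: pos_def dest_def)
  have iff: "snd l = home_index G \<omega> (fst l) \<longleftrightarrow> snd l = home_index G' \<omega>' (fst l)"
    using home_token_eq[OF heard_mono[OF assms] l(1) dest] by simp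
  show "pay G task \<omega> 6 l = pay G' task' \<omega>' 6 l"
  proof (cases "snd l = home_index G \<omega> (fst l)")
    case True
    then have home: "home G \<omega> (fst l) = x" "fst l \<in> pverts G"
      using dest l(1) by (auto simp: home_def tokens_def)
    have "finite (callers G \<omega> (fst l))"
      by (simp add: callers_def N.finite_V)
    then have "map (\<lambda>u. [u, act G task \<omega> u]) (enum (callers G \<omega> (fst l))) =
        map (\<lambda>u. [u, act G' task' \<omega>' u]) (enum (callers G' \<omega>' (fst l)))"
      using callers_eq(3,4)[OF assms home(2,1)] by (intro map_cong) (auto simp: set_enum)
    then show ?thesis using iff by (simp add: pay_def)
  qed (use iff in \<open>simp add: pay_def\<close>)
qed

lemma own_callers_eq:
  assumes "heard (7 * T)"
  shows "callers G \<omega> x = callers G' \<omega>' x"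
    "u \<in> callers G \<omega> x \<Longrightarrow> act G task \<omega> u = act G' task' \<omega>' u"
proof -
  have fin: "finite (callers G \<omega> x)" "finite (callers G' \<omega>' x)"
    by (simp_all add: callers_def N.finite_V N'.finite_V)
  have "pay G task \<omega> 6 (x, home_index G \<omega> x) = pay G' task' \<omega>' 6 (x, home_index G \<omega> x)"
    using arrived[of 6 "(x, home_index G \<omega> x)"] known_6 heard_mono[OF assms, of "6 * T"] assms
      home_token[OF x] by (simp add: pos_def)
  moreover have "home_index G \<omega> x = home_index G' \<omega>' x"
    by (rule home_index_eq) (use assms heard_mono in auto)
  ultimately have "concat (map (\<lambda>u. [u, act G task \<omega> u]) (enum (callers G \<omega> x))) =
      concat (map (\<lambda>u. [u, act G' task' \<omega>' u]) (enum (callers G' \<omega>' x)))"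
    by (simp add: pay_def)
  from concat_pairs_inj[OF this] show "callers G \<omega> x = callers G' \<omega>' x"
    "u \<in> callers G \<omega> x \<Longrightarrow> act G task \<omega> u = act G' task' \<omega>' u"
    using set_enum[OF fin(1)] set_enum[OF fin(2)] by metis+
qed

lemma known_7:
  assumes "heard (7 * T)"
  shows "known 7"
proof -
  have "response G task \<omega> x u = response G' task' \<omega>' x u" for u
    using own_target_eq(2) heard_mono[OF assms, of "5 * T"] view_eqs by (simp add: response_def)
  moreover have "home_index G \<omega> x = home_index G' \<omega>' x"
    by (rule home_index_eq) (use assms heard_mono in auto)
  ultimately show ?thesis
    using own_callers_eq(1)[OF assms] by (auto simp: known_def pay_def pos_def)
qed

text \<open>The reply to \<open>u\<close> reached the common endpoint \<open>x\<close> in pass 7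
  with the home token of the target; there the chosen token of \<open>u\<close> picks it up.\<close>

lemma known_8:
  assumes "heard (8 * T)"
  shows "known 8"
  unfolding known_def
proof (intro ballI impI)
  fix l assume l: "l \<in> tokens G" "pos \<omega> 8 0 l = x"
  have h: "heard (4 * T)" "heard (6 * T)" "heard (7 * T)"
    using heard_mono[OF assms] by auto
  have dest: "dest \<omega> l = x" using l(2) by (simp add: pos_def dest_def)
  have iff: "snd l = chosen G \<omega> (fst l) \<longleftrightarrow> snd l = chosen G' \<omega>' (fst l)"
    by (rule chosen_token_eq(1)[OF h(2) l(1) dest])
  show "pay G task \<omega> 8 l = pay G' task' \<omega>' 8 l"
  proof (cases "snd l = chosen G \<omega> (fst l)")
    case True
    define u v where "u = fst l" and "v = target G \<omega> u"
    have u: "u \<in> pverts G" and l_eq: "l = (u, chosen G \<omega> u)"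
      using l(1) True by (auto simp: u_def tokens_def prod_eq_iff)
    have v: "v \<in> pverts G" "home G \<omega> v = x"
      using target_in_V[OF sound u] dest_chosen[OF sound u] dest by (auto simp: v_def l_eq)
    \<comment> \<open>It was \<open>x\<close> that answered this request of \<open>u\<close>, and it
      gives the same answer in both executions.\<close>
    have tgt: "target G' \<omega>' u = v"
      using answer_eq[OF h(1) l(1) dest] iff True by (simp add: v_def u_def target_def prod_eq_iff)
        (metis prod.collapse target_def)
    note ceq = callers_eq[OF h(2) v]
    have "pos \<omega> 7 T (v, home_index G \<omega> v) = x"
      using v(2) by (simp add: pos_def home_def dest_def)
    then have "pay G task \<omega> 7 (v, home_index G \<omega> v) = pay G' task' \<omega>' 7 (v, home_index G \<omega> v)"
      using arrived[of 7 "(v, home_index G \<omega> v)"] known_7[OF h(3)] assms home_token[OF v(1)]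
      by simp
    then have "concat (map (\<lambda>u. [u, response G task \<omega> v u]) (enum (callers G \<omega> v))) =
        concat (map (\<lambda>u. [u, response G' task' \<omega>' v u]) (enum (callers G' \<omega>' v)))"
      using ceq(2) by (simp add: pay_def)
    from concat_pairs_inj[OF this] have "\<forall>u\<in>callers G \<omega> v. response G task \<omega> v u = response G' task' \<omega>' v u"
      by (simp add: set_enum callers_def N.finite_V)
    moreover have "u \<in> callers G \<omega> v" using u by (simp add: callers_def v_def)
    ultimately show ?thesis
      using True iff tgt by (simp add: pay_def u_def v_def)
  qed (use iff in \<open>simp add: pay_def\<close>)
qed

lemma fat_local:
  assumes "heard f" "f < 9 * T"
  shows "fat G task \<omega> f x y = fat G' task' \<omega>' f x y"
proof -
  define k s where "k = f div T" and "s = f mod T"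
  have f: "f = k * T + s" and s: "s < T" using T_pos by (auto simp: k_def s_def)
  have k: "k < 9" using assms(2) by (simp add: k_def div_less_iff_less_mult[OF T_pos] mult.commute)
  show ?thesis
  proof (cases "k = 3")
    case True
    then show ?thesis using assms(1) s flood_eq[of s] by (simp add: f fat_def)
  next
    case False
    have h: "heard (k * T)" using assms(1) heard_mono by (simp add: f)
    have "k \<in> {0, 1, 2, 4, 5, 6, 7, 8}" using k False by auto
    then have "known k"
      using h known_0 known_1 known_2 known_4 known_5 known_6 known_7 known_8 by auto
    then show ?thesis unfolding f using False assms(1) s by (intro fat_eq) (auto simp: f)
  qed
qed

lemma result_local:
  assumes "heard (9 * T)"
  shows "gossip_round (pverts G) task (target G \<omega>) x = gossip_round (pverts G') task' (target G' \<omega>') x"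
proof -
  have h: "heard (5 * T)" "heard (7 * T)" "heard (8 * T)" using heard_mono[OF assms] by auto
  note tgt = own_target_eq[OF h(1)]
  \<comment> \<open>A caller reports its action only at the target it has sampled, which is
    \<open>x\<close> in both executions.\<close>
  have acts: "task_action (task w) x = task_action (task' w) x" if "w \<in> callers G \<omega> x" for w
  proof -
    have "w \<in> callers G' \<omega>' x" using own_callers_eq(1)[OF h(2)] that by simp
    then show ?thesis
      using own_callers_eq(2)[OF h(2) that] that
      by (intro actcode_inj) (simp add: act_def callers_def)
  qed
  have sets: "{w\<in>pverts G. target G \<omega> w = x \<and> is_Push (task_action (task w) x)} =
      {w\<in>pverts G'. target G' \<omega>' w = x \<and> is_Push (task_action (task' w) x)}"
  proof -
    have "{w\<in>callers G \<omega> x. is_Push (task_action (task w) x)} =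
        {w\<in>callers G' \<omega>' x. is_Push (task_action (task' w) x)}"
      unfolding own_callers_eq(1)[OF h(2), symmetric] using acts by (intro Collect_cong) metis
    then show ?thesis by (simp add: callers_def conj_assoc)
  qed
  have "image_mset (\<lambda>w. payload (task_action (task w) x))
        (mset_set {w\<in>pverts G. target G \<omega> w = x \<and> is_Push (task_action (task w) x)}) =
      image_mset (\<lambda>w. payload (task_action (task' w) x))
        (mset_set {w\<in>pverts G'. target G' \<omega>' w = x \<and> is_Push (task_action (task' w) x)})"
    unfolding sets[symmetric]
    by (intro image_mset_cong) (use acts N.finite_V in \<open>auto simp: callers_def\<close>)
  moreover have "response G task \<omega> (target G \<omega> x) x = response G' task' \<omega>' (target G' \<omega>' x) x"
    using arrived[of 8 "(x, chosen G \<omega> x)"] known_8[OF h(3)] assms chosen_token(1)[OF sound x] tgt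
    by (simp add: pay_def pos_def)
  ultimately show ?thesis
    using tgt view_eqs by (auto simp: gossip_round_def response_def dest!: mcode_inj)
qed

end

section \<open>From local message functions to algorithms\<close>

text \<open>The nonconstructive step from agreement of lookalike executions to an actual function of
  what a node knows. The default value keeps messages short on inputs that no good execution
  produces.\<close>

lemma factor_through:
  assumes "\<And>a b. a \<in> A \<Longrightarrow> b \<in> A \<Longrightarrow> g a = g b \<Longrightarrow> f a = f b"
  shows "\<exists>F. (\<forall>a\<in>A. F (g a) = f a) \<and> (\<forall>k. k \<notin> g ` A \<longrightarrow> F k = d)"
proof (intro exI conjI ballI allI impI)
  let ?F = "\<lambda>k. if k \<in> g ` A then f (inv_into A g k) else d"
  show "?F (g a) = f a" if "a \<in> A" for a
    using assms[OF inv_into_into[of "g a" g A] that] that f_inv_into_f[of "g a" g A] by auto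
  show "?F k = d" if "k \<notin> g ` A" for k using that by simp
qed

definition heard_list :: "network \<Rightarrow> (nat \<Rightarrow> nat \<Rightarrow> nat \<Rightarrow> msg) \<Rightarrow> nat \<Rightarrow> nat \<Rightarrow> msg list list" where
  "heard_list G m r x = map (\<lambda>r'. map (\<lambda>y. m r' y x) (sorted_list_of_set (neighbours G x))) [0..<r]"

lemma length_heard_list [simp]: "length (heard_list G m r x) = r"
  by (simp add: heard_list_def)

lemma heard_list_Suc:
  "heard_list G m (Suc r) x = heard_list G m r x @ [map (\<lambda>y. m r y x) (sorted_list_of_set (neighbours G x))]"
  by (simp add: heard_list_def)

lemma heard_list_eqD:
  assumes "heard_list G m r x = heard_list G' m' r x" "neighbours G x = neighbours G' x"
    "finite (neighbours G x)" "r' < r" "y \<in> neighbours G x"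
  shows "m r' y x = m' r' y x"
proof -
  have "\<forall>i\<in>set [0..<r]. map (\<lambda>y. m i y x) (sorted_list_of_set (neighbours G x)) =
      map (\<lambda>y. m' i y x) (sorted_list_of_set (neighbours G x))"
    using assms(1) unfolding heard_list_def assms(2)[symmetric] by (simp only: map_eq_conv)
  with assms(4) have "\<forall>z\<in>set (sorted_list_of_set (neighbours G x)). m r' z x = m' r' z x"
    by (simp only: map_eq_conv set_upt atLeastLessThan_iff) simp
  then show ?thesis using assms(3,5) by simp
qed

subsection \<open>Programs driven by seeds and received messages\<close>

record ('a, 'i, 'o) seed_prog =
  prog_seed :: "'i local_view \<Rightarrow> 'a pmf"
  prog_send :: "'i local_view \<Rightarrow> 'a \<Rightarrow> msg list list \<Rightarrow> nat \<Rightarrow> msg"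
  prog_out :: "'i local_view \<Rightarrow> 'a \<Rightarrow> msg list list \<Rightarrow> 'o"

text \<open>The seed may range over an uncountable type, but the support of a pmf is countable. So
  support element and history fit into one natural number, the state type of the final
  algorithm.\<close>

definition enc_state :: "('a, 'i, 'o) seed_prog \<Rightarrow> 'i local_view \<Rightarrow> 'a \<Rightarrow> msg list list \<Rightarrow> nat" where
  "enc_state p v a h = to_nat (to_nat_on (set_pmf (prog_seed p v)) a, h)"

definition dec_seed :: "('a, 'i, 'o) seed_prog \<Rightarrow> 'i local_view \<Rightarrow> nat \<Rightarrow> 'a" where
  "dec_seed p v s = from_nat_into (set_pmf (prog_seed p v)) (fst (from_nat s :: nat \<times> msg list list))"

definition dec_hist :: "nat \<Rightarrow> msg list list" where
  "dec_hist s = snd (from_nat s :: nat \<times> msg list list)"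

lemma dec_enc:
  "a \<in> set_pmf (prog_seed p v) \<Longrightarrow> dec_seed p v (enc_state p v a h) = a"
  "dec_hist (enc_state p v a h) = h"
  by (simp_all add: dec_seed_def dec_hist_def enc_state_def)

definition compile :: "('a, 'i, 'o) seed_prog \<Rightarrow> (nat, 'i, 'o) congest_alg" where
  "compile p = \<lparr>
     alg_init = (\<lambda>v. map_pmf (\<lambda>a. enc_state p v a []) (prog_seed p v)),
     alg_send = (\<lambda>v s. prog_send p v (dec_seed p v s) (dec_hist s)),
     alg_compute = (\<lambda>v s inb. return_pmf (to_nat (fst (from_nat s :: nat \<times> msg list list),
        dec_hist s @ [map inb (sorted_list_of_set (view_nbrs v))]))),
     alg_output = (\<lambda>v s. prog_out p v (dec_seed p v s) (dec_hist s))\<rparr>"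

primrec hist :: "('a, 'i, 'o) seed_prog \<Rightarrow> network \<Rightarrow> (nat \<Rightarrow> 'i) \<Rightarrow> (nat \<Rightarrow> 'a) \<Rightarrow> nat \<Rightarrow> nat \<Rightarrow> msg list list" where
  "hist p G inp \<omega> 0 x = []"
| "hist p G inp \<omega> (Suc r) x = hist p G inp \<omega> r x @
     [map (\<lambda>y. prog_send p (local_view G inp y) (\<omega> y) (hist p G inp \<omega> r y) x)
       (sorted_list_of_set (neighbours G x))]"

lemma length_hist [simp]: "length (hist p G inp \<omega> r x) = r"
  by (induction r) simp_all

lemma take_hist: "r \<le> r' \<Longrightarrow> take r (hist p G inp \<omega> r' x) = hist p G inp \<omega> r x"
  by (induction r') (auto simp: le_Suc_eq)

definition final_states ::
  "('a, 'i, 'o) seed_prog \<Rightarrow> network \<Rightarrow> (nat \<Rightarrow> 'i) \<Rightarrow> nat \<Rightarrow> (nat \<Rightarrow> 'a) \<Rightarrow> nat \<Rightarrow> nat" where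
  "final_states p G inp r \<omega> x =
     (if x \<in> pverts G then enc_state p (local_view G inp x) (\<omega> x) (hist p G inp \<omega> r x) else undefined)"

text \<open>No randomness is drawn after initialisation, so a run is a deterministic image of the
  independent initial seeds.\<close>

lemma compile_run:
  assumes fin: "finite (pverts G)" and nb: "\<And>x. neighbours G x \<subseteq> pverts G"
  shows "congest_run (compile p) G inp r =
    map_pmf (final_states p G inp r) (Pi_pmf (pverts G) d (\<lambda>x. prog_seed p (local_view G inp x)))"
    (is "_ = map_pmf _ ?P")
proof (induction r)
  case 0
  have "Pi_pmf (pverts G) undefined (\<lambda>u. map_pmf (\<lambda>a. enc_state p (local_view G inp u) a [])
      (prog_seed p (local_view G inp u))) =
    ?P \<bind> (\<lambda>\<omega>. Pi_pmf (pverts G) undefined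
      (\<lambda>u. return_pmf (enc_state p (local_view G inp u) (\<omega> u) [])))"
    unfolding map_pmf_def by (rule Pi_pmf_bind[OF fin])
  then show ?case
    by (simp add: compile_def fin map_pmf_def final_states_def[abs_def] cong: if_cong)
next
  case (Suc r)
  have "Pi_pmf (pverts G) undefined (\<lambda>u. alg_compute (compile p) (local_view G inp u)
        (final_states p G inp r \<omega> u) (inbox (compile p) G inp (final_states p G inp r \<omega>) u)) =
      return_pmf (final_states p G inp (Suc r) \<omega>)"
    if "\<omega> \<in> set_pmf ?P" for \<omega>
  proof -
    have seeds: "\<omega> y \<in> set_pmf (prog_seed p (local_view G inp y))" if "y \<in> pverts G" for y
      using \<open>\<omega> \<in> set_pmf ?P\<close> that fin by (auto simp: set_Pi_pmf PiE_dflt_def)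
    have "alg_compute (compile p) (local_view G inp u)
        (final_states p G inp r \<omega> u) (inbox (compile p) G inp (final_states p G inp r \<omega>) u) =
        return_pmf (final_states p G inp (Suc r) \<omega> u)" if u: "u \<in> pverts G" for u
    proof -
      have fin_nb: "finite (neighbours G u)" using nb fin by (rule finite_subset)
      have "inbox (compile p) G inp (final_states p G inp r \<omega>) u y =
          prog_send p (local_view G inp y) (\<omega> y) (hist p G inp \<omega> r y) u" if "y \<in> neighbours G u" for y
      proof -
        have "y \<in> pverts G" using that nb by blast
        then show ?thesis
          using that seeds by (simp add: inbox_def compile_def final_states_def dec_enc)
      qed
      then have eq: "map (inbox (compile p) G inp (final_states p G inp r \<omega>) u)
            (sorted_list_of_set (neighbours G u)) =
          map (\<lambda>y. prog_send p (local_view G inp y) (\<omega> y) (hist p G inp \<omega> r y) u)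
            (sorted_list_of_set (neighbours G u))"
        using fin_nb by (intro map_cong) auto
      have vn: "view_nbrs (local_view G inp u) = neighbours G u" by (simp add: local_view_def)
      have "alg_compute (compile p) (local_view G inp u) s b = return_pmf (to_nat
          (fst (from_nat s :: nat \<times> msg list list), dec_hist s @ [map b (sorted_list_of_set (neighbours G u))]))" for s b
        by (simp add: compile_def vn)
      then show ?thesis
        using u by (simp only: eq) (simp add: final_states_def enc_state_def dec_hist_def)
    qed
    then have "Pi_pmf (pverts G) undefined (\<lambda>u. alg_compute (compile p) (local_view G inp u)
          (final_states p G inp r \<omega> u) (inbox (compile p) G inp (final_states p G inp r \<omega>) u)) =
        Pi_pmf (pverts G) undefined (\<lambda>u. return_pmf (final_states p G inp (Suc r) \<omega> u))"
      by (intro Pi_pmf_cong) auto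
    also have "\<dots> = return_pmf (final_states p G inp (Suc r) \<omega>)"
      unfolding Pi_pmf_return_pmf[OF fin] by (intro arg_cong[where f = return_pmf] ext)
        (simp add: final_states_def)
    finally show ?thesis .
  qed
  then have "congest_run (compile p) G inp (Suc r) = ?P \<bind> (\<lambda>\<omega>. return_pmf (final_states p G inp (Suc r) \<omega>))"
    by (simp add: Suc.IH bind_map_pmf cong: bind_pmf_cong)
  then show ?case by (simp add: map_pmf_def)
qed

subsection \<open>Windows of doubling length\<close>

text \<open>Window \<open>i\<close> consists of the \<open>W * 2 ^ i\<close> rounds starting with round \<open>W * (2 ^ i - 1)\<close>.\<close>

definition window :: "nat \<Rightarrow> nat \<Rightarrow> nat" where
  "window W r = (LEAST i. r < W * (2 ^ Suc i - 1))"

lemma window_eq: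
  assumes "0 < W" "W * (2 ^ i - 1) \<le> r" "r < W * (2 ^ Suc i - 1)"
  shows "window W r = i"
  unfolding window_def
proof (rule Least_equality)
  fix k assume k: "r < W * (2 ^ Suc k - 1)"
  show "i \<le> k"
  proof (rule ccontr)
    assume "\<not> i \<le> k"
    then have "(2::nat) ^ Suc k \<le> 2 ^ i" by (intro power_increasing) auto
    then have "W * (2 ^ Suc k - 1) \<le> W * (2 ^ i - 1)" by (intro mult_le_mono) auto
    then show False using k assms(2) by linarith
  qed
qed (use assms in simp)

text \<open>Window \<open>window W r\<close> is still in progress at round \<open>r\<close>; its
  predecessor is the last complete one.\<close>

definition last_window :: "nat \<Rightarrow> nat \<Rightarrow> nat" where
  "last_window W r = window W r - 1"

lemma last_window:
  assumes W: "0 < W" and r: "W * (2 ^ Suc j - 1) \<le> r"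
  shows "j \<le> last_window W r" "W * (2 ^ Suc (last_window W r) - 1) \<le> r"
proof -
  have "r < W * (2 ^ Suc r - 1)"
  proof -
    have "Suc r < 2 ^ Suc r" by (rule less_exp)
    then have "1 * r < W * (2 ^ Suc r - 1)" using W by (intro mult_le_less_imp_less) auto
    then show ?thesis by simp
  qed
  then have ex: "r < W * (2 ^ Suc (window W r) - 1)"
    unfolding window_def by (rule LeastI)
  have "j < window W r"
  proof (rule ccontr)
    assume "\<not> j < window W r"
    then have "(2::nat) ^ Suc (window W r) \<le> 2 ^ Suc j" by (intro power_increasing) auto
    then have "W * (2 ^ Suc (window W r) - 1) \<le> W * (2 ^ Suc j - 1)"
      by (intro mult_le_mono diff_le_mono order_refl)
    then show False using ex r by linarith
  qed
  then have suc: "Suc (last_window W r) = window W r" by (simp add: last_window_def)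
  with \<open>j < window W r\<close> show "j \<le> last_window W r" by linarith
  have "last_window W r < window W r" using suc by linarith
  then show "W * (2 ^ Suc (last_window W r) - 1) \<le> r"
    using not_less_Least[of "last_window W r" "\<lambda>i. r < W * (2 ^ Suc i - 1)"]
    unfolding window_def[symmetric] by linarith
qed

text \<open>\<open>msg\<close> and \<open>res\<close> may look at the whole network and all seeds.
  \<open>Good i\<close> contains the configurations in which attempt \<open>i\<close> succeeds;
  locality and short messages are demanded only there.\<close>

locale windowed_protocol =
  fixes Good :: "nat \<Rightarrow> (network \<times> (nat \<Rightarrow> 'i) \<times> (nat \<Rightarrow> 'a)) set"
    and msg :: "nat \<Rightarrow> network \<Rightarrow> (nat \<Rightarrow> 'i) \<Rightarrow> (nat \<Rightarrow> 'a) \<Rightarrow> nat \<Rightarrow> nat \<Rightarrow> nat \<Rightarrow> msg"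
    and res :: "nat \<Rightarrow> network \<Rightarrow> (nat \<Rightarrow> 'i) \<Rightarrow> (nat \<Rightarrow> 'a) \<Rightarrow> nat \<Rightarrow> 'o"
    and W :: "nat \<Rightarrow> nat"
    and seed :: "'i local_view \<Rightarrow> 'a pmf"
    and B :: real
  assumes W_pos: "2 \<le> n \<Longrightarrow> 0 < W n"
    and Good_graph: "(G, t, \<omega>) \<in> Good i \<Longrightarrow> connected_network G"
    and msg_local: "\<lbrakk>(G, t, \<omega>) \<in> Good i; (G', t', \<omega>') \<in> Good i; x \<in> pverts G; x \<in> pverts G';
        local_view G t x = local_view G' t' x; \<omega> x = \<omega>' x; r < W (card (pverts G)) * 2 ^ i;
        \<And>r' y. r' < r \<Longrightarrow> y \<in> neighbours G x \<Longrightarrow> msg i G t \<omega> r' y x = msg i G' t' \<omega>' r' y x\<rbrakk>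
        \<Longrightarrow> msg i G t \<omega> r x y = msg i G' t' \<omega>' r x y"
    and res_local: "\<lbrakk>(G, t, \<omega>) \<in> Good i; (G', t', \<omega>') \<in> Good i; x \<in> pverts G; x \<in> pverts G';
        local_view G t x = local_view G' t' x; \<omega> x = \<omega>' x;
        \<And>r' y. r' < W (card (pverts G)) * 2 ^ i \<Longrightarrow> y \<in> neighbours G x \<Longrightarrow>
          msg i G t \<omega> r' y x = msg i G' t' \<omega>' r' y x\<rbrakk>
        \<Longrightarrow> res i G t \<omega> x = res i G' t' \<omega>' x"
    and msg_length: "\<lbrakk>(G, t, \<omega>) \<in> Good i; x \<in> pverts G; y \<in> neighbours G x;
        r < W (card (pverts G)) * 2 ^ i\<rbrakk>
        \<Longrightarrow> real (length (msg i G t \<omega> r x y)) \<le> B * log 2 (card (pverts G))"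
    and B_nonneg: "0 \<le> B"
begin

lemma message_function:
  "\<exists>F. (\<forall>G t \<omega> x r y. (G, t, \<omega>) \<in> Good i \<longrightarrow> x \<in> pverts G \<longrightarrow> y \<in> neighbours G x \<longrightarrow>
        r < W (card (pverts G)) * 2 ^ i \<longrightarrow>
        F (local_view G t x) (\<omega> x) (heard_list G (msg i G t \<omega>) r x) y = msg i G t \<omega> r x y) \<and>
      (\<forall>v a h y. 2 \<le> view_size v \<longrightarrow> real (length (F v a h y)) \<le> B * log 2 (view_size v))"
proof -
  let ?A = "{(G, t, \<omega>, x, r, y). (G, t, \<omega>) \<in> Good i \<and> x \<in> pverts G \<and> y \<in> neighbours G x \<and>
    r < W (card (pverts G)) * 2 ^ i}"
  let ?g = "\<lambda>(G, t, \<omega>, x, r, y). (local_view G t x, \<omega> x, heard_list G (msg i G t \<omega>) r x, y)"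
  let ?f = "\<lambda>(G, t, \<omega>, x, r, y). msg i G t \<omega> r x y"
  have "\<exists>F. (\<forall>a\<in>?A. F (?g a) = ?f a) \<and> (\<forall>k. k \<notin> ?g ` ?A \<longrightarrow> F k = [])"
  proof (rule factor_through)
    fix a b assume a: "a \<in> ?A" and b: "b \<in> ?A" and eq: "?g a = ?g b"
    obtain G t \<omega> x r y where a_eq: "a = (G, t, \<omega>, x, r, y)" by (cases a) auto
    obtain G' t' \<omega>' x' r' y' where b_eq: "b = (G', t', \<omega>', x', r', y')" by (cases b) auto
    have view: "local_view G t x = local_view G' t' x'" and om: "\<omega> x = \<omega>' x'" and y: "y' = y"
      and h: "heard_list G (msg i G t \<omega>) r x = heard_list G' (msg i G' t' \<omega>') r' x'"
      using eq by (auto simp: a_eq b_eq)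
    \<comment> \<open>The number of the round is the length of the history, hence part of what the
      node knows.\<close>
    have r: "r' = r" using arg_cong[OF h, of length] by simp
    have x: "x' = x" and nb: "neighbours G x = neighbours G' x"
      using view by (auto simp: local_view_def)
    have good: "(G, t, \<omega>) \<in> Good i" "(G', t', \<omega>') \<in> Good i" "x \<in> pverts G" "x \<in> pverts G'"
        "r < W (card (pverts G)) * 2 ^ i"
      using a b by (auto simp: a_eq b_eq x)
    interpret connected_network G by (rule Good_graph[OF good(1)])
    have "msg i G t \<omega> r x y = msg i G' t' \<omega>' r x y"
      by (rule msg_local[OF good(1-4) _ _ good(5)])
        (use view om x heard_list_eqD[OF h[unfolded r x] nb finite_nb] in auto)
    then show "?f a = ?f b" by (simp add: a_eq b_eq x r y)
  qed
  then obtain F where F: "\<And>a. a \<in> ?A \<Longrightarrow> F (?g a) = ?f a" "\<And>k. k \<notin> ?g ` ?A \<Longrightarrow> F k = []"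
    by blast
  show ?thesis
  proof (intro exI[of _ "\<lambda>v a h y. F (v, a, h, y)"] conjI allI impI)
    fix G t \<omega> x r y
    assume "(G, t, \<omega>) \<in> Good i" "x \<in> pverts G" "y \<in> neighbours G x" "r < W (card (pverts G)) * 2 ^ i"
    then show "F (local_view G t x, \<omega> x, heard_list G (msg i G t \<omega>) r x, y) = msg i G t \<omega> r x y"
      using F(1)[of "(G, t, \<omega>, x, r, y)"] by simp
  next
    fix v :: "'i local_view" and a h y assume v: "2 \<le> view_size v"
    show "real (length (F (v, a, h, y))) \<le> B * log 2 (view_size v)"
    proof (cases "(v, a, h, y) \<in> ?g ` ?A")
      case True
      then obtain k where k: "k \<in> ?A" "(v, a, h, y) = ?g k" by blast
      obtain G t \<omega> x r z where k_eq: "k = (G, t, \<omega>, x, r, z)" by (cases k) auto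
      have "F (v, a, h, y) = msg i G t \<omega> r x z" using F(1)[OF k(1)] k(2) by (simp add: k_eq)
      moreover have "view_size v = card (pverts G)" using k(2) by (auto simp: k_eq local_view_def)
      ultimately show ?thesis using k(1) msg_length by (auto simp: k_eq)
    next
      case False
      then show ?thesis using F(2) v B_nonneg by simp
    qed
  qed
qed

lemma result_function:
  "\<exists>F. \<forall>G t \<omega> x. (G, t, \<omega>) \<in> Good i \<longrightarrow> x \<in> pverts G \<longrightarrow>
     F (local_view G t x) (\<omega> x) (heard_list G (msg i G t \<omega>) (W (card (pverts G)) * 2 ^ i) x) =
       res i G t \<omega> x"
proof -
  let ?A = "{(G, t, \<omega>, x). (G, t, \<omega>) \<in> Good i \<and> x \<in> pverts G}"
  let ?g = "\<lambda>(G, t, \<omega>, x). (local_view G t x, \<omega> x,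
    heard_list G (msg i G t \<omega>) (W (card (pverts G)) * 2 ^ i) x)"
  let ?f = "\<lambda>(G, t, \<omega>, x). res i G t \<omega> x"
  have "\<exists>F. (\<forall>a\<in>?A. F (?g a) = ?f a) \<and> (\<forall>k. k \<notin> ?g ` ?A \<longrightarrow> F k = undefined)"
  proof (rule factor_through)
    fix a b assume a: "a \<in> ?A" and b: "b \<in> ?A" and eq: "?g a = ?g b"
    obtain G t \<omega> x where a_eq: "a = (G, t, \<omega>, x)" by (cases a) auto
    obtain G' t' \<omega>' x' where b_eq: "b = (G', t', \<omega>', x')" by (cases b) auto
    have view: "local_view G t x = local_view G' t' x'" and om: "\<omega> x = \<omega>' x'"
      using eq by (auto simp: a_eq b_eq)
    have x: "x' = x" and nb: "neighbours G x = neighbours G' x" and n: "card (pverts G') = card (pverts G)"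
      using view by (auto simp: local_view_def)
    have h: "heard_list G (msg i G t \<omega>) (W (card (pverts G)) * 2 ^ i) x =
        heard_list G' (msg i G' t' \<omega>') (W (card (pverts G)) * 2 ^ i) x"
      using eq by (auto simp: a_eq b_eq x n)
    have good: "(G, t, \<omega>) \<in> Good i" "(G', t', \<omega>') \<in> Good i" "x \<in> pverts G" "x \<in> pverts G'"
      using a b by (auto simp: a_eq b_eq x)
    interpret connected_network G by (rule Good_graph[OF good(1)])
    have "res i G t \<omega> x = res i G' t' \<omega>' x"
      by (rule res_local[OF good]) (use view om x heard_list_eqD[OF h nb finite_nb] in auto)
    then show "?f a = ?f b" by (simp add: a_eq b_eq x)
  qed
  then obtain F where F: "\<And>a. a \<in> ?A \<Longrightarrow> F (?g a) = ?f a" by blast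
  show ?thesis
  proof (intro exI[of _ "\<lambda>v a h. F (v, a, h)"] allI impI)
    fix G t \<omega> x assume "(G, t, \<omega>) \<in> Good i" "x \<in> pverts G"
    then show "F (local_view G t x, \<omega> x, heard_list G (msg i G t \<omega>) (W (card (pverts G)) * 2 ^ i) x) =
        res i G t \<omega> x"
      using F[of "(G, t, \<omega>, x)"] by simp
  qed
qed

text \<open>The length of the history tells a node which window is running, and cutting off the
  earlier history starts each window afresh. Earlier windows may belong to failing attempts: what
  they send respects the bandwidth and is then forgotten. Only the last complete window has to be
  good.\<close>

theorem program:
  "\<exists>p :: ('a, 'i, 'o) seed_prog. prog_seed p = seed \<and>
     (\<forall>v a h y. 2 \<le> view_size v \<longrightarrow> real (length (prog_send p v a h y)) \<le> B * log 2 (view_size v)) \<and>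
     (\<forall>i R G t \<omega> x. (G, t, \<omega>) \<in> Good i \<longrightarrow> i = last_window (W (card (pverts G))) R \<longrightarrow>
        W (card (pverts G)) * (2 ^ Suc i - 1) \<le> R \<longrightarrow> x \<in> pverts G \<longrightarrow>
        prog_out p (local_view G t x) (\<omega> x) (hist p G t \<omega> R x) = res i G t \<omega> x)"
proof -
  obtain F where F:
    "\<And>i G t \<omega> x r y. \<lbrakk>(G, t, \<omega>) \<in> Good i; x \<in> pverts G; y \<in> neighbours G x; r < W (card (pverts G)) * 2 ^ i\<rbrakk>
      \<Longrightarrow> F i (local_view G t x) (\<omega> x) (heard_list G (msg i G t \<omega>) r x) y = msg i G t \<omega> r x y"
    and len: "\<And>i v a h y. 2 \<le> view_size v \<Longrightarrow> real (length (F i v a h y)) \<le> B * log 2 (view_size v)"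
    using message_function by metis
  obtain E where E: "\<And>i G t \<omega> x. \<lbrakk>(G, t, \<omega>) \<in> Good i; x \<in> pverts G\<rbrakk> \<Longrightarrow>
     E i (local_view G t x) (\<omega> x) (heard_list G (msg i G t \<omega>) (W (card (pverts G)) * 2 ^ i) x) =
       res i G t \<omega> x"
    using result_function by metis
  define p where "p = \<lparr>prog_seed = seed,
    prog_send = (\<lambda>v a h y. let i = window (W (view_size v)) (length h) in
      F i v a (drop (W (view_size v) * (2 ^ i - 1)) h) y),
    prog_out = (\<lambda>v a h. let i = last_window (W (view_size v)) (length h) in
      E i v a (take (W (view_size v) * 2 ^ i) (drop (W (view_size v) * (2 ^ i - 1)) h)))\<rparr>"
  have send_p: "prog_send p v a h y = F (window (W (view_size v)) (length h)) v a
      (drop (W (view_size v) * (2 ^ window (W (view_size v)) (length h) - 1)) h) y" for v a h y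
    by (simp add: p_def Let_def)
  have out_p: "prog_out p v a h = E (last_window (W (view_size v)) (length h)) v a
      (take (W (view_size v) * 2 ^ last_window (W (view_size v)) (length h))
        (drop (W (view_size v) * (2 ^ last_window (W (view_size v)) (length h) - 1)) h))" for v a h
    by (simp add: p_def Let_def)
  show ?thesis
  proof (intro exI[of _ p] conjI allI impI)
    show "prog_seed p = seed" by (simp add: p_def)
    show "real (length (prog_send p v a h y)) \<le> B * log 2 (view_size v)" if "2 \<le> view_size v" for v a h y
      using len[OF that] by (simp add: send_p)
  next
    fix i R G t \<omega> x
    assume good: "(G, t, \<omega>) \<in> Good i" and i: "i = last_window (W (card (pverts G))) R"
      and R: "W (card (pverts G)) * (2 ^ Suc i - 1) \<le> R" and x: "x \<in> pverts G"
    interpret connected_network G by (rule Good_graph[OF good])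
    define w st where "w = W (card (pverts G))" and "st = w * (2 ^ i - 1)"
    have w: "0 < w" using W_pos two by (simp add: w_def)
    have st_len: "st + w * 2 ^ i = w * (2 ^ Suc i - 1)"
      by (simp add: st_def diff_mult_distrib2 algebra_simps)
    have vs: "view_size (local_view G t y) = card (pverts G)" for y by (simp add: local_view_def)
    have win: "drop st (hist p G t \<omega> (st + r) y) = heard_list G (msg i G t \<omega>) r y"
      if "r \<le> w * 2 ^ i" "y \<in> pverts G" for r y
      using that
    proof (induction r arbitrary: y)
      case 0
      then show ?case by (simp add: heard_list_def)
    next
      case (Suc r)
      have wi: "window w (st + r) = i"
      proof (rule window_eq[OF w])
        show "w * (2 ^ i - 1) \<le> st + r" by (simp add: st_def)
        show "st + r < w * (2 ^ Suc i - 1)" unfolding st_len[symmetric] using Suc.prems(1) by linarith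
      qed
      have "prog_send p (local_view G t z) (\<omega> z) (hist p G t \<omega> (st + r) z) y = msg i G t \<omega> r z y"
        if z: "z \<in> neighbours G y" for z
      proof -
        have zV: "z \<in> pverts G" using z nb_subset by blast
        have "y \<in> neighbours G z" using z nb_sym by blast
        moreover have "prog_send p (local_view G t z) (\<omega> z) (hist p G t \<omega> (st + r) z) y =
            F i (local_view G t z) (\<omega> z) (heard_list G (msg i G t \<omega>) r z) y"
          using Suc.IH[OF _ zV] Suc.prems(1) wi 
          unfolding send_p vs length_hist w_def[symmetric] wi st_def[symmetric] by simp
        ultimately show ?thesis using F[OF good zV] Suc.prems(1) by (simp add: w_def)
      qed
      then have "map (\<lambda>z. prog_send p (local_view G t z) (\<omega> z) (hist p G t \<omega> (st + r) z) y)
            (sorted_list_of_set (neighbours G y)) =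
          map (\<lambda>z. msg i G t \<omega> r z y) (sorted_list_of_set (neighbours G y))"
        by (intro map_cong) auto
      then show ?case
        using Suc.IH[of y] Suc.prems by (simp add: heard_list_Suc)
    qed
    have "take (w * 2 ^ i) (drop st (hist p G t \<omega> R x)) = drop st (take (st + w * 2 ^ i) (hist p G t \<omega> R x))"
      by (simp add: take_drop add.commute)
    also have "\<dots> = heard_list G (msg i G t \<omega>) (w * 2 ^ i) x"
      using R win[OF order_refl x] unfolding st_len w_def[symmetric] by (simp add: take_hist)
    finally show "prog_out p (local_view G t x) (\<omega> x) (hist p G t \<omega> R x) = res i G t \<omega> x"
      using E[OF good x]
      unfolding out_p vs length_hist w_def[symmetric] i[folded w_def, symmetric] st_def[symmetric] by simp
  qed
qed

end

section \<open>Random seeds\<close>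

text \<open>A node does not know \<open>V\<close>, only a range \<open>U\<close> of possible labels;
  so seeds exist for tokens of all labels in \<open>U\<close>. \<open>X\<close> exceeds every
  possible \<open>dg G w * peak G f\<close>, so all coins that are read lie in the seed
  space.\<close>

locale seeded_network = token_protocol S J Tm T + connected_network G
  for S J Tm T :: nat and G :: network +
  fixes X :: nat and U :: "nat set"
  assumes T_le: "T \<le> Tm" and fin_U: "finite U" and V_U: "pverts G \<subseteq> U"
    and X_large: "card (pverts G) * (card (pverts G) ^ 2 + 1) < X"
begin

definition step_law :: "nat \<Rightarrow> nat \<Rightarrow> nat pmf" where
  "step_law x s = (if s < Tm then lazy_step G x else pmf_of_set {..<s - Tm})"

definition seed_pmf :: "(nat \<times> (nat \<times> nat) \<times> nat) set \<Rightarrow> seeds pmf" where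
  "seed_pmf K = Pi_pmf K 0 (\<lambda>(x, l, s). step_law x s)"

definition block :: "(nat \<times> nat) set \<Rightarrow> (nat \<times> (nat \<times> nat) \<times> nat) set" where
  "block L = V \<times> L \<times> {..<Tm + X}"

lemma finite_block: "finite L \<Longrightarrow> finite (block L)"
  by (simp add: block_def finite_V)

lemma seed_outside:
  assumes "finite K" "\<omega> \<in> set_pmf (seed_pmf K)" "i \<notin> K"
  shows "\<omega> i = 0"
  using subsetD[OF set_Pi_pmf_subset[OF assms(1)] assms(2)[unfolded seed_pmf_def]] assms(3) by blast

lemma path_cong:
  assumes "\<And>x s. s < m \<Longrightarrow> f (x, l, s) = g (x, l, s)"
  shows "path f l m = path g l m"
  using assms by (induction m) auto

subsection \<open>The law of one token\<close>

context
  fixes L and l :: "nat \<times> nat"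
  assumes L: "finite L" and l: "l \<in> L" and origin: "fst l \<in> V"
begin

text \<open>Seeds before time \<open>m\<close> determine the path, later ones are fresh; hence the
  position read next may depend on the node reached. Used with \<open>\<sigma> = m\<close> for the
  next step and with a degree-dependent \<open>\<sigma>\<close> for the final coin. The law of the
  path is a premise because \<open>path_law\<close> is proved from this lemma by induction.\<close>

lemma path_joint_law:
  assumes path: "map_pmf (\<lambda>\<omega>. path \<omega> l m) (seed_pmf (block L)) = lazy_walk G (fst l) m"
    and \<sigma>: "\<And>x. x \<in> V \<Longrightarrow> m \<le> \<sigma> x \<and> \<sigma> x < Tm + X"
  shows "map_pmf (\<lambda>\<omega>. (path \<omega> l m, \<omega> (path \<omega> l m, l, \<sigma> (path \<omega> l m)))) (seed_pmf (block L)) =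
    lazy_walk G (fst l) m \<bind> (\<lambda>x. map_pmf (Pair x) (step_law x (\<sigma> x)))"
proof -
  define A B where "A = {(x, l, s)\<in>block L. s < m}" and "B = {(x, l, s)\<in>block L. m \<le> s}"
  have fin: "finite A" "finite B"
    using finite_block[OF L] by (auto simp: A_def B_def elim: rev_finite_subset)
  let ?m = "\<lambda>(f, g) i. if i \<in> A then f i else g i"
  have split: "seed_pmf (block L) = map_pmf ?m (pair_pmf (seed_pmf A) (seed_pmf B))"
  proof -
    have "block L = A \<union> B" "A \<inter> B = {}" by (auto simp: A_def B_def)
    then show ?thesis unfolding seed_pmf_def using Pi_pmf_union[OF fin] by simp
  qed
  have path_m: "path (?m (f, g)) l m = path f l m"
    if f: "f \<in> set_pmf (seed_pmf A)" and g: "g \<in> set_pmf (seed_pmf B)" for f g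
  proof (rule path_cong)
    fix x s assume s: "s < m"
    have "(x, l, s) \<notin> B" using s by (simp add: B_def)
    then show "?m (f, g) (x, l, s) = f (x, l, s)"
      using seed_outside[OF fin(1) f] seed_outside[OF fin(2) g] by simp
  qed
  have path_A: "map_pmf (\<lambda>f. path f l m) (seed_pmf A) = lazy_walk G (fst l) m"
  proof -
    have "map_pmf (\<lambda>\<omega>. path \<omega> l m) (seed_pmf (block L)) =
        map_pmf (\<lambda>f. path f l m) (map_pmf fst (pair_pmf (seed_pmf A) (seed_pmf B)))"
      unfolding split pmf.map_comp by (intro map_pmf_cong refl) (use path_m in auto)
    then show ?thesis using path by (simp add: map_fst_pair_pmf)
  qed
  let ?h = "\<lambda>x g. (x, g (x, l, \<sigma> x))"
  have "map_pmf (\<lambda>\<omega>. (path \<omega> l m, \<omega> (path \<omega> l m, l, \<sigma> (path \<omega> l m)))) (seed_pmf (block L)) =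
      map_pmf (\<lambda>(f, g). ?h (path f l m) g) (pair_pmf (seed_pmf A) (seed_pmf B))"
    unfolding split pmf.map_comp
  proof (intro map_pmf_cong refl)
    fix fg assume fg: "fg \<in> set_pmf (pair_pmf (seed_pmf A) (seed_pmf B))"
    obtain f g where fg_eq: "fg = (f, g)" by (cases fg)
    have f: "f \<in> set_pmf (seed_pmf A)" and g: "g \<in> set_pmf (seed_pmf B)"
      using fg by (auto simp: fg_eq)
    have "path f l m \<in> set_pmf (map_pmf (\<lambda>f. path f l m) (seed_pmf A))" using f by simp
    then have "path f l m \<in> V" unfolding path_A using set_lazy_walk[OF origin] by blast
    then have "(path f l m, l, \<sigma> (path f l m)) \<notin> A"
      using \<sigma>[of "path f l m"] by (auto simp: A_def)
    then show "((\<lambda>\<omega>. (path \<omega> l m, \<omega> (path \<omega> l m, l, \<sigma> (path \<omega> l m)))) \<circ> ?m) fg =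
        (\<lambda>(f, g). ?h (path f l m) g) fg"
      using path_m[OF f g] by (simp add: fg_eq)
  qed
  also have "\<dots> = seed_pmf A \<bind> (\<lambda>f. map_pmf (?h (path f l m)) (seed_pmf B))"
    by (simp add: pair_pmf_def map_pmf_def bind_assoc_pmf bind_return_pmf)
  also have "\<dots> = lazy_walk G (fst l) m \<bind> (\<lambda>x. map_pmf (?h x) (seed_pmf B))"
    unfolding path_A[symmetric] bind_map_pmf ..
  also have "\<dots> = lazy_walk G (fst l) m \<bind> (\<lambda>x. map_pmf (Pair x) (step_law x (\<sigma> x)))"
  proof (intro bind_pmf_cong refl)
    fix x assume "x \<in> set_pmf (lazy_walk G (fst l) m)"
    then have "x \<in> V" using set_lazy_walk[OF origin] by blast
    then have "(x, l, \<sigma> x) \<in> B" using \<sigma>[of x] l by (simp add: B_def block_def)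
    then have "map_pmf (\<lambda>g. g (x, l, \<sigma> x)) (seed_pmf B) = step_law x (\<sigma> x)"
      by (simp add: seed_pmf_def Pi_pmf_component[OF fin(2)])
    then show "map_pmf (?h x) (seed_pmf B) = map_pmf (Pair x) (step_law x (\<sigma> x))"
      by (simp add: pmf.map_comp o_def flip: \<open>map_pmf (\<lambda>g. g (x, l, \<sigma> x)) (seed_pmf B) = step_law x (\<sigma> x)\<close>)
  qed
  finally show ?thesis .
qed

lemma path_law:
  assumes "m \<le> Tm"
  shows "map_pmf (\<lambda>\<omega>. path \<omega> l m) (seed_pmf (block L)) = lazy_walk G (fst l) m"
  using assms
proof (induction m)
  case 0
  then show ?case by (simp add: map_pmf_const)
next
  case (Suc m)
  then have IH: "map_pmf (\<lambda>\<omega>. path \<omega> l m) (seed_pmf (block L)) = lazy_walk G (fst l) m" by simp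
  have "map_pmf (\<lambda>\<omega>. path \<omega> l (Suc m)) (seed_pmf (block L)) =
      map_pmf snd (map_pmf (\<lambda>\<omega>. (path \<omega> l m, \<omega> (path \<omega> l m, l, m))) (seed_pmf (block L)))"
    by (simp add: pmf.map_comp o_def)
  also have "map_pmf (\<lambda>\<omega>. (path \<omega> l m, \<omega> (path \<omega> l m, l, m))) (seed_pmf (block L)) =
      lazy_walk G (fst l) m \<bind> (\<lambda>x. map_pmf (Pair x) (step_law x m))"
    using path_joint_law[OF IH, of "\<lambda>_. m"] Suc.prems by simp
  also have "map_pmf snd \<dots> = lazy_walk G (fst l) (Suc m)"
    using Suc.prems by (simp add: map_bind_pmf pmf.map_comp o_def step_law_def)
  finally show ?case .
qed

lemmas joint_law = path_joint_law[OF path_law]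

lemma prob_path:
  assumes "m \<le> Tm"
  shows "measure_pmf.prob (seed_pmf (block L)) {\<omega>. path \<omega> l m = w} = pmf (lazy_walk G (fst l) m) w"
proof -
  have "measure_pmf.prob (seed_pmf (block L)) {\<omega>. path \<omega> l m = w} =
      measure_pmf.prob (map_pmf (\<lambda>\<omega>. path \<omega> l m) (seed_pmf (block L))) {w}"
    by (simp add: measure_map_pmf vimage_def)
  then show ?thesis by (simp add: path_law[OF assms] pmf.rep_eq)
qed

lemma prob_path_step:
  assumes "m < Tm" "x \<in> V"
  shows "measure_pmf.prob (seed_pmf (block L)) {\<omega>. path \<omega> l m = x \<and> path \<omega> l (Suc m) = y} =
    pmf (lazy_walk G (fst l) m) x * pmf (lazy_step G x) y"
proof -
  have "measure_pmf.prob (seed_pmf (block L)) {\<omega>. path \<omega> l m = x \<and> path \<omega> l (Suc m) = y} =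
      measure_pmf.prob (map_pmf (\<lambda>\<omega>. (path \<omega> l m, \<omega> (path \<omega> l m, l, m))) (seed_pmf (block L))) {(x, y)}"
    by (simp add: measure_map_pmf vimage_def)
  also have "\<dots> = pmf (lazy_walk G (fst l) m \<bind> (\<lambda>x. map_pmf (Pair x) (lazy_step G x))) (x, y)"
    using assms by (subst joint_law) (auto simp: step_law_def pmf.rep_eq)
  also have "\<dots> = (\<Sum>z\<in>V. pmf (lazy_walk G (fst l) m) z * pmf (map_pmf (Pair z) (lazy_step G z)) (x, y))"
    by (rule pmf_bind_V) (rule set_lazy_walk[OF origin])
  also have "\<dots> = (\<Sum>z\<in>V. if z = x then pmf (lazy_walk G (fst l) m) x * pmf (lazy_step G x) y else 0)"
  proof (intro sum.cong refl)
    fix z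
    have "pmf (map_pmf (Pair z) (lazy_step G z)) (x, y) = (if z = x then pmf (lazy_step G x) y else 0)"
    proof (cases "z = x")
      case True
      then show ?thesis by (simp add: pmf_map_inj' inj_on_def)
    next
      case False
      then show ?thesis by (auto simp: pmf_eq_0_set_pmf)
    qed
    then show "pmf (lazy_walk G (fst l) m) z * pmf (map_pmf (Pair z) (lazy_step G z)) (x, y) =
        (if z = x then pmf (lazy_walk G (fst l) m) x * pmf (lazy_step G x) y else 0)" by simp
  qed
  finally show ?thesis using assms(2) finite_V by simp
qed

end

subsection \<open>Independence of tokens\<close>

definition token_local :: "(nat \<times> nat) \<Rightarrow> (seeds \<Rightarrow> 'b) \<Rightarrow> bool" where
  "token_local l F \<longleftrightarrow> (\<forall>f g. (\<forall>x s. f (x, l, s) = g (x, l, s)) \<longrightarrow> F f = F g)"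

lemma token_local_path: "token_local l (\<lambda>\<omega>. P (path \<omega> l m))"
  unfolding token_local_def using path_cong[of m _ l] by metis

lemma token_local_conj:
  "token_local l A \<Longrightarrow> token_local l B \<Longrightarrow> token_local l (\<lambda>\<omega>. A \<omega> \<and> B \<omega>)"
  unfolding token_local_def by metis

lemma tokens_independent:
  assumes "finite L" "finite K" "\<And>l. l \<in> L \<Longrightarrow> token_local l (F l)"
  shows "map_pmf (\<lambda>\<omega> l. if l \<in> L then F l \<omega> else d) (seed_pmf K) =
    Pi_pmf L d (\<lambda>l. map_pmf (F l) (seed_pmf K))"
  unfolding seed_pmf_def
proof (rule Pi_pmf_blocks'[OF assms(1,2), where B = "\<lambda>l. UNIV \<times> {l} \<times> UNIV"])
  show "disjoint_family_on (\<lambda>l. UNIV \<times> {l} \<times> UNIV) L"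
    by (auto simp: disjoint_family_on_def)
  show "F l f = F l g" if "l \<in> L" "\<And>i. i \<in> UNIV \<times> {l} \<times> UNIV \<Longrightarrow> f i = g i" for l f g
    using assms(3)[OF that(1)] that(2) by (simp add: token_local_def)
qed

lemma count_tail:
  assumes L: "finite L" and K: "finite K" and loc: "\<And>l. l \<in> L \<Longrightarrow> token_local l (A l)"
    and \<mu>: "(\<Sum>l\<in>L. measure_pmf.prob (seed_pmf K) {\<omega>. A l \<omega>}) \<le> \<mu>"
  shows "measure_pmf.prob (seed_pmf K) {\<omega>. q \<le> card {l\<in>L. A l \<omega>}} \<le> 2 powr (2 * \<mu> - real q)"
proof -
  let ?M = "map_pmf (\<lambda>\<omega> l. if l \<in> L then A l \<omega> else False) (seed_pmf K)"
  have "measure_pmf.prob (seed_pmf K) {\<omega>. q \<le> card {l\<in>L. A l \<omega>}} =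
      measure_pmf.prob ?M {f. q \<le> card {l\<in>L. f l}}"
    by (simp add: measure_map_pmf vimage_def cong: conj_cong)
  also have "?M = Pi_pmf L False (\<lambda>l. map_pmf (A l) (seed_pmf K))"
    by (rule tokens_independent[OF L K loc])
  also have "measure_pmf.prob \<dots> {f. q \<le> card {l\<in>L. f l}} \<le> 2 powr (2 * \<mu> - real q)"
    by (rule Pi_pmf_count_tail[OF L]) (use \<mu> in \<open>simp add: measure_map_pmf vimage_def\<close>)
  finally show ?thesis .
qed

lemma prob_all:
  assumes L: "finite L" and K: "finite K" and loc: "\<And>l. l \<in> L \<Longrightarrow> token_local l (A l)"
  shows "measure_pmf.prob (seed_pmf K) {\<omega>. \<forall>l\<in>L. A l \<omega>} =
    (\<Prod>l\<in>L. measure_pmf.prob (seed_pmf K) {\<omega>. A l \<omega>})"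
proof -
  let ?M = "map_pmf (\<lambda>\<omega> l. if l \<in> L then A l \<omega> else False) (seed_pmf K)"
  have "measure_pmf.prob (seed_pmf K) {\<omega>. \<forall>l\<in>L. A l \<omega>} = measure_pmf.prob ?M (Pi L (\<lambda>_. {True}))"
    by (simp add: measure_map_pmf vimage_def Pi_def Ball_def del: split_paired_All)
  also have "?M = Pi_pmf L False (\<lambda>l. map_pmf (A l) (seed_pmf K))"
    by (rule tokens_independent[OF L K loc])
  finally show ?thesis
    by (simp add: measure_Pi_pmf_Pi[OF L] measure_map_pmf vimage_def)
qed

subsection \<open>Congestion\<close>

definition all_seeds :: "seeds pmf" where
  "all_seeds = seed_pmf (block (U \<times> {..<J}))"

lemma tokens_subset: "tokens G \<subseteq> U \<times> {..<J}"
  using V_U by (auto simp: tokens_def)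

text \<open>For one token per node, weighting the starts by their degrees, which are at least 1,
  bounds the expected number of tokens at \<open>x\<close> by \<open>dg G x\<close>, by
  stationarity. A given arc is taken with probability \<open>1 / (2 * dg G x)\<close>, so
  \<open>J\<close> tokens per node give a mean of at most \<open>J / 2\<close>.\<close>

lemma congestion_prob:
  assumes arc: "(x, y) \<in> parcs G" and s: "s < T"
  shows "measure_pmf.prob all_seeds {\<omega>. q \<le> card {l\<in>tokens G. path \<omega> l s = x \<and> path \<omega> l (Suc s) = y}} \<le>
    2 powr (real J - real q)"
proof -
  have x: "x \<in> V" and y: "y \<in> nb x" "y \<noteq> x" using arc arc_V no_loop by (auto simp: nb_iff)
  have "(\<Sum>l\<in>tokens G. measure_pmf.prob all_seeds {\<omega>. path \<omega> l s = x \<and> path \<omega> l (Suc s) = y}) =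
      (\<Sum>l\<in>tokens G. pmf (lazy_walk G (fst l) s) x / (2 * real (dg G x)))"
  proof (intro sum.cong refl)
    fix l assume "l \<in> tokens G"
    then have "l \<in> U \<times> {..<J}" "fst l \<in> V" using tokens_subset by (auto simp: tokens_def)
    then show "measure_pmf.prob all_seeds {\<omega>. path \<omega> l s = x \<and> path \<omega> l (Suc s) = y} =
        pmf (lazy_walk G (fst l) s) x / (2 * real (dg G x))"
      unfolding all_seeds_def using fin_U s T_le x y
      by (subst prob_path_step) (auto simp: pmf_lazy_step)
  qed
  also have "\<dots> = real J * (\<Sum>u\<in>V. pmf (lazy_walk G u s) x) / (2 * real (dg G x))"
    by (simp add: tokens_def sum_distrib_left sum_divide_distrib sum.cartesian_product')
  also have "\<dots> \<le> real J * real (dg G x) / (2 * real (dg G x))"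
  proof -
    have "(\<Sum>u\<in>V. pmf (lazy_walk G u s) x) \<le> (\<Sum>u\<in>V. real (dg G u) * pmf (lazy_walk G u s) x)"
      by (intro sum_mono) (use dg_pos in \<open>force simp: Suc_le_eq mult_le_cancel_right1\<close>)
    then show ?thesis by (intro divide_right_mono mult_left_mono) (simp_all add: stationary[OF x])
  qed
  also have "\<dots> = real J / 2" using dg_pos[OF x] by simp
  finally have "measure_pmf.prob all_seeds {\<omega>. q \<le> card {l\<in>tokens G. path \<omega> l s = x \<and> path \<omega> l (Suc s) = y}} \<le>
    2 powr (2 * (real J / 2) - real q)"
    unfolding all_seeds_def
    by (intro count_tail token_local_conj token_local_path)
      (auto simp: finite_block fin_U finite_tokens finite_V)
  then show ?thesis by simp
qed

end

section \<open>Mixtures of product laws\<close>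

lemma measure_pmf_prob_bind:
  "measure_pmf.prob (M \<bind> N) X = measure_pmf.expectation M (\<lambda>x. measure_pmf.prob (N x) X)"
proof -
  have eq: "measure_pmf.prob p X = pmf (map_pmf (\<lambda>x. x \<in> X) p) True" for p
    by (simp add: pmf_map vimage_def)
  show ?thesis unfolding eq map_bind_pmf pmf_bind ..
qed

lemma integrable_pmf_bounded:
  fixes f :: "'a \<Rightarrow> real"
  assumes "\<And>x. x \<in> set_pmf M \<Longrightarrow> 0 \<le> f x \<and> f x \<le> b"
  shows "integrable (measure_pmf M) f"
  by (rule measure_pmf.integrable_const_bound[where B = b]) (use assms in \<open>auto simp: AE_measure_pmf_iff\<close>)

lemma prob_bind_le:
  assumes "\<And>x. x \<in> set_pmf M \<Longrightarrow> measure_pmf.prob (N x) X \<le> b"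
  shows "measure_pmf.prob (M \<bind> N) X \<le> b"
proof -
  have "measure_pmf.expectation M (\<lambda>x. measure_pmf.prob (N x) X) \<le> measure_pmf.expectation M (\<lambda>_. b)"
    by (rule integral_mono_AE)
      (use assms in \<open>auto simp: AE_measure_pmf_iff intro!: integrable_pmf_bounded[where b = 1]\<close>)
  then show ?thesis by (simp add: measure_pmf_prob_bind)
qed

lemma prob_Pi_pmf_fixed:
  assumes V: "finite V" and Z: "Z \<subseteq> V"
  shows "measure_pmf.prob (Pi_pmf V d A) {t. \<forall>z\<in>Z. t z = a z} = (\<Prod>z\<in>Z. pmf (A z) (a z))"
proof -
  let ?B = "\<lambda>z. if z \<in> Z then {a z} else UNIV"
  have "{t. \<forall>z\<in>Z. t z = a z} = Pi V ?B"
    using Z by (auto simp: Pi_def split: if_splits)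
  then have "measure_pmf.prob (Pi_pmf V d A) {t. \<forall>z\<in>Z. t z = a z} =
      (\<Prod>z\<in>V. measure_pmf.prob (A z) (?B z))"
    using V by (simp add: measure_Pi_pmf_Pi)
  also have "\<dots> = (\<Prod>z\<in>V. if z \<in> Z then pmf (A z) (a z) else 1)"
    by (intro prod.cong) (auto simp: pmf.rep_eq)
  also have "\<dots> = (\<Prod>z\<in>V \<inter> Z. pmf (A z) (a z))"
    using V by (simp add: prod.inter_restrict)
  also have "V \<inter> Z = Z" using Z by blast
  finally show ?thesis .
qed

text \<open>Given \<open>f\<close>, the value at \<open>u\<close> is independent of those on
  \<open>Z\<close>, so the conditional probability is \<open>E[x y] / E[y]\<close> with
  \<open>x\<close> between the two bounds for every \<open>f\<close>. The quotient stays between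
  them however small \<open>E[y]\<close> is.\<close>

lemma mixture_gossip_sampler:
  fixes P :: "'f pmf" and A :: "'f \<Rightarrow> nat \<Rightarrow> nat pmf"
  assumes V: "finite V"
    and supp: "\<And>f u. f \<in> set_pmf P \<Longrightarrow> u \<in> V \<Longrightarrow> set_pmf (A f u) \<subseteq> V"
    and lo: "\<And>f u v. f \<in> set_pmf P \<Longrightarrow> u \<in> V \<Longrightarrow> v \<in> V \<Longrightarrow> (1 - lam) / real (card V) \<le> pmf (A f u) v"
    and hi: "\<And>f u v. f \<in> set_pmf P \<Longrightarrow> u \<in> V \<Longrightarrow> v \<in> V \<Longrightarrow> pmf (A f u) v \<le> (1 + lam) / real (card V)"
  shows "gossip_sampler lam V (P \<bind> (\<lambda>f. Pi_pmf V d (A f)))"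
  unfolding gossip_sampler_def
proof (intro conjI ballI allI impI)
  fix t u assume "t \<in> set_pmf (P \<bind> (\<lambda>f. Pi_pmf V d (A f)))" and u: "u \<in> V"
  then obtain f where f: "f \<in> set_pmf P" "t \<in> set_pmf (Pi_pmf V d (A f))" by auto
  then show "t u \<in> V" using u V supp[OF f(1) u] by (auto simp: set_Pi_pmf PiE_dflt_def)
next
  let ?M = "P \<bind> (\<lambda>f. Pi_pmf V d (A f))"
  fix u v Z and a :: "nat \<Rightarrow> nat"
  assume u: "u \<in> V" and v: "v \<in> V" and Z: "Z \<subseteq> V" and uZ: "u \<notin> Z"
    and pos: "\<P>(t in ?M. \<forall>z\<in>Z. t z = a z) > 0"
  define x where "x f = pmf (A f u) v" for f
  define y where "y f = (\<Prod>z\<in>Z. pmf (A f z) (a z))" for f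
  have fin_Z: "finite Z" using Z V by (rule finite_subset)
  have y01: "0 \<le> y f \<and> y f \<le> 1" for f
    unfolding y_def by (auto intro!: prod_nonneg prod_le_1 pmf_le_1)
  have Q: "\<P>(t in ?M. \<forall>z\<in>Z. t z = a z) = measure_pmf.expectation P y"
    by (simp add: measure_pmf_prob_bind prob_Pi_pmf_fixed[OF V Z] y_def[abs_def])
  have "{t. t u = v \<and> (\<forall>z\<in>Z. t z = a z)} = {t. \<forall>z\<in>insert u Z. t z = (a(u := v)) z}"
    using uZ by auto
  moreover have "(\<Prod>z\<in>insert u Z. pmf (A f z) ((a(u := v)) z)) = x f * y f" for f
  proof -
    have "(\<Prod>z\<in>Z. pmf (A f z) ((a(u := v)) z)) = y f"
      unfolding y_def by (intro prod.cong) (use uZ in auto)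
    then show ?thesis using fin_Z uZ by (simp add: x_def)
  qed
  ultimately have "measure_pmf.prob (Pi_pmf V d (A f)) {t. t u = v \<and> (\<forall>z\<in>Z. t z = a z)} = x f * y f" for f
    using prob_Pi_pmf_fixed[OF V, of "insert u Z" d "A f" "a(u := v)"] u Z by (simp only: insert_subset)
  then have PQ: "\<P>(t in ?M. t u = v \<and> (\<forall>z\<in>Z. t z = a z)) = measure_pmf.expectation P (\<lambda>f. x f * y f)"
    by (simp add: measure_pmf_prob_bind)
  have int_y: "integrable (measure_pmf P) y"
    by (rule integrable_pmf_bounded[where b = 1]) (rule y01)
  have int_xy: "integrable (measure_pmf P) (\<lambda>f. x f * y f)"
    by (rule integrable_pmf_bounded[where b = 1]) (use y01 in \<open>auto simp: x_def pmf_le_1 mult_le_one\<close>)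
  have "measure_pmf.expectation P (\<lambda>f. (1 - lam) / real (card V) * y f) \<le> measure_pmf.expectation P (\<lambda>f. x f * y f)"
  proof (rule integral_mono_AE)
    show "AE f in P. (1 - lam) / real (card V) * y f \<le> x f * y f"
      unfolding AE_measure_pmf_iff x_def using lo[OF _ u v] y01 by (blast intro: mult_right_mono)
  qed (use int_y int_xy in auto)
  moreover have "measure_pmf.expectation P (\<lambda>f. x f * y f) \<le> measure_pmf.expectation P (\<lambda>f. (1 + lam) / real (card V) * y f)"
  proof (rule integral_mono_AE)
    show "AE f in P. x f * y f \<le> (1 + lam) / real (card V) * y f"
      unfolding AE_measure_pmf_iff x_def using hi[OF _ u v] y01 by (blast intro: mult_right_mono)
  qed (use int_y int_xy in auto)
  ultimately have "(1 - lam) / real (card V) * measure_pmf.expectation P y \<le> measure_pmf.expectation P (\<lambda>f. x f * y f)"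
    "measure_pmf.expectation P (\<lambda>f. x f * y f) \<le> (1 + lam) / real (card V) * measure_pmf.expectation P y"
    by simp_all
  then show "\<P>(t in ?M. t u = v \<bar> \<forall>z\<in>Z. t z = a z) \<in> {(1 - lam) / real (card V)..(1 + lam) / real (card V)}"
    using pos unfolding cond_prob_def Q PQ by (simp add: le_divide_eq divide_le_eq)
qed

section \<open>Rejection sampling\<close>

definition last_hit :: "nat \<Rightarrow> nat \<Rightarrow> (nat \<Rightarrow> 'v option) \<Rightarrow> 'v option" where
  "last_hit S J h = (let H = {j\<in>{S..<J}. h j \<noteq> None} in if H = {} then None else h (Max H))"

lemma last_hit_cong: "(\<And>j. S \<le> j \<Longrightarrow> j < J \<Longrightarrow> h j = h' j) \<Longrightarrow> last_hit S J h = last_hit S J h'"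
proof -
  assume eq: "\<And>j. S \<le> j \<Longrightarrow> j < J \<Longrightarrow> h j = h' j"
  have H: "{j\<in>{S..<J}. h j \<noteq> None} = {j\<in>{S..<J}. h' j \<noteq> None}" using eq by auto
  show ?thesis
  proof (cases "{j\<in>{S..<J}. h' j \<noteq> None} = {}")
    case False
    then have "Max {j\<in>{S..<J}. h' j \<noteq> None} \<in> {j\<in>{S..<J}. h' j \<noteq> None}" by (intro Max_in) auto
    then show ?thesis using eq unfolding last_hit_def Let_def H by auto
  next
    case True
    then show ?thesis unfolding last_hit_def Let_def H by (simp only: if_True simp_thms)
  qed
qed

lemma last_hit_Nil [simp]: "last_hit S S h = None"
  by (simp add: last_hit_def)

lemma last_hit_Suc:
  assumes "S \<le> J"
  shows "last_hit S (Suc J) h = (case h J of None \<Rightarrow> last_hit S J h | Some v \<Rightarrow> Some v)"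
proof (cases "h J")
  case None
  have "{j\<in>{S..<Suc J}. h j \<noteq> None} = {j\<in>{S..<J}. h j \<noteq> None}"
    using None by (auto simp: less_Suc_eq)
  then show ?thesis using None by (simp add: last_hit_def)
next
  case (Some v)
  have "Max {j\<in>{S..<Suc J}. h j \<noteq> None} = J"
    using assms Some by (intro Max_eqI) auto
  moreover have "{j\<in>{S..<Suc J}. h j \<noteq> None} \<noteq> {}" using assms Some by auto
  ultimately show ?thesis using Some unfolding last_hit_def Let_def by simp
qed

text \<open>A uniform substitute when no request is answered. It keeps the law defined on all
  executions instead of conditioning on success.\<close>

definition fallback :: "'v set \<Rightarrow> 'v option \<Rightarrow> 'v pmf" where
  "fallback V r = (case r of None \<Rightarrow> pmf_of_set V | Some v \<Rightarrow> return_pmf v)"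

definition sample_law :: "'v set \<Rightarrow> 'v option pmf \<Rightarrow> nat \<Rightarrow> nat \<Rightarrow> 'v pmf" where
  "sample_law V r S J = map_pmf (last_hit S J) (Pi_pmf {S..<J} None (\<lambda>_. r)) \<bind> fallback V"

text \<open>The last request is decisive if it is answered; otherwise the earlier ones are.\<close>

lemma sample_law_Suc:
  assumes "S \<le> J"
  shows "sample_law V r S (Suc J) =
    r \<bind> (\<lambda>h. case h of None \<Rightarrow> sample_law V r S J | Some v \<Rightarrow> return_pmf v)"
proof -
  have ins: "{S..<Suc J} = insert J {S..<J}" using assms by auto
  have upd: "last_hit S J (f(J := y)) = last_hit S J f" for f :: "nat \<Rightarrow> 'a option" and y
    by (rule last_hit_cong) auto
  have "sample_law V r S (Suc J) =
      r \<bind> (\<lambda>y. Pi_pmf {S..<J} None (\<lambda>_. r) \<bind> (\<lambda>f. fallback V (last_hit S (Suc J) (f(J := y)))))"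
    unfolding sample_law_def ins
    by (simp add: Pi_pmf_insert' bind_map_pmf bind_assoc_pmf bind_return_pmf)
  also have "\<dots> = r \<bind> (\<lambda>h. case h of None \<Rightarrow> sample_law V r S J | Some v \<Rightarrow> return_pmf v)"
    by (intro bind_pmf_cong refl)
      (auto simp: last_hit_Suc[OF assms] upd sample_law_def bind_map_pmf fallback_def split: option.splits)
  finally show ?thesis .
qed

text \<open>One more request maps a probability \<open>x\<close> to
  \<open>pmf r (Some v) + q * x\<close> with rejection probability \<open>q\<close>. Since
  \<open>1 - q\<close> is about \<open>card V * \<kappa>\<close>, the claimed interval is invariant
  under this map, and the fallback starts inside it. The factor 4 is room for
  \<open>(1 + \<delta>) / (1 - \<delta>)\<close>.\<close>

lemma sample_law_bounds:
  fixes r :: "'v option pmf"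
  assumes V: "finite V" "V \<noteq> {}" and SJ: "S \<le> J"
    and supp: "set_pmf r \<subseteq> insert None (Some ` V)"
    and lo: "\<And>v. v \<in> V \<Longrightarrow> (1 - \<delta>) * \<kappa> \<le> pmf r (Some v)"
    and hi: "\<And>v. v \<in> V \<Longrightarrow> pmf r (Some v) \<le> (1 + \<delta>) * \<kappa>"
    and \<delta>: "0 \<le> \<delta>" "\<delta> \<le> 1 / 4" and \<kappa>: "0 \<le> \<kappa>"
  shows "set_pmf (sample_law V r S J) \<subseteq> V"
    and "v \<in> V \<Longrightarrow> (1 - 4 * \<delta>) / real (card V) \<le> pmf (sample_law V r S J) v"
    and "v \<in> V \<Longrightarrow> pmf (sample_law V r S J) v \<le> (1 + 4 * \<delta>) / real (card V)"
proof -
  let ?N = "real (card V)"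
  have N: "0 < ?N" using V by (simp add: card_gt_0_iff)
  have total: "pmf r None + (\<Sum>v\<in>V. pmf r (Some v)) = 1"
  proof -
    have "(\<Sum>h\<in>insert None (Some ` V). pmf r h) = 1"
      using V supp by (intro sum_pmf_eq_1) auto
    then show ?thesis using V by (simp add: sum.reindex)
  qed
  define q where "q = pmf r None"
  have "(\<Sum>v\<in>V. (1 - \<delta>) * \<kappa>) \<le> (\<Sum>v\<in>V. pmf r (Some v))" by (intro sum_mono lo)
  then have q1: "?N * ((1 - \<delta>) * \<kappa>) \<le> 1 - q" using total by (simp add: q_def)
  have "(\<Sum>v\<in>V. pmf r (Some v)) \<le> (\<Sum>v\<in>V. (1 + \<delta>) * \<kappa>)" by (intro sum_mono hi)
  then have q2: "1 - q \<le> ?N * ((1 + \<delta>) * \<kappa>)" using total by (simp add: q_def)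
  have ub: "(1 + \<delta>) * \<kappa> \<le> (1 + 4 * \<delta>) / ?N * (1 - q)"
  proof -
    have "1 + \<delta> \<le> (1 + 4 * \<delta>) * (1 - \<delta>)"
    proof -
      have "4 * \<delta> * \<delta> \<le> 4 * \<delta> * (1 / 4)" using \<delta> by (intro mult_left_mono) auto
      then show ?thesis using \<delta> by (simp add: algebra_simps)
    qed
    then have "(1 + \<delta>) * \<kappa> \<le> (1 + 4 * \<delta>) * ((1 - \<delta>) * \<kappa>)"
      using \<kappa> by (simp add: mult_right_mono flip: mult.assoc)
    also have "(1 - \<delta>) * \<kappa> \<le> (1 - q) / ?N" using q1 N by (simp add: le_divide_eq mult.commute)
    finally show ?thesis using \<delta> N by (simp add: mult_left_mono)
  qed
  have lb: "(1 - 4 * \<delta>) / ?N * (1 - q) \<le> (1 - \<delta>) * \<kappa>"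
  proof -
    have "(1 - 4 * \<delta>) / ?N * (1 - q) \<le> (1 - 4 * \<delta>) / ?N * (?N * ((1 + \<delta>) * \<kappa>))"
      using q2 \<delta> N by (intro mult_left_mono) auto
    also have "\<dots> = (1 - 4 * \<delta>) * (1 + \<delta>) * \<kappa>" using N by simp
    also have "\<dots> \<le> (1 - \<delta>) * \<kappa>"
      using \<delta> \<kappa> by (intro mult_right_mono) (auto simp: algebra_simps)
    finally show ?thesis .
  qed
  have base: "(1 - 4 * \<delta>) / ?N \<le> 1 / ?N" "1 / ?N \<le> (1 + 4 * \<delta>) / ?N"
    using \<delta> N by (auto intro!: divide_right_mono)
  have main: "set_pmf (sample_law V r S J) \<subseteq> V \<and>
      (\<forall>v\<in>V. (1 - 4 * \<delta>) / ?N \<le> pmf (sample_law V r S J) v \<and> pmf (sample_law V r S J) v \<le> (1 + 4 * \<delta>) / ?N)"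
    using SJ
  proof (induction J rule: dec_induct)
    case base
    have "sample_law V r S S = pmf_of_set V"
      by (simp add: sample_law_def bind_return_pmf fallback_def)
    then show ?case using V \<open>(1 - 4 * \<delta>) / ?N \<le> 1 / ?N\<close> \<open>1 / ?N \<le> (1 + 4 * \<delta>) / ?N\<close> by simp
  next
    case (step J)
    let ?A = "sample_law V r S J"
    have supp': "set_pmf (sample_law V r S (Suc J)) \<subseteq> V"
    proof
      fix x assume "x \<in> set_pmf (sample_law V r S (Suc J))"
      then obtain h where h: "h \<in> set_pmf r"
        "x \<in> set_pmf (case h of None \<Rightarrow> ?A | Some v \<Rightarrow> return_pmf v)"
        unfolding sample_law_Suc[OF step.hyps(1)] set_bind_pmf by blast
      show "x \<in> V"
      proof (cases h)
        case None
        then show ?thesis using h(2) step.IH by auto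
      next
        case (Some v)
        then show ?thesis using h supp by auto
      qed
    qed
    have pmf_Suc: "pmf (sample_law V r S (Suc J)) v = pmf r (Some v) + q * pmf ?A v" if v: "v \<in> V" for v
    proof -
      have "pmf (sample_law V r S (Suc J)) v =
          (\<Sum>h\<in>insert None (Some ` V). pmf r h * pmf (case h of None \<Rightarrow> ?A | Some v \<Rightarrow> return_pmf v) v)"
        unfolding sample_law_Suc[OF step.hyps(1)] pmf_bind
        by (subst integral_measure_pmf_real[where A = "insert None (Some ` V)"])
          (use V supp in \<open>auto simp: mult.commute\<close>)
      also have "\<dots> = q * pmf ?A v + (\<Sum>w\<in>V. pmf r (Some w) * pmf (return_pmf w) v)"
        using V by (simp add: sum.reindex q_def)
      also have "(\<Sum>w\<in>V. pmf r (Some w) * pmf (return_pmf w) v) =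
          (\<Sum>w\<in>V. if w = v then pmf r (Some v) else 0)"
        by (intro sum.cong) (auto simp: indicator_def)
      finally show ?thesis using v V by simp
    qed
    have q0: "0 \<le> q" by (simp add: q_def)
    have "(1 - 4 * \<delta>) / ?N \<le> pmf (sample_law V r S (Suc J)) v \<and>
        pmf (sample_law V r S (Suc J)) v \<le> (1 + 4 * \<delta>) / ?N" if v: "v \<in> V" for v
    proof -
      have IH: "(1 - 4 * \<delta>) / ?N \<le> pmf ?A v" "pmf ?A v \<le> (1 + 4 * \<delta>) / ?N"
        using step.IH v by auto
      have "(1 - 4 * \<delta>) / ?N * q \<le> q * pmf ?A v" "q * pmf ?A v \<le> (1 + 4 * \<delta>) / ?N * q"
        using mult_left_mono[OF IH(1) q0] mult_left_mono[OF IH(2) q0] by (simp_all add: mult.commute)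
      moreover have split: "z * (1 - q) + z * q = z" for z by (simp add: algebra_simps)
      note split[of "(1 - 4 * \<delta>) / ?N"] split[of "(1 + 4 * \<delta>) / ?N"]
      ultimately show ?thesis
        unfolding pmf_Suc[OF v] using lo[OF v] hi[OF v] lb ub by linarith
    qed
    with supp' show ?case by blast
  qed
  then show "set_pmf (sample_law V r S J) \<subseteq> V"
    "v \<in> V \<Longrightarrow> (1 - 4 * \<delta>) / ?N \<le> pmf (sample_law V r S J) v"
    "v \<in> V \<Longrightarrow> pmf (sample_law V r S J) v \<le> (1 + 4 * \<delta>) / ?N" by auto
qed

section \<open>The law of the targets\<close>

context seeded_network
begin

abbreviation home_labels :: "(nat \<times> nat) set" where "home_labels \<equiv> U \<times> {..<S}"
abbreviation request_labels :: "(nat \<times> nat) set" where "request_labels \<equiv> U \<times> {S..<J}"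
abbreviation home_seeds :: "seeds pmf" where "home_seeds \<equiv> seed_pmf (block home_labels)"
abbreviation request_seeds :: "seeds pmf" where "request_seeds \<equiv> seed_pmf (block request_labels)"

text \<open>Home tokens have indices below \<open>S\<close>. Fixing their seeds fixes all homes and
  \<open>peak\<close>, while the seeds of the requests stay independent.\<close>

definition merge :: "seeds \<Rightarrow> seeds \<Rightarrow> seeds" where
  "merge f g = (\<lambda>(x, l, s). if snd l < S then f (x, l, s) else g (x, l, s))"

lemma merge_simps:
  "snd l < S \<Longrightarrow> merge f g (x, l, s) = f (x, l, s)"
  "S \<le> snd l \<Longrightarrow> merge f g (x, l, s) = g (x, l, s)"
  by (simp_all add: merge_def)

lemma fin_labels: "finite home_labels" "finite request_labels" "finite (U \<times> {..<J})"
  using fin_U by auto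

lemma all_seeds_split: "all_seeds = home_seeds \<bind> (\<lambda>f. map_pmf (merge f) request_seeds)"
proof -
  have un: "block (U \<times> {..<J}) = block home_labels \<union> block request_labels"
    "block home_labels \<inter> block request_labels = {}"
    using S_le_J by (auto simp: block_def)
  have "all_seeds = map_pmf (\<lambda>(f, g) i. if i \<in> block home_labels then f i else g i)
      (pair_pmf home_seeds request_seeds)"
    unfolding all_seeds_def seed_pmf_def un(1)
    by (rule Pi_pmf_union) (use un(2) fin_labels finite_block in auto)
  also have "\<dots> = map_pmf (\<lambda>(f, g). merge f g) (pair_pmf home_seeds request_seeds)"
  proof (intro map_pmf_cong refl)
    fix fg assume fg: "fg \<in> set_pmf (pair_pmf home_seeds request_seeds)"
    obtain f g where fg_eq: "fg = (f, g)" by (cases fg)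
    have f0: "f i = 0" if "i \<notin> block home_labels" for i
      by (rule seed_outside[OF finite_block[OF fin_labels(1)] _ that]) (use fg in \<open>simp add: fg_eq\<close>)
    have g0: "g i = 0" if "i \<notin> block request_labels" for i
      by (rule seed_outside[OF finite_block[OF fin_labels(2)] _ that]) (use fg in \<open>simp add: fg_eq\<close>)
    have "(if (x, l, s) \<in> block home_labels then f (x, l, s) else g (x, l, s)) = merge f g (x, l, s)" for x l s
    proof (cases "snd l < S")
      case True
      then have "(x, l, s) \<notin> block request_labels" by (auto simp: block_def)
      then show ?thesis using True f0 g0 by (auto simp: merge_simps)
    next
      case False
      then have "(x, l, s) \<notin> block home_labels" by (auto simp: block_def)
      then show ?thesis using False by (auto simp: merge_simps)
    qed
    then show "(\<lambda>(f, g) i. if i \<in> block home_labels then f i else g i) fg = (\<lambda>(f, g). merge f g) fg"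
      unfolding fg_eq by (auto simp: fun_eq_iff)
  qed
  also have "\<dots> = home_seeds \<bind> (\<lambda>f. map_pmf (merge f) request_seeds)"
    by (simp add: pair_pmf_def map_pmf_def bind_assoc_pmf bind_return_pmf)
  finally show ?thesis .
qed

lemma path_merge:
  "snd l < S \<Longrightarrow> path (merge f g) l m = path f l m"
  "S \<le> snd l \<Longrightarrow> path (merge f g) l m = path g l m"
  by (rule path_cong, simp add: merge_simps)+

lemma dest_merge:
  "snd l < S \<Longrightarrow> dest (merge f g) l = dest f l"
  "S \<le> snd l \<Longrightarrow> dest (merge f g) l = dest g l"
  by (simp_all add: dest_def path_merge)

lemma home_merge: "home G (merge f g) v = home G f v"
proof -
  have "(j < S \<and> (\<forall>i<S. dg G (dest (merge f g) (v, i)) \<le> dg G (dest (merge f g) (v, j)))) =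
      (j < S \<and> (\<forall>i<S. dg G (dest f (v, i)) \<le> dg G (dest f (v, j))))" for j
    by (auto simp: dest_merge)
  then have "home_index G (merge f g) v = home_index G f v" by (simp add: home_index_def)
  then show ?thesis
    using home_index(1)[of G f v] by (simp add: home_def dest_merge)
qed

lemma residents_merge: "residents G (merge f g) = residents G f"
  by (simp add: residents_def home_merge fun_eq_iff)

lemma peak_merge: "peak G (merge f g) = peak G f"
  by (simp add: peak_def density_def residents_merge)

section \<open>The law of the answer to a single request\<close>

lemma dest_in_V:
  assumes "finite L" "\<omega> \<in> set_pmf (seed_pmf (block L))" "l \<in> L" "fst l \<in> V"
  shows "dest \<omega> l \<in> V"
proof -
  have "dest \<omega> l \<in> set_pmf (map_pmf (\<lambda>\<omega>. path \<omega> l T) (seed_pmf (block L)))"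
    using assms(2) by (simp add: dest_def)
  then show ?thesis
    using path_law[OF assms(1,3,4) T_le] set_lazy_walk[OF assms(4), of T] by auto
qed

lemma home_in_V:
  assumes "f \<in> set_pmf home_seeds" "v \<in> V"
  shows "home G f v \<in> V"
  unfolding home_def
  by (rule dest_in_V[OF fin_labels(1) assms(1)]) (use assms(2) V_U home_index(1)[of G f v] in auto)

lemma finite_residents: "finite (residents G f w)"
  by (simp add: residents_def finite_V)

lemma density_le_peak: "w \<in> V \<Longrightarrow> density G f w \<le> peak G f"
  unfolding peak_def using finite_V by (intro Max_ge) auto

lemma residents_le_peak:
  assumes "w \<in> V"
  shows "card V * card (residents G f w) \<le> dg G w * peak G f"
proof -
  have "card V * card (residents G f w) < dg G w * density G f w"
    using dividend_less_times_div[OF dg_pos[OF assms], of "card V * card (residents G f w)"]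
    by (simp add: density_def)
  also have "\<dots> \<le> dg G w * peak G f" using density_le_peak[OF assms] by simp
  finally show ?thesis by simp
qed

lemma peak_pos: "0 < peak G f"
proof -
  obtain w where "w \<in> V" using two by fastforce
  then show ?thesis using density_le_peak[of w f] by (simp add: density_def)
qed

lemma peak_le: "peak G f \<le> card V ^ 2 + 1"
proof -
  have "density G f w \<le> card V ^ 2 + 1" for w
  proof -
    have "card (residents G f w) \<le> card V"
      unfolding residents_def by (intro card_mono) (auto simp: finite_V)
    then have "card V * card (residents G f w) div dg G w \<le> card V * card V"
      by (meson div_le_dividend le_trans mult_le_mono2)
    then show ?thesis by (simp add: density_def power2_eq_square)
  qed
  moreover have "V \<noteq> {}" using two by auto
  ultimately show ?thesis unfolding peak_def using finite_V by (intro Max.boundedI) auto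
qed

lemma coin_index:
  assumes "w \<in> V"
  shows "0 < dg G w * peak G f" "dg G w * peak G f < X"
proof -
  show "0 < dg G w * peak G f" using dg_pos[OF assms] peak_pos by simp
  have "dg G w * peak G f \<le> card V * (card V ^ 2 + 1)"
    using dg_less[OF assms] peak_le by (intro mult_le_mono) auto
  then show "dg G w * peak G f < X" using X_large by simp
qed

definition respond :: "seeds \<Rightarrow> nat \<Rightarrow> nat \<Rightarrow> nat option" where
  "respond f w c = (if c < card V * card (residents G f w)
     then Some (enum (residents G f w) ! (c div card V)) else None)"

definition answer_law :: "seeds \<Rightarrow> nat \<Rightarrow> nat option pmf" where
  "answer_law f u = lazy_walk G u T \<bind>
     (\<lambda>w. map_pmf (respond f w) (pmf_of_set {..<dg G w * peak G f}))"

lemma answer_merge: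
  assumes "S \<le> snd l"
  shows "answer G (merge f g) l = respond f (dest g l) (g (dest g l, l, Tm + dg G (dest g l) * peak G f))"
  using assms by (simp add: answer_def respond_def Let_def dest_merge merge_simps residents_merge peak_merge)

lemma token_local_answer:
  assumes "S \<le> snd l"
  shows "token_local l (\<lambda>g. answer G (merge f g) l)"
  unfolding token_local_def
proof (intro allI impI)
  fix g h :: seeds assume eq: "\<forall>x s. g (x, l, s) = h (x, l, s)"
  then have "dest g l = dest h l" unfolding dest_def by (intro path_cong) auto
  with eq show "answer G (merge f g) l = answer G (merge f h) l"
    by (simp add: answer_merge[OF assms])
qed

text \<open>With \<open>f\<close> fixed, the position of the coin is a function of the node reached,
  so \<open>joint_law\<close> applies.\<close>

lemma map_answer:
  assumes l: "l \<in> request_labels" and u: "fst l \<in> V"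
  shows "map_pmf (\<lambda>g. answer G (merge f g) l) request_seeds = answer_law f (fst l)"
proof -
  have S: "S \<le> snd l" using l by auto
  let ?\<sigma> = "\<lambda>w. Tm + dg G w * peak G f"
  have "map_pmf (\<lambda>g. answer G (merge f g) l) request_seeds =
      map_pmf (\<lambda>(w, c). respond f w c)
        (map_pmf (\<lambda>g. (path g l T, g (path g l T, l, ?\<sigma> (path g l T)))) request_seeds)"
    by (simp add: pmf.map_comp o_def answer_merge[OF S] dest_def)
  also have "map_pmf (\<lambda>g. (path g l T, g (path g l T, l, ?\<sigma> (path g l T)))) request_seeds =
      lazy_walk G (fst l) T \<bind> (\<lambda>w. map_pmf (Pair w) (step_law w (?\<sigma> w)))"
    by (rule joint_law[OF fin_labels(2) l u]) (use T_le coin_index in auto)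
  finally show ?thesis
    by (simp add: map_bind_pmf pmf.map_comp o_def step_law_def answer_law_def)
qed

text \<open>Resident number \<open>i\<close> owns the coin values from \<open>card V * i\<close> to
  below \<open>card V * (i + 1)\<close>, all of which lie in range by
  \<open>residents_le_peak\<close>.\<close>

lemma prob_respond:
  assumes w: "w \<in> V" and v: "v \<in> V"
  shows "pmf (map_pmf (respond f w) (pmf_of_set {..<dg G w * peak G f})) (Some v) =
    (if home G f v = w then real (card V) / (real (dg G w) * real (peak G f)) else 0)"
proof -
  let ?R = "residents G f w" and ?N = "card V" and ?q = "dg G w * peak G f"
  have q: "0 < ?q" using coin_index[OF w] by simp
  have N: "0 < ?N" using two by simp
  have len: "length (enum ?R) = card ?R" by (simp add: length_enum finite_residents)
  have "pmf (map_pmf (respond f w) (pmf_of_set {..<?q})) (Some v) =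
      measure_pmf.prob (pmf_of_set {..<?q}) (respond f w -` {Some v})"
    by (simp add: pmf_map)
  also have "\<dots> = real (card ({..<?q} \<inter> respond f w -` {Some v})) / real ?q"
    using q by (subst measure_pmf_of_set) (auto simp: lessThan_empty_iff)
  also have "card ({..<?q} \<inter> respond f w -` {Some v}) = (if home G f v = w then ?N else 0)"
  proof (cases "home G f v = w")
    case True
    then have "v \<in> set (enum ?R)" using v by (simp add: set_enum finite_residents) (simp add: residents_def)
    then obtain i where i: "i < card ?R" "enum ?R ! i = v" by (auto simp: in_set_conv_nth len)
    have bound: "?N * i + ?N \<le> ?q"
    proof -
      have "?N * i + ?N = ?N * Suc i" by simp
      also have "\<dots> \<le> ?N * card ?R" using i(1) by (intro mult_le_mono2) simp
      also have "\<dots> \<le> ?q" by (rule residents_le_peak[OF w])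
      finally show ?thesis .
    qed
    have iff: "c < ?N * card ?R \<and> enum ?R ! (c div ?N) = v \<longleftrightarrow> c div ?N = i" for c
    proof
      assume c: "c < ?N * card ?R \<and> enum ?R ! (c div ?N) = v"
      then have "c div ?N < card ?R" by (simp add: less_mult_imp_div_less mult.commute)
      then show "c div ?N = i"
        using c i distinct_enum[OF finite_residents] by (metis len nth_eq_iff_index_eq)
    next
      assume c: "c div ?N = i"
      then have "c div ?N < card ?R" using i by simp
      then have "c < ?N * card ?R" using N by (simp add: div_less_iff_less_mult mult.commute)
      then show "c < ?N * card ?R \<and> enum ?R ! (c div ?N) = v" using c i by simp
    qed
    have "{..<?q} \<inter> respond f w -` {Some v} = {?N * i..<?N * i + ?N}"
    proof (intro set_eqI iffI)
      fix c assume "c \<in> {..<?q} \<inter> respond f w -` {Some v}"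
      then have "c div ?N = i" using iff[of c] by (auto simp: respond_def split: if_splits)
      then have "c = ?N * i + c mod ?N" by (metis mult_div_mod_eq)
      moreover have "c mod ?N < ?N" using N by simp
      ultimately show "c \<in> {?N * i..<?N * i + ?N}" unfolding atLeastLessThan_iff by linarith
    next
      fix c assume c: "c \<in> {?N * i..<?N * i + ?N}"
      then have "c div ?N = i"
        by (intro div_nat_eqI) (auto simp: mult.commute)
      then show "c \<in> {..<?q} \<inter> respond f w -` {Some v}"
        using iff[of c] c bound by (auto simp: respond_def)
    qed
    then show ?thesis using True by simp
  next
    case False
    have "respond f w c \<noteq> Some v" for c
    proof
      assume "respond f w c = Some v"
      then have c: "c < ?N * card ?R" "enum ?R ! (c div ?N) = v" by (auto simp: respond_def split: if_splits)
      then have "c div ?N < length (enum ?R)" by (simp add: len less_mult_imp_div_less mult.commute)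
      then have "v \<in> set (enum ?R)" using c(2) nth_mem by blast
      then show False using False by (simp add: set_enum finite_residents) (simp add: residents_def)
    qed
    then have "{..<?q} \<inter> respond f w -` {Some v} = {}" by auto
    then show ?thesis using False by simp
  qed
  finally show ?thesis by simp
qed

lemma pmf_answer_law:
  assumes f: "f \<in> set_pmf home_seeds" and u: "u \<in> V" and v: "v \<in> V"
  shows "pmf (answer_law f u) (Some v) =
    pmf (lazy_walk G u T) (home G f v) * (n / (real (dg G (home G f v)) * real (peak G f)))"
proof -
  have "pmf (answer_law f u) (Some v) = (\<Sum>w\<in>V. pmf (lazy_walk G u T) w *
      pmf (map_pmf (respond f w) (pmf_of_set {..<dg G w * peak G f})) (Some v))"
    unfolding answer_law_def by (rule pmf_bind_V[OF set_lazy_walk[OF u]])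
  also have "\<dots> = (\<Sum>w\<in>V. if home G f v = w then pmf (lazy_walk G u T) w *
      (n / (real (dg G w) * real (peak G f))) else 0)"
    by (intro sum.cong) (auto simp: prob_respond v n_def)
  finally show ?thesis using home_in_V[OF f v] finite_V by simp
qed

text \<open>The probability of any fixed answer for an exactly stationary walk: the degree of the
  home cancels between \<open>stat\<close> and the acceptance probability.\<close>

definition hit_rate :: "seeds \<Rightarrow> real" where
  "hit_rate f = n / (vol * real (peak G f))"

lemma hit_rate_nonneg: "0 \<le> hit_rate f"
  using n_ge_2 vol_pos by (simp add: hit_rate_def)

lemma answer_law_bounds:
  assumes mix: "mixed k T" and f: "f \<in> set_pmf home_seeds" and u: "u \<in> V" and v: "v \<in> V"
  shows "(1 - 1 / n ^ k) * hit_rate f \<le> pmf (answer_law f u) (Some v)"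
    and "pmf (answer_law f u) (Some v) \<le> (1 + 1 / n ^ k) * hit_rate f"
proof -
  define w where "w = home G f v"
  have w: "w \<in> V" using home_in_V[OF f v] by (simp add: w_def)
  have d: "0 < real (dg G w)" using dg_pos[OF w] by simp
  have "\<bar>pmf (lazy_walk G u T) w - stat w\<bar> \<le> stat w / n ^ k"
    using mix u w by (simp add: mixed_def excess_def)
  then have b: "(1 - 1 / n ^ k) * stat w \<le> pmf (lazy_walk G u T) w"
    "pmf (lazy_walk G u T) w \<le> (1 + 1 / n ^ k) * stat w"
    by (auto simp: algebra_simps abs_le_iff)
  let ?c = "n / (real (dg G w) * real (peak G f))"
  have c: "0 \<le> ?c" using n_ge_2 by simp
  have eq: "stat w * ?c = hit_rate f"
    using d vol_pos peak_pos[of f] by (simp add: stat_def hit_rate_def field_simps)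
  show "(1 - 1 / n ^ k) * hit_rate f \<le> pmf (answer_law f u) (Some v)"
    "pmf (answer_law f u) (Some v) \<le> (1 + 1 / n ^ k) * hit_rate f"
    using mult_right_mono[OF b(1) c] mult_right_mono[OF b(2) c]
    by (simp_all add: pmf_answer_law[OF f u v] w_def[symmetric] eq[symmetric] mult.assoc)
qed

lemma set_answer_law:
  assumes u: "u \<in> V"
  shows "set_pmf (answer_law f u) \<subseteq> insert None (Some ` V)"
proof
  fix h assume "h \<in> set_pmf (answer_law f u)"
  then obtain w c where h: "h = respond f w c" by (auto simp: answer_law_def)
  show "h \<in> insert None (Some ` V)"
  proof (cases "c < card V * card (residents G f w)")
    case True
    then have "c div card V < length (enum (residents G f w))"
      by (simp add: length_enum finite_residents less_mult_imp_div_less mult.commute)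
    then have "enum (residents G f w) ! (c div card V) \<in> residents G f w"
      using nth_mem[of "c div card V" "enum (residents G f w)"] by (simp add: set_enum finite_residents)
    then show ?thesis using True by (auto simp: h respond_def residents_def)
  qed (simp add: h respond_def)
qed

section \<open>The joint law of all contacts\<close>

definition outcome :: "seeds \<Rightarrow> nat \<Rightarrow> nat option" where
  "outcome \<omega> u = (if u \<in> V then last_hit S J (\<lambda>j. answer G \<omega> (u, j)) else None)"

lemma outcome_target:
  assumes "u \<in> V" "hits G \<omega> u \<noteq> {}"
  shows "outcome \<omega> u = Some (target G \<omega> u)"
proof -
  have "Max (hits G \<omega> u) \<in> hits G \<omega> u"
    by (rule Max_in) (use assms(2) in \<open>auto simp: hits_def\<close>)
  then show ?thesis
    using assms by (auto simp: outcome_def last_hit_def Let_def target_def chosen_def hits_def[symmetric])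
      (auto simp: hits_def)
qed

text \<open>The request seeds are grouped twice: by node, which makes nodes independent, and within
  a node by request, which makes its answers independent.\<close>

lemma map_outcome:
  "map_pmf (\<lambda>g. outcome (merge f g)) request_seeds =
    Pi_pmf V None (\<lambda>u. map_pmf (last_hit S J) (Pi_pmf {S..<J} None (\<lambda>_. answer_law f u)))"
proof -
  let ?F = "\<lambda>u g. last_hit S J (\<lambda>j. answer G (merge f g) (u, j))"
  have "map_pmf (\<lambda>g u. if u \<in> V then ?F u g else None) request_seeds =
      Pi_pmf V None (\<lambda>u. map_pmf (?F u) request_seeds)"
    unfolding seed_pmf_def
  proof (rule Pi_pmf_blocks'[OF finite_V finite_block[OF fin_labels(2)],
        where B = "\<lambda>u. UNIV \<times> ({u} \<times> UNIV) \<times> UNIV"])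
    show "?F u g = ?F u h" if "\<And>i. i \<in> UNIV \<times> ({u} \<times> UNIV) \<times> UNIV \<Longrightarrow> g i = h i" for u g h
    proof (rule last_hit_cong)
      fix j assume "S \<le> j"
      then show "answer G (merge f g) (u, j) = answer G (merge f h) (u, j)"
        using token_local_answer[of "(u, j)" f] that by (auto simp: token_local_def)
    qed
  qed (auto simp: disjoint_family_on_def)
  also have "(\<lambda>g u. if u \<in> V then ?F u g else None) = (\<lambda>g. outcome (merge f g))"
    by (simp add: outcome_def fun_eq_iff)
  also have "Pi_pmf V None (\<lambda>u. map_pmf (?F u) request_seeds) =
      Pi_pmf V None (\<lambda>u. map_pmf (last_hit S J) (Pi_pmf {S..<J} None (\<lambda>_. answer_law f u)))"
  proof (intro Pi_pmf_cong refl)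
    fix u assume u: "u \<in> V"
    let ?H = "\<lambda>g j. if j \<in> {S..<J} then answer G (merge f g) (u, j) else None"
    have "map_pmf ?H request_seeds = Pi_pmf {S..<J} None (\<lambda>j. map_pmf (\<lambda>g. answer G (merge f g) (u, j)) request_seeds)"
      unfolding seed_pmf_def
    proof (rule Pi_pmf_blocks'[OF _ finite_block[OF fin_labels(2)], where B = "\<lambda>j. UNIV \<times> {(u, j)} \<times> UNIV"])
      show "answer G (merge f g) (u, j) = answer G (merge f h) (u, j)"
        if "j \<in> {S..<J}" "\<And>i. i \<in> UNIV \<times> {(u, j)} \<times> UNIV \<Longrightarrow> g i = h i" for j g h
        using token_local_answer[of "(u, j)" f] that by (auto simp: token_local_def)
    qed (auto simp: disjoint_family_on_def)
    also have "\<dots> = Pi_pmf {S..<J} None (\<lambda>_. answer_law f u)"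
      by (intro Pi_pmf_cong refl, subst map_answer) (use u V_U in auto)
    finally have H: "map_pmf ?H request_seeds = Pi_pmf {S..<J} None (\<lambda>_. answer_law f u)" .
    have "map_pmf (?F u) request_seeds = map_pmf (last_hit S J) (map_pmf ?H request_seeds)"
      unfolding pmf.map_comp o_def by (intro map_pmf_cong refl last_hit_cong) auto
    then show "map_pmf (?F u) request_seeds =
        map_pmf (last_hit S J) (Pi_pmf {S..<J} None (\<lambda>_. answer_law f u))" by (simp only: H)
  qed
  finally show ?thesis .
qed

text \<open>A point mass at the computed targets once every node has a hit. The uniform substitutes
  are drawn in the coupling only, not by the network.\<close>

definition contact_law :: "seeds \<Rightarrow> (nat \<Rightarrow> nat) pmf" where
  "contact_law \<omega> = Pi_pmf V 0 (\<lambda>u. fallback V (outcome \<omega> u))"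

lemma contact_law_mixture:
  "all_seeds \<bind> contact_law =
    home_seeds \<bind> (\<lambda>f. Pi_pmf V 0 (\<lambda>u. sample_law V (answer_law f u) S J))"
proof -
  have "map_pmf (merge f) request_seeds \<bind> contact_law = Pi_pmf V 0 (\<lambda>u. sample_law V (answer_law f u) S J)" for f
  proof -
    have "map_pmf (merge f) request_seeds \<bind> contact_law =
        map_pmf (\<lambda>g. outcome (merge f g)) request_seeds \<bind> (\<lambda>h. Pi_pmf V 0 (\<lambda>u. fallback V (h u)))"
      by (simp add: bind_map_pmf contact_law_def[abs_def])
    also have "\<dots> = Pi_pmf V 0 (\<lambda>u. sample_law V (answer_law f u) S J)"
      unfolding map_outcome sample_law_def by (rule Pi_pmf_bind[OF finite_V, symmetric])
    finally show ?thesis .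
  qed
  then show ?thesis by (simp add: all_seeds_split bind_assoc_pmf)
qed

text \<open>The two extra powers of \<open>n\<close> pay for the factor 4 of
  \<open>sample_law_bounds\<close>, as \<open>n ^ 2\<close> is at least 4.\<close>

lemma sample_bounds:
  assumes mix: "mixed (a + 2) T" and f: "f \<in> set_pmf home_seeds" and u: "u \<in> V"
  shows "set_pmf (sample_law V (answer_law f u) S J) \<subseteq> V"
    and "v \<in> V \<Longrightarrow> (1 - 1 / n ^ a) / real (card V) \<le> pmf (sample_law V (answer_law f u) S J) v"
    and "v \<in> V \<Longrightarrow> pmf (sample_law V (answer_law f u) S J) v \<le> (1 + 1 / n ^ a) / real (card V)"
proof -
  have n1: "1 \<le> n ^ a" using n_ge_2 by (intro one_le_power) simp
  have n4: "4 \<le> n\<^sup>2" using power_mono[of 2 n 2] n_ge_2 by simp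
  have d: "0 \<le> 1 / n ^ (a + 2)" "1 / n ^ (a + 2) \<le> 1 / 4" "4 * (1 / n ^ (a + 2)) \<le> 1 / n ^ a"
  proof -
    show "0 \<le> 1 / n ^ (a + 2)" using n_ge_2 by simp
    have "4 \<le> n ^ a * n\<^sup>2" using mult_mono[OF n1 n4] n1 by simp
    then have "4 \<le> n ^ (a + 2)" by (simp only: power_add)
    then show "1 / n ^ (a + 2) \<le> 1 / 4" using frac_le[of 1 1 4 "n ^ (a + 2)"] by simp
    show "4 * (1 / n ^ (a + 2)) \<le> 1 / n ^ a"
      using n1 n4 n_ge_2 by (simp add: power_add divide_simps power2_eq_square)
  qed
  have ne: "V \<noteq> {}" using u by auto
  note ab = answer_law_bounds[OF mix f u]
  note b = sample_law_bounds[OF finite_V ne S_le_J set_answer_law[OF u] _ _ d(1,2) hit_rate_nonneg]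
  show "set_pmf (sample_law V (answer_law f u) S J) \<subseteq> V" by (rule b(1)[OF ab])
  show "(1 - 1 / n ^ a) / real (card V) \<le> pmf (sample_law V (answer_law f u) S J) v" if "v \<in> V"
    using d(3) by (intro order.trans[OF divide_right_mono b(2)[OF ab that]]) auto
  show "pmf (sample_law V (answer_law f u) S J) v \<le> (1 + 1 / n ^ a) / real (card V)" if "v \<in> V"
    using d(3) by (intro order.trans[OF b(3)[OF ab that] divide_right_mono]) auto
qed

theorem contacts_gossip:
  assumes mix: "mixed (a + 2) T" and lam: "1 / n ^ a \<le> lam"
  shows "gossip_sampler lam V (all_seeds \<bind> contact_law)"
  unfolding contact_law_mixture
proof (rule mixture_gossip_sampler[OF finite_V])
  fix f u v assume f: "f \<in> set_pmf home_seeds" and u: "u \<in> V" and v: "v \<in> V"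
  note b = sample_bounds[OF mix f u]
  show "(1 - lam) / real (card V) \<le> pmf (sample_law V (answer_law f u) S J) v"
    using lam by (intro order.trans[OF divide_right_mono b(2)[OF v]]) auto
  show "pmf (sample_law V (answer_law f u) S J) v \<le> (1 + lam) / real (card V)"
    using lam by (intro order.trans[OF b(3)[OF v] divide_right_mono]) auto
qed (rule sample_bounds(1)[OF mix])

end

section \<open>Failure probability\<close>

lemma pmf_le_pmf_bind_fallback: "pmf p (Some v) \<le> pmf (p \<bind> fallback V) v"
proof -
  have "pmf p (Some v) = measure_pmf.expectation p (indicat_real {Some v})"
    by (simp add: pmf.rep_eq)
  also have "\<dots> \<le> measure_pmf.expectation p (\<lambda>h. pmf (fallback V h) v)"
    by (rule integral_mono_AE)
      (auto simp: fallback_def indicator_def pmf_le_1 intro!: integrable_pmf_bounded[where b = 1] AE_I2)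
  also have "\<dots> = pmf (p \<bind> fallback V) v" by (simp add: pmf_bind)
  finally show ?thesis .
qed

lemma prob_UN_le:
  assumes "finite A" "\<And>a. a \<in> A \<Longrightarrow> measure_pmf.prob p (E a) \<le> b"
  shows "measure_pmf.prob p (\<Union>a\<in>A. E a) \<le> real (card A) * b"
proof -
  have "measure_pmf.prob p (\<Union>a\<in>A. E a) \<le> (\<Sum>a\<in>A. measure_pmf.prob p (E a))"
    using assms(1) by (intro measure_pmf.finite_measure_subadditive_finite) auto
  also have "\<dots> \<le> (\<Sum>a\<in>A. b)" by (intro sum_mono assms(2))
  finally show ?thesis by simp
qed

context seeded_network
begin

text \<open>\<open>vol / n\<close> is the average degree. The mean number of home tokens ending at
  \<open>w\<close> is at most twice \<open>S * n * dg G w / vol\<close>, and the Chernoff bound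
  doubles it again. Both conditions depend on home tokens alone, hence are settled before the
  requests are drawn.\<close>

definition homes_ok :: "nat \<Rightarrow> seeds \<Rightarrow> bool" where
  "homes_ok h \<omega> \<longleftrightarrow>
     (\<forall>w\<in>V. real (card {l\<in>V \<times> {..<S}. dest \<omega> l = w}) \<le> 4 * real S * n * real (dg G w) / vol + real h) \<and>
     (\<forall>v\<in>V. \<exists>j<S. vol \<le> 2 * n * real (dg G (dest \<omega> (v, j))))"

definition calm :: "nat \<Rightarrow> nat \<Rightarrow> seeds \<Rightarrow> bool" where
  "calm q q' \<omega> \<longleftrightarrow>
     (\<forall>s<T. \<forall>(x, y)\<in>parcs G. card {l\<in>tokens G. path \<omega> l s = x \<and> path \<omega> l (Suc s) = y} \<le> q) \<and>
     (\<forall>u\<in>V. hits G \<omega> u \<noteq> {}) \<and>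
     (\<forall>v\<in>V. card {u\<in>V. outcome \<omega> u = Some v} \<le> q')"

lemma flood_le:
  assumes "x \<in> V"
  shows "flood G \<omega> s x \<le> peak G \<omega>"
  using assms
proof (induction s arbitrary: x)
  case (Suc s)
  then have "\<forall>z\<in>insert x (nb x). flood G \<omega> s z \<le> peak G \<omega>" using nb_subset by blast
  then show ?case by simp
qed (simp add: density_le_peak)

context
  fixes k :: nat
  assumes mix: "mixed (k + 2) T"
begin

lemma dev_le_half: "1 / n ^ (k + 2) \<le> 1 / 2"
proof -
  have "n \<le> n ^ (k + 2)" using n_ge_2 self_le_power[of n "k + 2"] by simp
  then show ?thesis using n_ge_2 frac_le[of 1 1 2 "n ^ (k + 2)"] by linarith
qed

lemma walk_bounds:
  assumes "u \<in> V" "w \<in> V"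
  shows "pmf (lazy_walk G u T) w \<le> 3 / 2 * stat w" "0 < pmf (lazy_walk G u T) w"
proof -
  have "\<bar>pmf (lazy_walk G u T) w - stat w\<bar> \<le> stat w * (1 / n ^ (k + 2))"
    using mix assms by (simp add: mixed_def excess_def)
  also have "\<dots> \<le> stat w * (1 / 2)"
    using dev_le_half stat_pos[OF assms(2)] by (intro mult_left_mono) auto
  finally show "pmf (lazy_walk G u T) w \<le> 3 / 2 * stat w" "0 < pmf (lazy_walk G u T) w"
    using stat_pos[OF assms(2)] by linarith+
qed

text \<open>Mixing makes every node reachable with positive probability in exactly \<open>T\<close>
  lazy steps. So all distances are at most \<open>T\<close>, and the maximum travels back along the
  support of the walk.\<close>

lemma flood_peak:
  assumes x: "x \<in> V"
  shows "flood G \<omega> T x = peak G \<omega>"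
proof (rule antisym)
  show "flood G \<omega> T x \<le> peak G \<omega>" by (rule flood_le[OF x])
  have up: "density G \<omega> y \<le> flood G \<omega> s z" if "z \<in> V" "y \<in> set_pmf (lazy_walk G z s)" for s y z
    using that
  proof (induction s arbitrary: z)
    case (Suc s)
    have "lazy_walk G z (Suc s) = lazy_step G z \<bind> (\<lambda>z'. lazy_walk G z' s)"
      using lazy_walk_add[of z 1 s] by (simp add: bind_return_pmf)
    then obtain z' where z': "z' \<in> insert z (nb z)" "y \<in> set_pmf (lazy_walk G z' s)"
      using Suc.prems set_lazy_step by auto
    then have "density G \<omega> y \<le> flood G \<omega> s z'"
      using Suc.prems(1) nb_subset by (intro Suc.IH) auto
    also have "\<dots> \<le> flood G \<omega> (Suc s) z"
      unfolding flood.simps using z'(1) by (intro Max_ge) auto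
    finally show ?case .
  qed simp
  have "density G \<omega> y \<le> flood G \<omega> T x" if "y \<in> V" for y
    using up[OF x, of y T] walk_bounds(2)[OF x that] by (simp add: set_pmf_iff)
  then show "peak G \<omega> \<le> flood G \<omega> T x"
    unfolding peak_def using x finite_V by (intro Max.boundedI) auto
qed

lemma calm_sound:
  assumes "\<omega> \<in> set_pmf all_seeds" "calm q q' \<omega>"
  shows "sound G \<omega>"
  unfolding sound_def
proof (intro conjI ballI allI impI)
  show "connected_network G" by (rule connected_network_axioms)
  show "flood G \<omega> T x = peak G \<omega>" if "x \<in> V" for x by (rule flood_peak[OF that])
  show "hits G \<omega> u \<noteq> {}" if "u \<in> V" for u using assms(2) that by (simp add: calm_def)
  fix x l s assume x: "x \<in> V" and l: "l \<in> tokens G" and s: "s < T"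
  have "(x, l, s) \<in> block (U \<times> {..<J})"
    using x l s T_le tokens_subset by (auto simp: block_def)
  then have "\<omega> (x, l, s) \<in> set_pmf (step_law x s)"
    using assms(1) finite_block[OF fin_labels(3)]
    by (cases l) (simp add: all_seeds_def seed_pmf_def set_Pi_pmf PiE_dflt_def)
  then show "\<omega> (x, l, s) \<in> insert x (nb x)"
    using s T_le set_lazy_step[OF x] by (simp add: step_law_def)
qed

lemma calm_callers:
  assumes "calm q q' \<omega>" "v \<in> V"
  shows "card (callers G \<omega> v) \<le> q'"
proof -
  have "callers G \<omega> v = {u\<in>V. outcome \<omega> u = Some v}"
    using assms(1) outcome_target by (auto simp: callers_def calm_def)
  then show ?thesis using assms by (simp add: calm_def)
qed

lemma prob_dest:
  assumes "l \<in> tokens G"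
  shows "measure_pmf.prob all_seeds {\<omega>. dest \<omega> l = w} = pmf (lazy_walk G (fst l) T) w"
  unfolding all_seeds_def dest_def
  by (rule prob_path[OF fin_labels(3)]) (use assms tokens_subset T_le in \<open>auto simp: tokens_def\<close>)

lemma crowded_prob:
  assumes w: "w \<in> V"
  shows "measure_pmf.prob all_seeds {\<omega>. 4 * real S * n * real (dg G w) / vol + real h <
      real (card {l\<in>V \<times> {..<S}. dest \<omega> l = w})} \<le> 2 powr (- real h)"
proof -
  define z where "z = 4 * real S * n * real (dg G w) / vol + real h"
  \<comment> \<open>The count is an integer, so exceeding \<open>z\<close> means reaching the next
    integer.\<close>
  define q where "q = nat \<lfloor>z\<rfloor> + 1"
  have z0: "0 \<le> z" using n_ge_2 vol_pos by (simp add: z_def)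
  have q: "q \<le> m" if "z < real m" for m
    using that z0 unfolding q_def by linarith
  have zq: "z < real q" using z0 unfolding q_def by linarith
  have sub: "V \<times> {..<S} \<subseteq> tokens G" using S_le_J by (auto simp: tokens_def)
  have "(\<Sum>l\<in>V \<times> {..<S}. measure_pmf.prob all_seeds {\<omega>. dest \<omega> l = w}) \<le>
      (\<Sum>l\<in>V \<times> {..<S}. 2 * stat w)"
  proof (intro sum_mono)
    fix l assume l: "l \<in> V \<times> {..<S}"
    then have "pmf (lazy_walk G (fst l) T) w \<le> 3 / 2 * stat w"
      by (intro walk_bounds w) auto
    then show "measure_pmf.prob all_seeds {\<omega>. dest \<omega> l = w} \<le> 2 * stat w"
      using prob_dest[of l w] l sub stat_pos[OF w] by auto
  qed
  also have "\<dots> = 2 * real S * n * real (dg G w) / vol"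
    by (simp add: card_cartesian_product n_def stat_def)
  finally have "measure_pmf.prob all_seeds {\<omega>. q \<le> card {l\<in>V \<times> {..<S}. dest \<omega> l = w}} \<le>
      2 powr (2 * (2 * real S * n * real (dg G w) / vol) - real q)"
    unfolding all_seeds_def dest_def
    by (intro count_tail token_local_path) (auto simp: finite_V fin_labels finite_block)
  also have "\<dots> \<le> 2 powr (- real h)"
    using zq by (intro powr_mono) (auto simp: z_def)
  finally have "measure_pmf.prob all_seeds {\<omega>. q \<le> card {l\<in>V \<times> {..<S}. dest \<omega> l = w}} \<le> 2 powr (- real h)" .
  moreover have "measure_pmf.prob all_seeds {\<omega>. z < real (card {l\<in>V \<times> {..<S}. dest \<omega> l = w})} \<le>
      measure_pmf.prob all_seeds {\<omega>. q \<le> card {l\<in>V \<times> {..<S}. dest \<omega> l = w}}"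
    using q by (intro measure_pmf.finite_measure_mono) auto
  ultimately show ?thesis unfolding z_def[symmetric] by linarith
qed

text \<open>Each node below half the average degree has stationary weight at most
  \<open>1 / (2 * n)\<close>, altogether at most one half; imperfect mixing costs a factor
  \<open>3 / 2\<close>.\<close>

lemma low_degree_walk:
  assumes u: "u \<in> V"
  shows "measure_pmf.prob (lazy_walk G u T) {w. 2 * n * real (dg G w) < vol} \<le> 3 / 4"
proof -
  let ?A = "{w\<in>V. 2 * n * real (dg G w) < vol}"
  have n0: "0 < n" using n_ge_2 by simp
  have "measure_pmf.prob (lazy_walk G u T) {w. 2 * n * real (dg G w) < vol} =
      measure_pmf.prob (lazy_walk G u T) ?A"
    using set_lazy_walk[OF u, of T] by (intro measure_pmf.finite_measure_eq_AE) (auto simp: AE_measure_pmf_iff)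
  also have "\<dots> = (\<Sum>w\<in>?A. pmf (lazy_walk G u T) w)"
    using finite_V by (intro measure_measure_pmf_finite) auto
  also have "\<dots> \<le> (\<Sum>w\<in>?A. 3 / 2 * (1 / (2 * n)))"
  proof (intro sum_mono)
    fix w assume w: "w \<in> ?A"
    then have "stat w \<le> 1 / (2 * n)"
      using vol_pos n0 by (simp add: stat_def field_simps)
    then show "pmf (lazy_walk G u T) w \<le> 3 / 2 * (1 / (2 * n))"
      using walk_bounds(1)[OF u, of w] w by simp
  qed
  also have "\<dots> = real (card ?A) * (3 / 2 * (1 / (2 * n)))" by simp
  also have "\<dots> \<le> n * (3 / 2 * (1 / (2 * n)))"
    unfolding n_def using finite_V by (intro mult_right_mono) (auto intro!: card_mono)
  also have "\<dots> = 3 / 4" using n0 by simp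
  finally show ?thesis .
qed

lemma low_degree_prob:
  assumes v: "v \<in> V"
  shows "measure_pmf.prob all_seeds {\<omega>. \<forall>j<S. 2 * n * real (dg G (dest \<omega> (v, j))) < vol} \<le> (3 / 4) ^ S"
proof -
  let ?A = "\<lambda>l \<omega>. 2 * n * real (dg G (path \<omega> l T)) < vol"
  have sub: "{v} \<times> {..<S} \<subseteq> U \<times> {..<J}" using V_U v S_le_J by auto
  have "measure_pmf.prob all_seeds {\<omega>. \<forall>j<S. 2 * n * real (dg G (dest \<omega> (v, j))) < vol} =
      measure_pmf.prob all_seeds {\<omega>. \<forall>l\<in>{v} \<times> {..<S}. ?A l \<omega>}"
    by (rule arg_cong[where f = "measure_pmf.prob all_seeds"]) (auto simp: dest_def)
  also have "\<dots> = (\<Prod>l\<in>{v} \<times> {..<S}. measure_pmf.prob all_seeds {\<omega>. ?A l \<omega>})"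
    unfolding all_seeds_def
    by (rule prob_all) (auto simp: fin_labels finite_block intro: token_local_path)
  also have "\<dots> \<le> (\<Prod>l\<in>{v} \<times> {..<S}. 3 / 4)"
  proof (intro prod_mono conjI)
    fix l assume l: "l \<in> {v} \<times> {..<S}"
    have "measure_pmf.prob all_seeds {\<omega>. ?A l \<omega>} =
        measure_pmf.prob (map_pmf (\<lambda>\<omega>. path \<omega> l T) all_seeds) {w. 2 * n * real (dg G w) < vol}"
      by (simp add: measure_map_pmf vimage_def)
    also have "map_pmf (\<lambda>\<omega>. path \<omega> l T) all_seeds = lazy_walk G (fst l) T"
      unfolding all_seeds_def
      by (rule path_law[OF fin_labels(3) _ _ T_le]) (use l sub v in auto)
    finally show "measure_pmf.prob all_seeds {\<omega>. ?A l \<omega>} \<le> 3 / 4"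
      using low_degree_walk[of "fst l"] l v by auto
  qed auto
  also have "\<dots> = (3 / 4) ^ S" by (simp add: card_cartesian_product)
  finally show ?thesis .
qed

lemma homes_ok_prob:
  "measure_pmf.prob all_seeds {\<omega>. \<not> homes_ok h \<omega>} \<le> n * 2 powr (- real h) + n * (3 / 4) ^ S"
proof -
  let ?A = "\<lambda>w. {\<omega>. 4 * real S * n * real (dg G w) / vol + real h < real (card {l\<in>V \<times> {..<S}. dest \<omega> l = w})}"
  let ?B = "\<lambda>v. {\<omega>. \<forall>j<S. 2 * n * real (dg G (dest \<omega> (v, j))) < vol}"
  have "{\<omega>. \<not> homes_ok h \<omega>} = (\<Union>w\<in>V. ?A w) \<union> (\<Union>v\<in>V. ?B v)"
    unfolding homes_ok_def by (auto simp: not_le)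
  then have "measure_pmf.prob all_seeds {\<omega>. \<not> homes_ok h \<omega>} \<le>
      measure_pmf.prob all_seeds (\<Union>w\<in>V. ?A w) + measure_pmf.prob all_seeds (\<Union>v\<in>V. ?B v)"
    using measure_Un_le[of "\<Union>w\<in>V. ?A w" all_seeds "\<Union>v\<in>V. ?B v"] by simp
  also have "\<dots> \<le> real (card V) * 2 powr (- real h) + real (card V) * (3 / 4) ^ S"
    by (intro add_mono prob_UN_le finite_V crowded_prob low_degree_prob)
  finally show ?thesis by (simp add: n_def)
qed

text \<open>A node with residents has at least half the average degree, since each resident
  preferred it to an endpoint of that degree. Hence the additive term \<open>h\<close> is also at
  most a multiple of \<open>n * dg G w / vol\<close>, and the degree cancels in the density.\<close>

lemma peak_bound:
  assumes ok: "homes_ok h \<omega>" and h: "0 < h"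
  shows "real (peak G \<omega>) \<le> 2 * real (4 * S + 2 * h) * n\<^sup>2 / vol"
proof -
  define L where "L = real (4 * S + 2 * h)"
  have L1: "1 \<le> L" using h by (simp add: L_def)
  have n0: "0 < n" using n_ge_2 by simp
  \<comment> \<open>Lets the summand 1 in \<open>density\<close> be absorbed by doubling.\<close>
  have ratio: "1 \<le> L * n\<^sup>2 / vol"
    using mult_mono[OF L1 vol_le] vol_pos L1 by (simp add: le_divide_eq)
  have "real (density G \<omega> w) \<le> 2 * L * n\<^sup>2 / vol" if w: "w \<in> V" for w
  proof (cases "residents G \<omega> w = {}")
    case True
    then have "density G \<omega> w = 1" by (simp add: density_def)
    then show ?thesis using ratio by simp
  next
    case False
    then obtain v where v: "v \<in> V" "home G \<omega> v = w" by (auto simp: residents_def)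
    obtain j where j: "j < S" "vol \<le> 2 * n * real (dg G (dest \<omega> (v, j)))"
      using ok v(1) by (auto simp: homes_ok_def)
    have "2 * n * real (dg G (dest \<omega> (v, j))) \<le> 2 * n * real (dg G w)"
      using home_index(2)[OF j(1), of G \<omega> v] v(2) n0 by (intro mult_left_mono) auto
    with j(2) have big: "vol \<le> 2 * n * real (dg G w)" by linarith
    have d: "0 < real (dg G w)" using dg_pos[OF w] by simp
    have "card (residents G \<omega> w) \<le> card {l\<in>V \<times> {..<S}. dest \<omega> l = w}"
    proof (rule card_inj_on_le)
      show "inj_on (\<lambda>v. (v, home_index G \<omega> v)) (residents G \<omega> w)" by (auto simp: inj_on_def)
      show "(\<lambda>v. (v, home_index G \<omega> v)) ` residents G \<omega> w \<subseteq> {l\<in>V \<times> {..<S}. dest \<omega> l = w}"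
        using home_index(1) by (auto simp: residents_def home_def)
    qed (simp add: finite_V)
    then have "real (card (residents G \<omega> w)) \<le> real (card {l\<in>V \<times> {..<S}. dest \<omega> l = w})"
      by (rule of_nat_mono)
    also have "\<dots> \<le> 4 * real S * n * real (dg G w) / vol + real h"
      using ok w unfolding homes_ok_def by blast
    also have "\<dots> \<le> 4 * real S * n * real (dg G w) / vol + real h * (2 * n * real (dg G w) / vol)"
      using big vol_pos h by (simp add: le_divide_eq mult_le_cancel_left1)
    also have "\<dots> = L * n * real (dg G w) / vol"
      by (simp add: L_def add_divide_distrib algebra_simps)
    finally have res: "real (card (residents G \<omega> w)) \<le> L * n * real (dg G w) / vol" .
    have "real (density G \<omega> w) \<le> n * real (card (residents G \<omega> w)) / real (dg G w) + 1"
    proof -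
      have "real (card V * card (residents G \<omega> w) div dg G w) * real (dg G w) \<le>
          real (card V * card (residents G \<omega> w))"
        unfolding of_nat_mult[symmetric] by (intro of_nat_mono) simp
      then show ?thesis using d by (simp add: density_def n_def le_divide_eq)
    qed
    also have "\<dots> \<le> n * (L * n * real (dg G w) / vol) / real (dg G w) + 1"
      using res n0 d by (intro add_right_mono divide_right_mono mult_left_mono) auto
    also have "\<dots> = L * n\<^sup>2 / vol + 1" using d by (simp add: power2_eq_square)
    also have "\<dots> \<le> 2 * L * n\<^sup>2 / vol" using ratio by simp
    finally show ?thesis .
  qed
  then show ?thesis
    using Max_in[of "density G \<omega> ` V"] finite_V two unfolding peak_def L_def by fastforce
qed

text \<open>A request is answered with probability at least \<open>n * hit_rate f / 2\<close>;
  \<open>peak_bound\<close> makes this the inverse of a multiple of \<open>S + h\<close>. The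
  requests of one node are independent once \<open>f\<close> is fixed.\<close>

lemma reject_prob:
  assumes f: "f \<in> set_pmf home_seeds" and ok: "homes_ok h f" and h: "0 < h" and u: "u \<in> V"
  shows "measure_pmf.prob request_seeds {g. hits G (merge f g) u = {}} \<le>
    (1 - 1 / (4 * real (4 * S + 2 * h))) ^ (J - S)"
proof -
  define L where "L = real (4 * S + 2 * h)"
  have L1: "1 \<le> L" using h by (simp add: L_def)
  have n0: "0 < n" using n_ge_2 by simp
  let ?A = "\<lambda>l g. answer G (merge f g) l = None"
  have "measure_pmf.prob request_seeds {g. hits G (merge f g) u = {}} =
      measure_pmf.prob request_seeds {g. \<forall>l\<in>{u} \<times> {S..<J}. ?A l g}"
    by (rule arg_cong[where f = "measure_pmf.prob request_seeds"]) (auto simp: hits_def)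
  also have "\<dots> = (\<Prod>l\<in>{u} \<times> {S..<J}. measure_pmf.prob request_seeds {g. ?A l g})"
  proof (rule prob_all)
    fix l assume "l \<in> {u} \<times> {S..<J}"
    then have "token_local l (\<lambda>g. answer G (merge f g) l)"
      by (intro token_local_answer) auto
    then show "token_local l (?A l)"
      unfolding token_local_def by (metis (no_types, lifting))
  qed (simp_all add: finite_block fin_labels)
  also have "\<dots> \<le> (\<Prod>l\<in>{u} \<times> {S..<J}. 1 - 1 / (4 * L))"
  proof (intro prod_mono conjI)
    fix l assume l: "l \<in> {u} \<times> {S..<J}"
    have "measure_pmf.prob request_seeds {g. ?A l g} =
        pmf (map_pmf (\<lambda>g. answer G (merge f g) l) request_seeds) None"
      by (simp add: pmf_map vimage_def)
    also have "map_pmf (\<lambda>g. answer G (merge f g) l) request_seeds = answer_law f u"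
      using map_answer[of l f] l u V_U by auto
    also have "pmf (answer_law f u) None = 1 - (\<Sum>v\<in>V. pmf (answer_law f u) (Some v))"
    proof -
      have "(\<Sum>r\<in>insert None (Some ` V). pmf (answer_law f u) r) = 1"
        using finite_V set_answer_law[OF u] by (intro sum_pmf_eq_1) auto
      then show ?thesis using finite_V by (simp add: sum.reindex)
    qed
    also have "\<dots> \<le> 1 - (\<Sum>v\<in>V. 1 / 2 * hit_rate f)"
    proof -
      have "1 / 2 * hit_rate f \<le> pmf (answer_law f u) (Some v)" if "v \<in> V" for v
      proof -
        have "1 / 2 * hit_rate f \<le> (1 - 1 / n ^ (k + 2)) * hit_rate f"
          using dev_le_half hit_rate_nonneg by (intro mult_right_mono) auto
        then show ?thesis using answer_law_bounds(1)[OF mix f u that] by linarith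
      qed
      then show ?thesis by (intro diff_left_mono sum_mono)
    qed
    also have "(\<Sum>v\<in>V. 1 / 2 * hit_rate f) = n\<^sup>2 / (2 * (vol * real (peak G f)))"
      by (simp add: hit_rate_def n_def power2_eq_square)
    also have "1 - n\<^sup>2 / (2 * (vol * real (peak G f))) \<le> 1 - 1 / (4 * L)"
    proof -
      have p0: "0 < real (peak G f)" using peak_pos by simp
      have "vol * real (peak G f) \<le> 2 * L * n\<^sup>2"
        using peak_bound[OF ok h] vol_pos by (simp add: L_def le_divide_eq mult.commute)
      then have "n\<^sup>2 / (2 * (2 * L * n\<^sup>2)) \<le> n\<^sup>2 / (2 * (vol * real (peak G f)))"
        using vol_pos p0 n0 L1 by (intro divide_left_mono) auto
      then show ?thesis using n0 by simp
    qed
    finally show "measure_pmf.prob request_seeds {g. ?A l g} \<le> 1 - 1 / (4 * L)" .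
  qed auto
  also have "\<dots> = (1 - 1 / (4 * L)) ^ (J - S)" by (simp add: card_cartesian_product)
  finally show ?thesis by (simp add: L_def)
qed

text \<open>The fallback only adds probability, so \<open>sample_bounds\<close> limits the chance
  that \<open>u\<close> finds \<open>v\<close> to \<open>2 / n\<close>. The mean load is thus at
  most 2.\<close>

lemma load_prob:
  assumes f: "f \<in> set_pmf home_seeds" and v: "v \<in> V"
  shows "measure_pmf.prob request_seeds {g. q < card {u\<in>V. outcome (merge f g) u = Some v}} \<le>
    2 powr (4 - real q)"
proof -
  let ?p = "\<lambda>u. map_pmf (last_hit S J) (Pi_pmf {S..<J} None (\<lambda>_. answer_law f u))"
  have n0: "0 < n" using n_ge_2 by simp
  have "(\<Sum>u\<in>V. measure_pmf.prob (?p u) {r. r = Some v}) \<le> (\<Sum>u\<in>V. 2 / n)"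
  proof (intro sum_mono)
    fix u assume u: "u \<in> V"
    have "measure_pmf.prob (?p u) {r. r = Some v} = pmf (?p u) (Some v)"
      by (simp add: pmf.rep_eq)
    also have "\<dots> \<le> pmf (sample_law V (answer_law f u) S J) v"
      unfolding sample_law_def by (rule pmf_le_pmf_bind_fallback)
    also have "\<dots> \<le> (1 + 1 / n ^ k) / real (card V)"
      by (rule sample_bounds(3)[OF mix f u v])
    also have "\<dots> \<le> 2 / n"
    proof -
      have "1 \<le> n ^ k" using n_ge_2 by (intro one_le_power) simp
      then have "1 + 1 / n ^ k \<le> 2" by (simp add: divide_le_eq_1)
      then show ?thesis unfolding n_def[symmetric] using n0 by (intro divide_right_mono) auto
    qed
    finally show "measure_pmf.prob (?p u) {r. r = Some v} \<le> 2 / n" .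
  qed
  also have "\<dots> = 2" using n0 by (simp add: n_def)
  finally have "measure_pmf.prob (Pi_pmf V None ?p) {r. Suc q \<le> card {u\<in>V. r u = Some v}} \<le>
      2 powr (2 * 2 - real (Suc q))"
    by (rule Pi_pmf_count_tail[OF finite_V])
  moreover have "measure_pmf.prob request_seeds {g. q < card {u\<in>V. outcome (merge f g) u = Some v}} =
      measure_pmf.prob (Pi_pmf V None ?p) {r. Suc q \<le> card {u\<in>V. r u = Some v}}"
    unfolding map_outcome[symmetric] by (simp add: measure_map_pmf vimage_def Suc_le_eq)
  ultimately have "measure_pmf.prob request_seeds {g. q < card {u\<in>V. outcome (merge f g) u = Some v}} \<le>
      2 powr (2 * 2 - real (Suc q))" by simp
  also have "\<dots> \<le> 2 powr (4 - real q)" by (intro powr_mono) auto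
  finally show ?thesis .
qed

lemma homes_ok_merge: "homes_ok h (merge f g) = homes_ok h f"
proof -
  have "{l\<in>V \<times> {..<S}. dest (merge f g) l = w} = {l\<in>V \<times> {..<S}. dest f l = w}" for w
    by (auto simp: dest_merge)
  moreover have "(\<exists>j<S. vol \<le> 2 * n * real (dg G (dest (merge f g) (v, j)))) =
      (\<exists>j<S. vol \<le> 2 * n * real (dg G (dest f (v, j))))" for v
    by (intro ex_cong1 conj_cong refl) (simp add: dest_merge)
  ultimately show ?thesis unfolding homes_ok_def by simp
qed

text \<open>Condition on the home seeds: if they are bad the event is empty, otherwise the bounds
  for fixed \<open>f\<close> apply.\<close>

lemma request_prob:
  assumes h: "0 < h"
  shows "measure_pmf.prob all_seeds {\<omega>. homes_ok h \<omega> \<and>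
      ((\<exists>u\<in>V. hits G \<omega> u = {}) \<or> (\<exists>v\<in>V. q' < card {u\<in>V. outcome \<omega> u = Some v}))} \<le>
    n * (1 - 1 / (4 * real (4 * S + 2 * h))) ^ (J - S) + n * 2 powr (4 - real q')"
  (is "measure_pmf.prob _ ?E \<le> ?b")
  unfolding all_seeds_split
proof (rule prob_bind_le)
  fix f assume f: "f \<in> set_pmf home_seeds"
  show "measure_pmf.prob (map_pmf (merge f) request_seeds) ?E \<le> ?b"
  proof (cases "homes_ok h f")
    case True
    let ?A = "\<lambda>u. {g. hits G (merge f g) u = {}}"
    let ?B = "\<lambda>v. {g. q' < card {u\<in>V. outcome (merge f g) u = Some v}}"
    have "measure_pmf.prob (map_pmf (merge f) request_seeds) ?E =
        measure_pmf.prob request_seeds ((\<Union>u\<in>V. ?A u) \<union> (\<Union>v\<in>V. ?B v))"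
      unfolding measure_map_pmf
      by (rule arg_cong[where f = "measure_pmf.prob request_seeds"]) (auto simp: homes_ok_merge True)
    also have "\<dots> \<le> measure_pmf.prob request_seeds (\<Union>u\<in>V. ?A u) + measure_pmf.prob request_seeds (\<Union>v\<in>V. ?B v)"
      by (rule measure_Un_le) auto
    also have "\<dots> \<le> real (card V) * (1 - 1 / (4 * real (4 * S + 2 * h))) ^ (J - S) + real (card V) * 2 powr (4 - real q')"
      by (intro add_mono prob_UN_le finite_V reject_prob[OF f True h] load_prob[OF f])
    finally show ?thesis by (simp add: n_def)
  next
    case False
    then have "merge f -` ?E = {}" by (auto simp: homes_ok_merge)
    then have "measure_pmf.prob (map_pmf (merge f) request_seeds) ?E = 0"
      by (simp only: measure_map_pmf measure_empty)
    moreover have "0 \<le> 1 - 1 / (4 * real (4 * S + 2 * h))"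
      using h by (simp add: divide_le_eq_1)
    ultimately show ?thesis using n_ge_2 by simp
  qed
qed

theorem calm_prob:
  assumes h: "0 < h"
  shows "measure_pmf.prob all_seeds {\<omega>. \<not> calm q q' \<omega>} \<le>
    real T * n\<^sup>2 * 2 powr (real J - real q) + n * 2 powr (- real h) + n * (3 / 4) ^ S +
    n * (1 - 1 / (4 * real (4 * S + 2 * h))) ^ (J - S) + n * 2 powr (4 - real q')"
proof -
  let ?A = "\<lambda>(s, x, y). {\<omega>. Suc q \<le> card {l\<in>tokens G. path \<omega> l s = x \<and> path \<omega> l (Suc s) = y}}"
  let ?C = "\<Union>a\<in>{..<T} \<times> parcs G. ?A a"
  let ?E = "{\<omega>. homes_ok h \<omega> \<and>
    ((\<exists>u\<in>V. hits G \<omega> u = {}) \<or> (\<exists>v\<in>V. q' < card {u\<in>V. outcome \<omega> u = Some v}))}"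
  have "measure_pmf.prob all_seeds {\<omega>. \<not> calm q q' \<omega>} \<le>
      measure_pmf.prob all_seeds (?C \<union> ({\<omega>. \<not> homes_ok h \<omega>} \<union> ?E))"
    by (intro measure_pmf.finite_measure_mono) (auto simp: calm_def not_le Suc_le_eq)
  also have "\<dots> \<le> measure_pmf.prob all_seeds ?C + measure_pmf.prob all_seeds ({\<omega>. \<not> homes_ok h \<omega>} \<union> ?E)"
    by (rule measure_Un_le) auto
  also have "\<dots> \<le> measure_pmf.prob all_seeds ?C + (measure_pmf.prob all_seeds {\<omega>. \<not> homes_ok h \<omega>} +
      measure_pmf.prob all_seeds ?E)"
    by (intro add_left_mono measure_Un_le) auto
  also have "measure_pmf.prob all_seeds ?C \<le> real (card ({..<T} \<times> parcs G)) * 2 powr (real J - real (Suc q))"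
  proof (rule prob_UN_le)
    fix a assume "a \<in> {..<T} \<times> parcs G"
    then obtain s x y where a: "a = (s, x, y)" "s < T" "(x, y) \<in> parcs G" by auto
    show "measure_pmf.prob all_seeds (?A a) \<le> 2 powr (real J - real (Suc q))"
      unfolding a(1) prod.case by (rule congestion_prob[OF a(3,2)])
  qed (simp add: finite_arcs)
  also have "\<dots> \<le> real T * n\<^sup>2 * 2 powr (real J - real q)"
    using vol_le vol_pos n_ge_2
    by (simp add: card_cartesian_product vol_def[symmetric]) (intro mult_mono powr_mono; simp)
  finally show ?thesis
    using homes_ok_prob[of h] request_prob[OF h, of q'] by linarith
qed

end

end

section \<open>Message sizes\<close>

text \<open>A record costs its payload, two entries for the label and the end mark.\<close>

lemma length_flat_le:
  assumes "\<And>r. r \<in> set rs \<Longrightarrow> length (snd r) \<le> m"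
  shows "length (flat_records rs) \<le> length rs * (m + 3)"
  using assms
proof (induction rs)
  case Nil
  then show ?case by (simp add: flat_records_def)
next
  case (Cons r rs)
  then have "length (flat_records rs) \<le> length rs * (m + 3)" "length (snd r) \<le> m" by auto
  then show ?case by (simp add: flat_records_def flat_record_def)
qed

lemma set_flat_le:
  assumes "\<And>l xs. (l, xs) \<in> set rs \<Longrightarrow> fst l < b \<and> snd l < b \<and> (\<forall>y\<in>set xs. y < b)" "z \<in> set (flat_records rs)"
  shows "z \<le> b"
proof -
  obtain r where r: "r \<in> set rs" "z \<in> set (flat_record r)"
    using assms(2) by (auto simp: flat_records_def)
  obtain l xs where r_eq: "r = (l, xs)" by (cases r)
  have "fst l < b" "snd l < b" "\<forall>y\<in>set xs. y < b" using assms(1)[of l xs] r(1) by (auto simp: r_eq)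
  then show ?thesis using r(2) by (auto simp: flat_record_def r_eq Suc_le_eq)
qed

context seeded_network
begin

context
  fixes q q' k :: nat and \<omega> :: seeds
  assumes mix: "mixed (k + 2) T" and supp: "\<omega> \<in> set_pmf all_seeds" and calm: "calm q q' \<omega>"
begin

lemma seeds_sound: "sound G \<omega>"
  by (rule calm_sound[OF mix supp calm])

lemma finite_crossing: "finite (crossing G \<omega> j s x y)"
  unfolding crossing_def by (simp add: finite_tokens finite_V)

text \<open>A backward crossing from \<open>x\<close> to \<open>y\<close> is a forward crossing from
  \<open>y\<close> to \<open>x\<close> at the mirrored time, so the forward bound covers all
  passes.\<close>

lemma card_crossing:
  assumes "s < T" "(x, y) \<in> parcs G"
  shows "card (crossing G \<omega> j s x y) \<le> q"
proof (cases "j \<in> {0, 2, 5, 7}")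
  case True
  then have "crossing G \<omega> j s x y = {l\<in>tokens G. path \<omega> l s = x \<and> path \<omega> l (Suc s) = y}"
    unfolding crossing_def pos_def by simp
  then show ?thesis using calm assms unfolding calm_def by fastforce
next
  case False
  have eq: "T - s = Suc (T - Suc s)" using assms(1) by simp
  have "crossing G \<omega> j s x y = {l\<in>tokens G. path \<omega> l (T - Suc s) = y \<and> path \<omega> l (Suc (T - Suc s)) = x}"
    using False unfolding crossing_def pos_def eq by (auto simp del: path.simps)
  moreover have "(y, x) \<in> parcs G" "T - Suc s < T" using arc_sym[OF assms(2)] assms(1) by auto
  ultimately show ?thesis using calm unfolding calm_def by fastforce
qed

lemma length_pay:
  assumes "l \<in> tokens G"
  shows "length (pay G t \<omega> j l) \<le> 2 * q' + 1"
proof -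
  have fin: "finite (callers G \<omega> (fst l))" by (simp add: callers_def finite_V)
  have "fst l \<in> V" using assms by (auto simp: tokens_def)
  then have "length (enum (callers G \<omega> (fst l))) \<le> q'"
    using calm_callers[OF mix calm] by (simp add: length_enum[OF fin])
  moreover have "length (concat (map (\<lambda>u. [u, F u]) xs)) = 2 * length xs" for F and xs :: "nat list"
    by (induction xs) auto
  ultimately show ?thesis by (auto simp: pay_def split: option.split)
qed

lemma length_fat:
  assumes "f < 9 * T" "(x, y) \<in> parcs G" "1 \<le> q"
  shows "length (fat G t \<omega> f x y) \<le> q * (2 * q' + 4)"
proof (cases "f div T = 3")
  case True
  have "1 * 1 \<le> q * (2 * q' + 4)" using assms(3) by (intro mult_le_mono) auto
  then show ?thesis using True by (simp add: fat_def)
next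
  case False
  let ?C = "crossing G \<omega> (f div T) (f mod T) x y"
  have "length (fat G t \<omega> f x y) \<le> length (enum ?C) * (2 * q' + 1 + 3)"
  proof -
    have "length (snd r) \<le> 2 * q' + 1"
      if "r \<in> set (map (\<lambda>l. (l, pay G t \<omega> (f div T) l)) (enum ?C))" for r
      using that length_pay by (auto simp: set_enum[OF finite_crossing]) (auto simp: crossing_def)
    then have "length (flat_records (map (\<lambda>l. (l, pay G t \<omega> (f div T) l)) (enum ?C))) \<le>
        length (map (\<lambda>l. (l, pay G t \<omega> (f div T) l)) (enum ?C)) * (2 * q' + 1 + 3)"
      by (rule length_flat_le)
    then show ?thesis using False by (simp add: fat_def)
  qed
  also have "length (enum ?C) = card ?C" by (rule length_enum[OF finite_crossing])
  also have "card ?C * (2 * q' + 1 + 3) \<le> q * (2 * q' + 4)"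
    using card_crossing[OF _ assms(2)] T_pos by (intro mult_le_mono) auto
  finally show ?thesis .
qed

text \<open>Labels, token indices, degrees, densities and codes of messages are all polynomial in
  \<open>n\<close>, so one entry costs O(log n) bits. The sizes of the gossip messages enter through
  \<open>actb\<close> and \<open>reply\<close>.\<close>

lemma entry_fat:
  assumes "f < 9 * T" "x \<in> V" and z: "z \<in> set (fat G t \<omega> f x y)"
    and U: "U \<subseteq> {..<b}" and J: "J \<le> b" and b: "card V ^ 2 + 1 \<le> b"
    and actb: "\<And>u v. u \<in> V \<Longrightarrow> v \<in> V \<Longrightarrow> actcode (task_action (t u) v) < b"
    and reply: "\<And>u v w. u \<in> V \<Longrightarrow> v \<in> V \<Longrightarrow> w \<in> V \<Longrightarrow> mcode (task_reply (t u) v w) < b"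
  shows "z \<le> b"
proof (cases "f div T = 3")
  case True
  then show ?thesis
    using z flood_le[OF assms(2), of \<omega> "f mod T"] peak_le[of \<omega>] b by (auto simp: fat_def)
next
  case False
  let ?C = "crossing G \<omega> (f div T) (f mod T) x y"
  have Vb: "v < b" if "v \<in> V" for v using that V_U U by auto
  have b2: "1 < b" using b two power2_eq_square[of "card V"] by (cases "card V") auto
  note tgt = target_in_V[OF seeds_sound]
  have pay: "\<forall>y\<in>set (pay G t \<omega> j l). y < b" if l: "l \<in> tokens G" for j l
  proof -
    have u: "fst l \<in> V" using l by (auto simp: tokens_def)
    have dg: "dg G (dest \<omega> l) < b"
    proof -
      have "dest \<omega> l \<in> V" using path_in_V[OF seeds_sound l order_refl] by (simp add: dest_def)
      then have "dg G (dest \<omega> l) < card V" by (rule dg_less)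
      also have "\<dots> \<le> b" using b self_le_power[of "card V" 2] two by simp
      finally show ?thesis .
    qed
    have callers: "set (enum (callers G \<omega> v)) = {u\<in>V. target G \<omega> u = v}" for v
      by (subst set_enum) (auto simp: callers_def finite_V)
    have acts: "act G t \<omega> w < b" if "w \<in> V" for w
      unfolding act_def using actb[OF that tgt[OF that]] .
    have resp: "response G t \<omega> v w < b" if "v \<in> V" "w \<in> V" for v w
      unfolding response_def using reply[OF that(1) tgt[OF that(1)] that(2)] .
    have ans: "v < b" if "answer G \<omega> l = Some v" for v
      using answer_Some(1)[OF finite_V that] Vb by blast
    show ?thesis
      unfolding pay_def using u dg b2 acts resp ans tgt Vb
      by (auto split: option.splits if_splits simp: callers)
  qed
  have "fst l < b \<and> snd l < b \<and> (\<forall>y\<in>set xs. y < b)"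
    if "(l, xs) \<in> set (map (\<lambda>l. (l, pay G t \<omega> (f div T) l)) (enum ?C))" for l xs
  proof -
    have "l \<in> ?C" and xs: "xs = pay G t \<omega> (f div T) l"
      using that by (auto simp: set_enum[OF finite_crossing])
    then have l: "l \<in> tokens G" by (simp add: crossing_def)
    show ?thesis using pay[OF l] l Vb J by (auto simp: xs tokens_def)
  qed
  then have "z \<le> b" if "z \<in> set (flat_records (map (\<lambda>l. (l, pay G t \<omega> (f div T) l)) (enum ?C)))"
    using that by (rule set_flat_le)
  then show ?thesis using z False by (simp add: fat_def)
qed

end

end

lemma prob_bind_le_event:
  assumes "\<And>x. x \<in> set_pmf M \<Longrightarrow> x \<notin> B \<Longrightarrow> measure_pmf.prob (N x) X = 0"
  shows "measure_pmf.prob (M \<bind> N) X \<le> measure_pmf.prob M B"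
proof -
  have "measure_pmf.expectation M (\<lambda>x. measure_pmf.prob (N x) X) \<le> measure_pmf.expectation M (indicat_real B)"
    by (rule integral_mono_AE)
      (use assms in \<open>auto simp: AE_measure_pmf_iff indicator_def intro!: integrable_pmf_bounded[where b = 1]\<close>)
  then show ?thesis by (simp add: measure_pmf_prob_bind)
qed

section \<open>Choice of parameters\<close>

definition lg :: "nat \<Rightarrow> nat" where
  "lg n = nat \<lceil>log 2 (real n)\<rceil>"

lemma lg_bounds:
  assumes "2 \<le> n"
  shows "1 \<le> log 2 (real n)" "log 2 (real n) \<le> real (lg n)" "real (lg n) \<le> 2 * log 2 (real n)"
    "1 \<le> lg n" "n \<le> 2 ^ lg n" "lg n \<le> n"
proof -
  show l1: "1 \<le> log 2 (real n)" using assms by simp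
  show l2: "log 2 (real n) \<le> real (lg n)" unfolding lg_def using l1 by linarith
  have l3: "real (lg n) < log 2 (real n) + 1" unfolding lg_def using l1 by linarith
  then show "real (lg n) \<le> 2 * log 2 (real n)" using l1 by linarith
  show "1 \<le> lg n" using l1 l2 by linarith
  have "real n = 2 powr log 2 (real n)" using assms by simp
  also have "\<dots> \<le> 2 powr real (lg n)" using l2 by (intro powr_mono) auto
  also have "\<dots> = real (2 ^ lg n)" by (simp add: powr_realpow)
  finally show "n \<le> 2 ^ lg n" by simp
  have "log 2 (real n) < real n"
  proof -
    have "real n < 2 powr real n" using less_exp[of n] by (simp add: powr_realpow)
    then show ?thesis using assms by (simp add: log_less_iff)
  qed
  then have "\<lceil>log 2 (real n)\<rceil> \<le> int n" by (simp add: ceiling_le_iff)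
  then show "lg n \<le> n" unfolding lg_def by linarith
qed

lemma half_power_lg:
  assumes "2 \<le> n"
  shows "(1 / 2) ^ (m * lg n) \<le> 1 / real n ^ m"
proof -
  have "real n ^ m \<le> (2 ^ lg n) ^ m"
    using lg_bounds(5)[OF assms] by (intro power_mono) (auto simp flip: of_nat_power)
  then have "real n ^ m \<le> 2 ^ (m * lg n)" by (simp add: mult.commute flip: power_mult)
  then show ?thesis using assms by (simp add: power_one_over frac_le)
qed

lemma le_power_self:
  assumes "2 \<le> (n::nat)"
  shows "m \<le> n ^ m"
proof -
  have "m \<le> 2 ^ m" by (rule less_imp_le[OF less_exp])
  also have "\<dots> \<le> n ^ m" using assms by (intro power_mono) auto
  finally show ?thesis .
qed

locale gossip_params =
  fixes a c d :: nat and K :: real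
begin

text \<open>
  With these values each of the five terms of the failure probability is at most \<open>1 / n ^ (c + 3)\<close>,
  see \<open>failure_sum\<close>.  The bound \<open>n ^ walk_exp\<close> on the walk length is twelve for the mixing time,
  \<open>a + 2\<close> for the precision, and six for the constant 64.
\<close>

definition slack :: "nat \<Rightarrow> nat" where "slack n = (c + 4) * lg n"
definition num_home :: "nat \<Rightarrow> nat" where "num_home n = 3 * slack n"
text \<open>The second summand counts requests. A request succeeds with probability at least
  \<open>1 / (4 * (4 * num_home n + 2 * slack n))\<close>, so a batch of the reciprocal size fails
  with probability at most one half; there are \<open>slack n\<close> batches.\<close>

definition num_tokens :: "nat \<Rightarrow> nat" where "num_tokens n = num_home n + 4 * (4 * num_home n + 2 * slack n) * slack n"
definition walk_exp :: nat where "walk_exp = a + 20"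
text \<open>The exponent \<open>c + 5 + walk_exp\<close> pays for the steps, at most
  \<open>n ^ walk_exp\<close>, for the arcs, at most \<open>n ^ 2\<close>, and for the target
  \<open>n ^ (c + 3)\<close>.\<close>

definition cap :: "nat \<Rightarrow> nat" where "cap n = num_tokens n + (c + 5 + walk_exp) * lg n"
definition cap' :: "nat \<Rightarrow> nat" where "cap' n = 4 + slack n"
definition thin_factor :: nat where
  "thin_factor = (59 * (c + 4) ^ 2 + c + 5 + walk_exp) * (2 * c + 20)"
definition thin :: "nat \<Rightarrow> nat" where "thin n = thin_factor * lg n ^ 3"
definition coins :: "nat \<Rightarrow> nat" where "coins n = n * (n ^ 2 + 1) + 1"
text \<open>The sum of the bounds on the kinds of numbers sent: labels below \<open>n ^ d\<close>,
  token indices, densities, and codes of gossip messages.\<close>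

definition entry_bound :: "nat \<Rightarrow> nat" where
  "entry_bound n = n ^ d + num_tokens n + n ^ 2 + 1 + 2 * n ^ nat \<lceil>K\<rceil> + 3"
definition bandwidth :: nat where
  "bandwidth = d + 2 + nat \<lceil>K\<rceil> + (59 * (c + 4) ^ 2 + 10)"

lemma num_tokens_le:
  assumes "2 \<le> n"
  shows "num_tokens n \<le> 59 * (c + 4) ^ 2 * lg n ^ 2"
proof -
  have "1 \<le> slack n" using lg_bounds(4)[OF assms] by (simp add: slack_def)
  then have "slack n \<le> slack n ^ 2" by (simp add: power2_eq_square)
  moreover have "num_tokens n = 3 * slack n + 56 * slack n ^ 2"
    by (simp add: num_tokens_def num_home_def power2_eq_square algebra_simps)
  ultimately have "num_tokens n \<le> 59 * slack n ^ 2" by linarith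
  then show ?thesis by (simp add: slack_def power_mult_distrib)
qed

lemma cap_thin:
  assumes "2 \<le> n"
  shows "cap n * (2 * cap' n + 4) \<le> thin n"
proof -
  have l: "1 \<le> lg n" by (rule lg_bounds(4)[OF assms])
  then have l2: "lg n \<le> lg n ^ 2" by (simp add: power2_eq_square)
  have "(c + 5 + walk_exp) * lg n \<le> (c + 5 + walk_exp) * lg n ^ 2" using l2 by (rule mult_le_mono2)
  with num_tokens_le[OF assms] have "cap n \<le> 59 * (c + 4) ^ 2 * lg n ^ 2 + (c + 5 + walk_exp) * lg n ^ 2"
    unfolding cap_def by (rule add_mono)
  also have "\<dots> = (59 * (c + 4) ^ 2 + c + 5 + walk_exp) * lg n ^ 2" by (simp add: algebra_simps)
  finally have cap: "cap n \<le> (59 * (c + 4) ^ 2 + c + 5 + walk_exp) * lg n ^ 2" .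
  have "2 * cap' n + 4 = 12 * 1 + (2 * c + 8) * lg n" by (simp add: cap'_def slack_def algebra_simps)
  also have "\<dots> \<le> 12 * lg n + (2 * c + 8) * lg n" using l by (intro add_right_mono mult_le_mono2)
  also have "\<dots> = (2 * c + 20) * lg n" by (simp add: algebra_simps)
  finally have "cap n * (2 * cap' n + 4) \<le>
      (59 * (c + 4) ^ 2 + c + 5 + walk_exp) * lg n ^ 2 * ((2 * c + 20) * lg n)"
    using cap by (intro mult_le_mono)
  also have "\<dots> = thin n"
    by (simp add: thin_def thin_factor_def power2_eq_square power3_eq_cube algebra_simps)
  finally show ?thesis .
qed

lemma thin_pos:
  assumes "2 \<le> n"
  shows "0 < thin n"
  using lg_bounds(4)[OF assms] by (simp add: thin_def thin_factor_def)

lemma entry_bound_le: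
  assumes n: "2 \<le> n"
  shows "entry_bound n + 2 \<le> n ^ bandwidth"
proof -
  define M N where "M = 59 * (c + 4) ^ 2" and "N = n ^ (d + 2 + nat \<lceil>K\<rceil>)"
  have n1: "1 \<le> n" using n by simp
  have "num_tokens n \<le> M * lg n ^ 2" using num_tokens_le[OF n] by (simp add: M_def)
  also have "\<dots> \<le> M * n ^ 2" using lg_bounds(6)[OF n] by (intro mult_le_mono2 power_mono) auto
  also have "\<dots> \<le> M * N" unfolding N_def by (intro mult_le_mono2 power_increasing n1) auto
  finally have "num_tokens n \<le> M * N" .
  moreover have "n ^ d \<le> N" "n ^ 2 \<le> N" "n ^ nat \<lceil>K\<rceil> \<le> N"
    unfolding N_def by (rule power_increasing[OF _ n1], linarith)+
  moreover have "1 \<le> N" unfolding N_def by (rule one_le_power[OF n1])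
  ultimately have "entry_bound n + 2 \<le> (M + 10) * N"
    unfolding entry_bound_def distrib_right by linarith
  also have "\<dots> \<le> n ^ (M + 10) * N" using le_power_self[OF n] by (rule mult_le_mono1)
  also have "\<dots> = n ^ bandwidth" unfolding N_def bandwidth_def M_def power_add[symmetric]
    by (rule arg_cong[where f = "\<lambda>e. n ^ e"]) linarith
  finally show ?thesis .
qed

lemma failure_sum:
  assumes n: "2 \<le> n" and T: "T \<le> n ^ walk_exp"
  shows "real T * (real n)\<^sup>2 * 2 powr (real (num_tokens n) - real (cap n)) + real n * 2 powr (- real (slack n)) +
    real n * (3 / 4) ^ num_home n + real n * (1 - 1 / (4 * real (4 * num_home n + 2 * slack n))) ^ (num_tokens n - num_home n) +
    real n * 2 powr (4 - real (cap' n)) \<le> 1 / real n ^ c"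
proof -
  define b where "b = 1 / real n ^ (c + 3)"
  have n0: "0 < real n" using n by simp
  have l: "1 \<le> lg n" by (rule lg_bounds(4)[OF n])
  have powr_half: "2 powr (- real m) = (1 / 2) ^ m" for m :: nat
    by (simp add: powr_minus powr_realpow power_one_over divide_simps)
  have slack: "real n * (1 / 2) ^ slack n \<le> b"
  proof -
    have "real n * (1 / 2) ^ slack n \<le> real n * (1 / real n ^ (c + 4))"
      unfolding slack_def using half_power_lg[OF n, of "c + 4"] by (intro mult_left_mono) auto
    also have "\<dots> = b" using n0 by (simp add: b_def power_add eval_nat_numeral)
    finally show ?thesis .
  qed
  have "real T * (real n)\<^sup>2 * 2 powr (real (num_tokens n) - real (cap n)) \<le> b"
  proof -
    have "real (num_tokens n) - real (cap n) = - real ((c + 5 + walk_exp) * lg n)" by (simp add: cap_def)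
    then have "2 powr (real (num_tokens n) - real (cap n)) \<le> 1 / real n ^ (c + 5 + walk_exp)"
      using half_power_lg[OF n, of "c + 5 + walk_exp"] by (simp only: powr_half)
    moreover have "real T \<le> real n ^ walk_exp" using T by (simp flip: of_nat_power)
    ultimately have "real T * (real n)\<^sup>2 * 2 powr (real (num_tokens n) - real (cap n)) \<le>
        real n ^ walk_exp * (real n)\<^sup>2 * (1 / real n ^ (c + 5 + walk_exp))"
      by (intro mult_mono) auto
    also have "\<dots> = real n ^ (walk_exp + 2) / real n ^ (walk_exp + 2 + (c + 3))"
      by (simp add: power_add eval_nat_numeral)
    also have "\<dots> = b" unfolding b_def power_add[of _ "walk_exp + 2" "c + 3"] using n0 by simp
    finally show ?thesis .
  qed
  moreover have "real n * 2 powr (- real (slack n)) \<le> b"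
    unfolding powr_half by (rule slack)
  moreover have "real n * (3 / 4) ^ num_home n \<le> b"
  proof -
    \<comment> \<open>The factor 3 in \<open>num_home\<close> is chosen because the cube of
      \<open>3 / 4\<close> is below one half.\<close>
    have "(3 / 4 :: real) ^ num_home n = ((3 / 4) ^ 3) ^ slack n" by (simp add: num_home_def flip: power_mult)
    also have "\<dots> \<le> (1 / 2) ^ slack n" by (intro power_mono) (auto simp: eval_nat_numeral)
    finally have "real n * (3 / 4) ^ num_home n \<le> real n * (1 / 2) ^ slack n" by (intro mult_left_mono) auto
    then show ?thesis using slack by linarith
  qed
  moreover have "real n * (1 - 1 / (4 * real (4 * num_home n + 2 * slack n))) ^ (num_tokens n - num_home n) \<le> b"
  proof -
    define x where "x = 4 * (4 * num_home n + 2 * slack n)"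
    have x: "0 < x" using l by (simp add: x_def slack_def)
    have "(1 - 1 / real x) ^ x \<le> exp (- (1 / real x)) ^ x"
      using x exp_ge_add_one_self[of "- (1 / real x)"] by (intro power_mono) (auto simp: divide_le_eq_1)
    also have "\<dots> = exp (- 1)" using x by (simp flip: exp_of_nat_mult)
    also have "\<dots> \<le> 1 / 2"
    proof -
      have "2 \<le> exp (1::real)" using exp_ge_add_one_self[of 1] by simp
      then show ?thesis by (simp add: exp_minus field_simps)
    qed
    finally have half: "(1 - 1 / real x) ^ x \<le> 1 / 2" .
    have "num_tokens n - num_home n = x * slack n" by (simp add: num_tokens_def x_def)
    then have "(1 - 1 / real x) ^ (num_tokens n - num_home n) = ((1 - 1 / real x) ^ x) ^ slack n" by (simp add: power_mult)
    also have "\<dots> \<le> (1 / 2) ^ slack n"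
      using half x by (intro power_mono zero_le_power) (auto simp: divide_le_eq_1)
    finally have "real n * (1 - 1 / real x) ^ (num_tokens n - num_home n) \<le> real n * (1 / 2) ^ slack n"
      by (intro mult_left_mono) auto
    moreover have "4 * real (4 * num_home n + 2 * slack n) = real x" by (simp add: x_def)
    ultimately show ?thesis using slack by (simp only:)
  qed
  moreover have "real n * 2 powr (4 - real (cap' n)) \<le> b"
  proof -
    have "4 - real (cap' n) = - real (slack n)" by (simp add: cap'_def)
    then show ?thesis using slack by (simp only: powr_half)
  qed
  moreover have "5 * b \<le> 1 / real n ^ c"
  proof -
    have "5 \<le> real n ^ 3" using power_mono[of 2 "real n" 3] n by simp
    then have "5 / (real n ^ c * real n ^ 3) \<le> real n ^ 3 / (real n ^ c * real n ^ 3)"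
      by (intro divide_right_mono) auto
    then show ?thesis using n0 by (simp add: b_def power_add)
  qed
  ultimately show ?thesis by linarith
qed

section \<open>The protocol with guessed walk length\<close>

definition unc :: "(nat \<Rightarrow> (nat \<times> nat) \<times> nat \<Rightarrow> nat) \<Rightarrow> seeds" where
  "unc \<omega> = (\<lambda>(x, i). \<omega> x i)"

definition fat_msg ::
  "nat \<Rightarrow> network \<Rightarrow> (nat \<Rightarrow> gossip_task) \<Rightarrow> (nat \<Rightarrow> (nat \<times> nat) \<times> nat \<Rightarrow> nat) \<Rightarrow> nat \<Rightarrow> nat \<Rightarrow> nat \<Rightarrow> nat list" where
  "fat_msg i G t \<omega> = token_protocol.fat (num_home (card (pverts G))) (num_tokens (card (pverts G)))
     (card (pverts G) ^ walk_exp) (2 ^ i) G t (unc \<omega>)"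

text \<open>Fat message \<open>r div b\<close> is sent one entry per round, in a block of
  \<open>b\<close> rounds. Silence marks the end of the list, as \<open>bits\<close> never yields
  the empty string.\<close>

definition thin_msg ::
  "nat \<Rightarrow> network \<Rightarrow> (nat \<Rightarrow> gossip_task) \<Rightarrow> (nat \<Rightarrow> (nat \<times> nat) \<times> nat \<Rightarrow> nat) \<Rightarrow> nat \<Rightarrow> nat \<Rightarrow> nat \<Rightarrow> msg" where
  "thin_msg i G t \<omega> r x y = (let b = thin (card (pverts G)); m = fat_msg i G t \<omega> (r div b) x y in
     if r mod b < length m then bits (m ! (r mod b)) else [])"

definition round_result ::
  "nat \<Rightarrow> network \<Rightarrow> (nat \<Rightarrow> gossip_task) \<Rightarrow> (nat \<Rightarrow> (nat \<times> nat) \<times> nat \<Rightarrow> nat) \<Rightarrow> nat \<Rightarrow> gossip_result" where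
  "round_result i G t \<omega> = gossip_round (pverts G) t
     (token_protocol.target (num_home (card (pverts G))) (num_tokens (card (pverts G)))
       (card (pverts G) ^ walk_exp) (2 ^ i) G (unc \<omega>))"

definition space_ok :: "nat \<Rightarrow> network \<Rightarrow> bool" where
  "space_ok i G \<longleftrightarrow> seeded_network (num_home (card (pverts G))) (num_tokens (card (pverts G)))
     (card (pverts G) ^ walk_exp) (2 ^ i) G (coins (card (pverts G))) {..<card (pverts G) ^ d} \<and>
     connected_network.mixed G (a + 2) (2 ^ i)"

abbreviation seeds_of :: "network \<Rightarrow> seeds pmf" where
  "seeds_of G \<equiv> seeded_network.all_seeds (num_tokens (card (pverts G))) (card (pverts G) ^ walk_exp) G
     (coins (card (pverts G))) {..<card (pverts G) ^ d}"

abbreviation calm_seeds :: "nat \<Rightarrow> network \<Rightarrow> seeds \<Rightarrow> bool" where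
  "calm_seeds i G \<equiv> seeded_network.calm (num_home (card (pverts G))) (num_tokens (card (pverts G)))
     (card (pverts G) ^ walk_exp) (2 ^ i) G (cap (card (pverts G))) (cap' (card (pverts G)))"

definition Good :: "nat \<Rightarrow> (network \<times> (nat \<Rightarrow> gossip_task) \<times> (nat \<Rightarrow> (nat \<times> nat) \<times> nat \<Rightarrow> nat)) set" where
  "Good i = {(G, t, \<omega>). space_ok i G \<and> unc \<omega> \<in> set_pmf (seeds_of G) \<and> calm_seeds i G (unc \<omega>) \<and>
     gossip_msg_bound K (pverts G) t}"

lemma GoodD:
  assumes "(G, t, \<omega>) \<in> Good i"
  shows "seeded_network (num_home (card (pverts G))) (num_tokens (card (pverts G)))
      (card (pverts G) ^ walk_exp) (2 ^ i) G (coins (card (pverts G))) {..<card (pverts G) ^ d}"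
    and "connected_network.mixed G (a + 2) (2 ^ i)"
    and "unc \<omega> \<in> set_pmf (seeds_of G)" "calm_seeds i G (unc \<omega>)" "gossip_msg_bound K (pverts G) t"
    and "connected_network G"
  using assms by (auto simp: Good_def space_ok_def seeded_network_def)

lemma Good_sound:
  assumes "(G, t, \<omega>) \<in> Good i"
  shows "token_protocol.sound (num_home (card (pverts G))) (num_tokens (card (pverts G)))
    (card (pverts G) ^ walk_exp) (2 ^ i) G (unc \<omega>)"
  by (rule seeded_network.calm_sound[OF GoodD(1-4)[OF assms]])

lemma length_fat_msg:
  assumes "(G, t, \<omega>) \<in> Good i" "f < 9 * 2 ^ i" "(x, y) \<in> parcs G"
  shows "length (fat_msg i G t \<omega> f x y) \<le> thin (card (pverts G))"
proof -
  interpret connected_network G by (rule GoodD(6)[OF assms(1)])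
  have "1 * 1 \<le> (c + 5 + walk_exp) * lg (card (pverts G))"
    using lg_bounds(4)[OF two] by (intro mult_le_mono) auto
  then have "1 \<le> cap (card (pverts G))" unfolding cap_def by linarith
  then show ?thesis
    using seeded_network.length_fat[OF GoodD(1-4)[OF assms(1)] assms(2,3)] cap_thin[OF two]
    unfolding fat_msg_def by (meson order.trans)
qed

lemma power_length_le:
  assumes "2 \<le> n" "real (length m) \<le> K * log 2 (real n)"
  shows "2 ^ length m \<le> n ^ nat \<lceil>K\<rceil>"
proof -
  have "K * log 2 (real n) \<le> real (nat \<lceil>K\<rceil>) * log 2 (real n)"
    using lg_bounds(1)[OF assms(1)] by (intro mult_right_mono) linarith+
  then have "2 powr real (length m) \<le> 2 powr (real (nat \<lceil>K\<rceil>) * log 2 (real n))"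
    using assms(2) by (intro powr_mono) auto
  also have "\<dots> = (2 powr log 2 (real n)) powr real (nat \<lceil>K\<rceil>)" by (simp add: powr_powr mult.commute)
  also have "\<dots> = real n ^ nat \<lceil>K\<rceil>" using assms(1) by (simp add: powr_realpow)
  finally have "real (2 ^ length m) \<le> real (n ^ nat \<lceil>K\<rceil>)" by (simp add: powr_realpow)
  then show ?thesis by linarith
qed

lemma thin_msg_length:
  assumes good: "(G, t, \<omega>) \<in> Good i" and x: "x \<in> pverts G"
    and r: "r < 9 * thin (card (pverts G)) * 2 ^ i"
  shows "real (length (thin_msg i G t \<omega> r x y)) \<le> real bandwidth * log 2 (card (pverts G))"
proof -
  interpret connected_network G by (rule GoodD(6)[OF good])
  define N f m where "N = card (pverts G)" and "f = r div thin N" and "m = fat_msg i G t \<omega> f x y"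
  have N: "2 \<le> N" using two by (simp add: N_def)
  have f: "f < 9 * 2 ^ i"
    using r thin_pos[OF N] by (simp add: f_def N_def[symmetric] div_less_iff_less_mult algebra_simps)
  have log0: "0 \<le> log 2 (real N)" using lg_bounds(1)[OF N] by linarith
  show ?thesis
  proof (cases "r mod thin N < length m")
    case False
    then show ?thesis using log0 by (simp add: thin_msg_def Let_def N_def[symmetric] f_def[symmetric] m_def[symmetric])
  next
    case True
    define z where "z = m ! (r mod thin N)"
    have zm: "z \<in> set m" using True by (simp add: z_def)
    have "z \<le> entry_bound N"
    proof (rule seeded_network.entry_fat[OF GoodD(1-4)[OF good] f x])
      show "z \<in> set (token_protocol.fat (num_home (card (pverts G))) (num_tokens (card (pverts G)))
          (card (pverts G) ^ walk_exp) (2 ^ i) G t (unc \<omega>) f x y)"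
        using zm by (simp add: m_def fat_msg_def)
      have bnd: "gossip_msg_bound K (pverts G) t" by (rule GoodD(5)[OF good])
      have code: "mcode s < 2 * N ^ nat \<lceil>K\<rceil>" if "real (length s) \<le> K * log 2 (real N)" for s
        using mcode_upper[of s] power_length_le[OF N that] by simp
      show "actcode (task_action (t u) v) < entry_bound N" if "u \<in> pverts G" "v \<in> pverts G" for u v
      proof (cases "task_action (t u) v")
        case (Push s)
        then have "mcode s < 2 * N ^ nat \<lceil>K\<rceil>"
          using bnd that by (intro code) (simp add: gossip_msg_bound_def N_def)
        then show ?thesis using Push by (simp add: entry_bound_def)
      qed (auto simp: entry_bound_def)
      show "mcode (task_reply (t u) v w) < entry_bound N"
        if "u \<in> pverts G" "v \<in> pverts G" "w \<in> pverts G" for u v w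
      proof -
        have "mcode (task_reply (t u) v w) < 2 * N ^ nat \<lceil>K\<rceil>"
          using bnd that by (intro code) (simp add: gossip_msg_bound_def N_def)
        then show ?thesis by (simp add: entry_bound_def)
      qed
    qed (auto simp: entry_bound_def N_def)
    then have "2 ^ length (bits z) \<le> N ^ bandwidth"
      using length_bits[of z] entry_bound_le[OF N] by linarith
    then have "real (2 ^ length (bits z)) \<le> real (N ^ bandwidth)" by (rule of_nat_mono)
    then have "log 2 (2 ^ length (bits z)) \<le> log 2 (real N ^ bandwidth)"
      using N by (subst log_le_cancel_iff) auto
    then have "real (length (bits z)) \<le> real bandwidth * log 2 (real N)"
      using N by (simp add: log_nat_power)
    then show ?thesis
      using True by (simp add: thin_msg_def Let_def N_def[symmetric] f_def[symmetric] m_def[symmetric] z_def)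
  qed
qed

text \<open>The first silent round reveals the length of the list, the audible ones its
  entries.\<close>

lemma thin_determines_fat:
  assumes "length l \<le> b" "length l' \<le> b"
    and "\<And>k. k < b \<Longrightarrow> (if k < length l then bits (l ! k) else []) = (if k < length l' then bits (l' ! k) else [])"
  shows "l = l'"
proof -
  have iff: "k < length l \<longleftrightarrow> k < length l'" if "k < b" for k
    using assms(3)[OF that] bits_not_Nil by (metis (full_types))
  have "length l = length l'"
    using iff[of "length l"] iff[of "length l'"] assms(1,2) by (metis le_neq_implies_less nat_neq_iff)
  moreover have "l ! k = l' ! k" if "k < length l" for k
  proof (rule bits_inj)
    show "bits (l ! k) = bits (l' ! k)" using assms(3)[of k] that assms(1) calculation by simp
  qed
  ultimately show ?thesis by (rule nth_equalityI)
qed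

text \<open>The third claim converts clocks: a block of \<open>thin\<close> rounds carries one fat
  message, so agreement over \<open>f\<close> blocks gives \<open>heard f\<close>.\<close>

lemma twins:
  assumes good: "(G, t, \<omega>) \<in> Good i" and good': "(G', t', \<omega>') \<in> Good i"
    and x: "x \<in> pverts G" "x \<in> pverts G'"
    and view: "local_view G t x = local_view G' t' x" and seeds: "\<omega> x = \<omega>' x"
  shows "card (pverts G') = card (pverts G)"
    and "token_twins (num_home (card (pverts G))) (num_tokens (card (pverts G))) (card (pverts G) ^ walk_exp) (2 ^ i)
      G G' t t' (unc \<omega>) (unc \<omega>') x"
    and "\<lbrakk>f \<le> 9 * 2 ^ i; \<And>r y. r < f * thin (card (pverts G)) \<Longrightarrow> y \<in> neighbours G x \<Longrightarrow>
        thin_msg i G t \<omega> r y x = thin_msg i G' t' \<omega>' r y x\<rbrakk> \<Longrightarrow>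
      token_twins.heard (num_home (card (pverts G))) (num_tokens (card (pverts G))) (card (pverts G) ^ walk_exp) (2 ^ i)
        G G' t t' (unc \<omega>) (unc \<omega>') x f"
proof -
  show n: "card (pverts G') = card (pverts G)" using view by (simp add: local_view_def)
  have nb: "neighbours G' x = neighbours G x" using view by (simp add: local_view_def)
  interpret N: connected_network G by (rule GoodD(6)[OF good])
  interpret N': connected_network G' by (rule GoodD(6)[OF good'])
  show tw: "token_twins (num_home (card (pverts G))) (num_tokens (card (pverts G))) (card (pverts G) ^ walk_exp) (2 ^ i)
      G G' t t' (unc \<omega>) (unc \<omega>') x"
  proof -
    have tp: "token_protocol (num_home (card (pverts G))) (num_tokens (card (pverts G))) (2 ^ i)"
      using GoodD(1)[OF good] by (simp add: seeded_network_def)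
    show ?thesis
      unfolding token_twins_def token_twins_axioms_def
      using tp Good_sound[OF good] Good_sound[OF good'] x view seeds by (simp add: n unc_def)
  qed
  assume f: "f \<le> 9 * 2 ^ i" and eq: "\<And>r y. r < f * thin (card (pverts G)) \<Longrightarrow> y \<in> neighbours G x \<Longrightarrow>
        thin_msg i G t \<omega> r y x = thin_msg i G' t' \<omega>' r y x"
  define b where "b = thin (card (pverts G))"
  have "fat_msg i G t \<omega> f' y x = fat_msg i G' t' \<omega>' f' y x" if f': "f' < f" and y: "y \<in> neighbours G x" for f' y
  proof (rule thin_determines_fat)
    have f9: "f' < 9 * 2 ^ i" using f f' by simp
    have "(y, x) \<in> parcs G" using y N.nb_sym by (simp add: N.nb_iff)
    then show "length (fat_msg i G t \<omega> f' y x) \<le> b"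
      using length_fat_msg[OF good f9] by (simp add: b_def)
    have "y \<in> neighbours G' x" using y nb by simp
    then have "x \<in> neighbours G' y" using N'.nb_sym by blast
    then have "(y, x) \<in> parcs G'" by (simp add: N'.nb_iff)
    then show "length (fat_msg i G' t' \<omega>' f' y x) \<le> b"
      using length_fat_msg[OF good' f9] by (simp add: b_def n)
    fix k assume k: "k < b"
    then have dm: "(f' * b + k) div b = f'" "(f' * b + k) mod b = k" by simp_all
    have "f' * b + k < f' * b + b" using k by simp
    also have "\<dots> = Suc f' * b" by simp
    also have "\<dots> \<le> f * b" using f' by (intro mult_le_mono1) simp
    finally have "thin_msg i G t \<omega> (f' * b + k) y x = thin_msg i G' t' \<omega>' (f' * b + k) y x"
      using y by (intro eq) (simp_all add: b_def)
    then show "(if k < length (fat_msg i G t \<omega> f' y x) then bits (fat_msg i G t \<omega> f' y x ! k) else []) =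
        (if k < length (fat_msg i G' t' \<omega>' f' y x) then bits (fat_msg i G' t' \<omega>' f' y x ! k) else [])"
      by (simp only: thin_msg_def Let_def n b_def[symmetric] dm)
  qed
  then show "token_twins.heard (num_home (card (pverts G))) (num_tokens (card (pverts G))) (card (pverts G) ^ walk_exp) (2 ^ i)
        G G' t t' (unc \<omega>) (unc \<omega>') x f"
    unfolding token_twins.heard_def[OF tw] fat_msg_def n by blast
qed

text \<open>A node must draw its seeds from its view alone, hence the label range
  \<open>n ^ d\<close> and a lazy step written with \<open>view_nbrs\<close>.\<close>

definition view_seed :: "gossip_task local_view \<Rightarrow> ((nat \<times> nat) \<times> nat \<Rightarrow> nat) pmf" where
  "view_seed v = Pi_pmf (({..<view_size v ^ d} \<times> {..<num_tokens (view_size v)}) \<times>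
       {..<view_size v ^ walk_exp + coins (view_size v)}) 0
     (\<lambda>(l, s). if s < view_size v ^ walk_exp
       then bernoulli_pmf (1 / 2) \<bind>
         (\<lambda>stay. if stay then return_pmf (view_id v) else pmf_of_set (view_nbrs v))
       else pmf_of_set {..<s - view_size v ^ walk_exp})"

text \<open>Attempt \<open>i\<close> has nine passes of \<open>2 ^ i\<close> fat messages, each
  taking \<open>thin n\<close> rounds, hence \<open>9 * thin n\<close> as the unit of the
  windows.\<close>

sublocale windowed_protocol Good thin_msg round_result "\<lambda>n. 9 * thin n" view_seed "real bandwidth"
proof (rule windowed_protocol.intro)
  show "0 < 9 * thin n" if "2 \<le> n" for n using thin_pos[OF that] by simp
  show "connected_network G" if "(G, t, \<omega>) \<in> Good i" for G t \<omega> i by (rule GoodD(6)[OF that])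
  show "0 \<le> real bandwidth" by simp
  show "real (length (thin_msg i G t \<omega> r x y)) \<le> real bandwidth * log 2 (card (pverts G))"
    if "(G, t, \<omega>) \<in> Good i" "x \<in> pverts G" "r < 9 * thin (card (pverts G)) * 2 ^ i" for G t \<omega> i x y r
    by (rule thin_msg_length[OF that])
  fix G t \<omega> i G' t' \<omega>' x
  assume A: "(G, t, \<omega>) \<in> Good i" "(G', t', \<omega>') \<in> Good i" "x \<in> pverts G" "x \<in> pverts G'"
    "local_view G t x = local_view G' t' x" "\<omega> x = \<omega>' x"
  note tw = twins[OF A]
  let ?b = "thin (card (pverts G))"
  show "thin_msg i G t \<omega> r x y = thin_msg i G' t' \<omega>' r x y"
    if r: "r < 9 * ?b * 2 ^ i"
      and eq: "\<And>r' y. r' < r \<Longrightarrow> y \<in> neighbours G x \<Longrightarrow> thin_msg i G t \<omega> r' y x = thin_msg i G' t' \<omega>' r' y x"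
    for r y
  proof -
    interpret connected_network G by (rule GoodD(6)[OF A(1)])
    have f: "r div ?b < 9 * 2 ^ i"
      using r thin_pos[OF two] by (simp add: div_less_iff_less_mult algebra_simps)
    \<comment> \<open>Round \<open>r\<close> sends an entry of fat message number
      \<open>r div ?b\<close>, which depends only on fat messages completed before it.\<close>
    have "thin_msg i G t \<omega> r' y x = thin_msg i G' t' \<omega>' r' y x"
      if "r' < r div ?b * ?b" "y \<in> neighbours G x" for r' y
      by (rule eq[OF less_le_trans[OF that(1) div_times_less_eq_dividend] that(2)])
    then have "token_twins.heard (num_home (card (pverts G))) (num_tokens (card (pverts G))) (card (pverts G) ^ walk_exp) (2 ^ i)
        G G' t t' (unc \<omega>) (unc \<omega>') x (r div ?b)"
      using f by (intro tw(3)) simp_all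
    from token_twins.fat_local[OF tw(2) this f]
    show ?thesis by (simp add: thin_msg_def fat_msg_def tw(1))
  qed
  show "round_result i G t \<omega> x = round_result i G' t' \<omega>' x"
    if eq: "\<And>r' y. r' < 9 * ?b * 2 ^ i \<Longrightarrow> y \<in> neighbours G x \<Longrightarrow>
      thin_msg i G t \<omega> r' y x = thin_msg i G' t' \<omega>' r' y x"
  proof -
    have "token_twins.heard (num_home (card (pverts G))) (num_tokens (card (pverts G))) (card (pverts G) ^ walk_exp) (2 ^ i)
        G G' t t' (unc \<omega>) (unc \<omega>') x (9 * 2 ^ i)"
      using eq by (intro tw(3)) (auto simp: algebra_simps)
    from token_twins.result_local[OF tw(2) this]
    show ?thesis by (simp add: round_result_def tw(1))
  qed
qed

text \<open>Regroups global seeds by node. The zero function outside the network is the default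
  value of the product law.\<close>

definition cur :: "network \<Rightarrow> seeds \<Rightarrow> nat \<Rightarrow> (nat \<times> nat) \<times> nat \<Rightarrow> nat" where
  "cur G \<omega> x = (if x \<in> pverts G then (\<lambda>i. \<omega> (x, i)) else (\<lambda>_. 0))"

context
  fixes i G
  assumes ok: "space_ok i G"
begin

interpretation seeded_network "num_home (card (pverts G))" "num_tokens (card (pverts G))" "card (pverts G) ^ walk_exp" "2 ^ i" G
    "coins (card (pverts G))" "{..<card (pverts G) ^ d}"
  using ok by (simp add: space_ok_def)

lemma fin_all: "finite (block ({..<card V ^ d} \<times> {..<num_tokens (card V)}))"
  by (rule finite_block) simp

lemma unc_cur:
  assumes "\<omega> \<in> set_pmf all_seeds"
  shows "unc (cur G \<omega>) = \<omega>"
proof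
  fix z :: "nat \<times> (nat \<times> nat) \<times> nat"
  obtain x j where z: "z = (x, j)" by (cases z)
  show "unc (cur G \<omega>) z = \<omega> z"
  proof (cases "x \<in> V")
    case False
    then have "\<omega> z = 0"
      using assms unfolding all_seeds_def z by (intro seed_outside[OF fin_all]) (auto simp: block_def)
    then show ?thesis using False by (simp add: unc_def cur_def z)
  qed (simp add: unc_def cur_def z)
qed

lemma view_seeds: "map_pmf (cur G) all_seeds = Pi_pmf V (\<lambda>_. 0) (\<lambda>x. view_seed (local_view G t x))"
proof -
  let ?A = "({..<card V ^ d} \<times> {..<num_tokens (card V)}) \<times> {..<card V ^ walk_exp + coins (card V)}"
  have "map_pmf (cur G) all_seeds =
      map_pmf (\<lambda>\<omega> x. if x \<in> V then (\<lambda>j. \<omega> (x, j)) else (\<lambda>_. 0)) all_seeds"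
    by (intro map_pmf_cong refl ext) (simp add: cur_def)
  also have "\<dots> = Pi_pmf V (\<lambda>_. 0) (\<lambda>x. map_pmf (\<lambda>\<omega> j. \<omega> (x, j)) all_seeds)"
    unfolding all_seeds_def seed_pmf_def
    by (rule Pi_pmf_blocks'[OF finite_V fin_all, where B = "\<lambda>x. {x} \<times> UNIV"])
      (auto simp: disjoint_family_on_def)
  also have "\<dots> = Pi_pmf V (\<lambda>_. 0) (\<lambda>x. view_seed (local_view G t x))"
  proof (intro Pi_pmf_cong refl)
    fix x assume x: "x \<in> V"
    have "map_pmf (\<lambda>\<omega> j. \<omega> (x, j)) all_seeds = map_pmf (\<lambda>\<omega> j. if j \<in> ?A then \<omega> (x, j) else 0) all_seeds"
    proof (intro map_pmf_cong refl ext)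
      fix \<omega> j assume "\<omega> \<in> set_pmf all_seeds"
      then have "\<omega> (x, j) = 0" if "j \<notin> ?A"
        using that unfolding all_seeds_def by (intro seed_outside[OF fin_all]) (auto simp: block_def)
      then show "\<omega> (x, j) = (if j \<in> ?A then \<omega> (x, j) else 0)" by simp
    qed
    also have "\<dots> = Pi_pmf ?A 0 ((\<lambda>(x, l, s). step_law x s) \<circ> Pair x)"
      unfolding all_seeds_def seed_pmf_def
      by (rule Pi_pmf_reindex[OF fin_all]) (use x in \<open>auto simp: block_def inj_on_def\<close>)
    also have "\<dots> = view_seed (local_view G t x)"
      unfolding view_seed_def
      by (rule Pi_pmf_cong) (auto simp: local_view_def step_law_def lazy_step_def cong: if_cong)
    finally show "map_pmf (\<lambda>\<omega> j. \<omega> (x, j)) all_seeds = view_seed (local_view G t x)" .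
  qed
  finally show ?thesis .
qed

text \<open>The coupling draws the seeds, runs the program on them, and draws the contacts from
  \<open>contact_law\<close>. On calm seeds the contacts are exactly the computed targets, so only
  seeds that are not calm can make an output wrong.\<close>

lemma emulation:
  assumes seed: "prog_seed p = view_seed"
    and out: "\<And>t \<omega> x. (G, t, \<omega>) \<in> Good i \<Longrightarrow> x \<in> pverts G \<Longrightarrow>
      prog_out p (local_view G t x) (\<omega> x) (hist p G t \<omega> R x) = round_result i G t \<omega> x"
    and bound: "gossip_msg_bound K V t"
    and lam: "1 / real (card V) ^ a \<le> lam"
  shows "emulates_gossip_round (compile p) G t lam (1 / real (card V) ^ c) R"
  unfolding emulates_gossip_round_def
proof (intro exI conjI)
  have mix: "mixed (a + 2) (2 ^ i)" using ok by (simp add: space_ok_def)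
  let ?F = "\<lambda>\<omega>. final_states p G t R (cur G \<omega>)"
  let ?N = "\<lambda>\<omega>. map_pmf (Pair (?F \<omega>)) (contact_law \<omega>)"
  let ?J = "all_seeds \<bind> ?N"
  have "map_pmf fst ?J = map_pmf (final_states p G t R) (map_pmf (cur G) all_seeds)"
    by (simp add: map_bind_pmf pmf.map_comp o_def map_pmf_const)
      (simp add: map_pmf_def)
  also have "\<dots> = congest_run (compile p) G t R"
    unfolding view_seeds[of t] by (subst compile_run[OF finite_V nb_subset]) (simp add: seed)
  finally show "map_pmf fst ?J = congest_run (compile p) G t R" .
  have "map_pmf snd ?J = all_seeds \<bind> contact_law"
    by (simp add: map_bind_pmf pmf.map_comp o_def)
  then show "gossip_sampler lam V (map_pmf snd ?J)"
    using contacts_gossip[OF mix] lam by (simp add: n_def)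
  let ?E = "{(\<sigma>, s). \<forall>u\<in>V. alg_output (compile p) (local_view G t u) (\<sigma> u) = gossip_round V t s u}"
  have "measure_pmf.prob ?J (- ?E) \<le> measure_pmf.prob all_seeds {\<omega>. \<not> calm_seeds i G \<omega>}"
  proof (rule prob_bind_le_event)
    fix \<omega> assume \<omega>: "\<omega> \<in> set_pmf all_seeds" and "\<omega> \<notin> {\<omega>. \<not> calm_seeds i G \<omega>}"
    then have calm: "calm_seeds i G \<omega>" by simp
    have good: "(G, t, cur G \<omega>) \<in> Good i"
      using ok \<omega> calm bound by (simp add: Good_def unc_cur)
    have snd: "sound G \<omega>" by (rule calm_sound[OF mix \<omega> calm])
    define s where "s u = (if u \<in> V then target G \<omega> u else 0)" for u
    have "fallback V (outcome \<omega> u) = return_pmf (target G \<omega> u)" if "u \<in> V" for u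
      using outcome_target[OF that, of \<omega>] calm that by (simp add: calm_def fallback_def)
    then have "contact_law \<omega> = Pi_pmf V 0 (\<lambda>u. return_pmf (target G \<omega> u))"
      unfolding contact_law_def by (intro Pi_pmf_cong) auto
    also have "\<dots> = return_pmf s" using finite_V by (simp add: s_def[abs_def])
    finally have law: "?N \<omega> = return_pmf (?F \<omega>, s)" by simp
    have "alg_output (compile p) (local_view G t u) (?F \<omega> u) = gossip_round V t s u" if u: "u \<in> V" for u
    proof -
      have "cur G \<omega> \<in> set_pmf (map_pmf (cur G) all_seeds)" using \<omega> by simp
      then have "cur G \<omega> u \<in> set_pmf (prog_seed p (local_view G t u))"
        unfolding view_seeds[of t] seed using u finite_V by (auto simp: set_Pi_pmf PiE_dflt_def)
      then have "alg_output (compile p) (local_view G t u) (?F \<omega> u) =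
          prog_out p (local_view G t u) (cur G \<omega> u) (hist p G t (cur G \<omega>) R u)"
        using u by (simp add: compile_def final_states_def dec_enc)
      also have "\<dots> = gossip_round V t (target G \<omega>) u"
        using out[OF good u] by (simp add: round_result_def unc_cur[OF \<omega>])
      also have "\<dots> = gossip_round V t s u"
      proof -
        have "{w\<in>V. target G \<omega> w = u \<and> is_Push (task_action (t w) u)} =
            {w\<in>V. s w = u \<and> is_Push (task_action (t w) u)}" by (auto simp: s_def)
        then show ?thesis
          using u target_in_V[OF snd u] by (simp add: gossip_round_def s_def)
      qed
      finally show ?thesis .
    qed
    then show "measure_pmf.prob (?N \<omega>) (- ?E) = 0" unfolding law by simp
  qed
  also have "\<dots> \<le> 1 / real (card V) ^ c"
  proof -
    have "0 < slack (card V)" using lg_bounds(4)[OF two] by (simp add: slack_def)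
    from calm_prob[OF mix this, of "cap (card V)" "cap' (card V)"] failure_sum[OF two T_le]
    show ?thesis unfolding n_def by linarith
  qed
  finally have "measure_pmf.prob ?J (- ?E) \<le> 1 / real (card V) ^ c" .
  moreover have "measure_pmf.prob ?J (- ?E) = 1 - measure_pmf.prob ?J ?E"
    using measure_pmf.prob_compl[of ?E ?J]
    by (simp only: Compl_eq_Diff_UNIV space_measure_pmf sets_measure_pmf UNIV_I)
  ultimately have "1 - 1 / real (card V) ^ c \<le> measure_pmf.prob ?J ?E" by linarith
  then show "1 - 1 / real (card V) ^ c \<le>
      \<P>((\<sigma>, s) in ?J. \<forall>u\<in>V. alg_output (compile p) (local_view G t u) (\<sigma> u) = gossip_round V t s u)"
    by (simp add: case_prod_beta')
qed

end

text \<open>288 is 9 passes times 32: a factor 8 for \<open>lg n\<close> in place of the logarithm,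
  cubed, a factor 2 for the preceding windows, and a factor 2 for rounding the walk length to a
  power of two.\<close>

definition rounds_factor :: real where
  "rounds_factor = 288 * real thin_factor * real (a + 2)"

text \<open>The last complete attempt must use walks long enough to be mixed and short enough for
  the seed space. The former holds because \<open>R\<close> covers an attempt with sufficient
  length, the latter because that last attempt itself fits into \<open>R\<close>.\<close>

lemma round_count:
  assumes net: "connected_network G" and V: "pverts G \<subseteq> {..<card (pverts G) ^ d}"
    and R: "R = nat \<lceil>rounds_factor * real (mixing_time G) * log 2 (real (card (pverts G))) ^ 3\<rceil>"
    and i: "i = last_window (9 * thin (card (pverts G))) R"
  shows "space_ok i G" "9 * thin (card (pverts G)) * (2 ^ Suc i - 1) \<le> R"
proof -
  interpret connected_network G by (rule net)
  define N W \<tau> k where "N = card V" and "W = 9 * thin N" and "\<tau> = mixing_time G" and "k = a + 2"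
  have N: "2 \<le> N" using two by (simp add: N_def)
  have W: "0 < W" using thin_pos[OF N] by (simp add: W_def)
  have \<tau>: "0 < \<tau>" using mixing_time_pos by (simp add: \<tau>_def)
  define x where "x = log 2 (real N)"
  note lgN = lg_bounds[OF N, folded x_def]
  have fac: "rounds_factor * real \<tau> * x ^ 3 = 32 * real (k * \<tau>) * (9 * real thin_factor * x ^ 3)"
    by (simp add: rounds_factor_def k_def algebra_simps)
  have Wr: "real W = 9 * real thin_factor * real (lg N) ^ 3" by (simp add: W_def thin_def)
  have up: "9 * real thin_factor * x ^ 3 \<le> real W"
    unfolding Wr using lgN by (intro mult_left_mono power_mono) auto
  have low: "real W \<le> 8 * (9 * real thin_factor * x ^ 3)"
  proof -
    have "real (lg N) ^ 3 \<le> (2 * x) ^ 3" using lgN by (intro power_mono) auto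
    then have "9 * real thin_factor * real (lg N) ^ 3 \<le> 9 * real thin_factor * (2 * x) ^ 3"
      by (intro mult_left_mono) auto
    then show ?thesis unfolding Wr by (simp add: power_mult_distrib)
  qed
  have R1: "32 * real (k * \<tau>) * (9 * real thin_factor * x ^ 3) \<le> real R"
    unfolding R N_def[symmetric] x_def[symmetric] \<tau>_def[symmetric] fac by linarith
  have nonneg: "0 \<le> 32 * real (k * \<tau>) * (9 * real thin_factor * x ^ 3)"
    using lgN by simp
  then have R2: "real R \<le> 32 * real (k * \<tau>) * (9 * real thin_factor * x ^ 3) + 1"
    unfolding R N_def[symmetric] x_def[symmetric] \<tau>_def[symmetric] fac by linarith
  \<comment> \<open>The first power of two that is long enough; minimality keeps it within twice
    \<open>k * \<tau>\<close>.\<close>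
  define j where "j = (LEAST j. k * \<tau> \<le> 2 ^ j)"
  have j: "k * \<tau> \<le> 2 ^ j"
    unfolding j_def by (rule LeastI[of _ "k * \<tau>"]) (rule less_imp_le[OF less_exp])
  have j': "2 ^ j \<le> 2 * (k * \<tau>)"
  proof (cases j)
    case 0
    then show ?thesis using \<tau> by (simp add: k_def)
  next
    case (Suc m)
    have "\<not> k * \<tau> \<le> 2 ^ m" using not_less_Least[of m "\<lambda>j. k * \<tau> \<le> 2 ^ j"] Suc by (simp add: j_def)
    then show ?thesis by (simp add: Suc)
  qed
  have "W * (2 ^ Suc j - 1) \<le> R"
  proof -
    have "real (W * (2 ^ Suc j - 1)) \<le> real (W * 2 ^ Suc j)" by (intro of_nat_mono mult_le_mono2) simp
    also have "\<dots> = real W * (2 * real (2 ^ j))" by simp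
    also have "\<dots> \<le> 8 * (9 * real thin_factor * x ^ 3) * (2 * real (2 * (k * \<tau>)))"
      using low j' lgN by (intro mult_mono mult_left_mono of_nat_mono) auto
    also have "\<dots> = 32 * real (k * \<tau>) * (9 * real thin_factor * x ^ 3)" by simp
    finally show ?thesis using R1 by linarith
  qed
  from last_window[OF W this] have ji: "j \<le> i" and iR: "W * (2 ^ Suc i - 1) \<le> R"
    unfolding i N_def[symmetric] W_def[symmetric] by auto
  show "9 * thin (card V) * (2 ^ Suc i - 1) \<le> R"
    using iR by (simp add: W_def N_def)
  have "mixed (Suc (a + 1)) (2 ^ i)"
  proof (rule mixed_iterate)
    have "Suc (a + 1) * mixing_time G = k * \<tau>" by (simp add: k_def \<tau>_def)
    also have "\<dots> \<le> 2 ^ j" by (rule j)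
    also have "\<dots> \<le> 2 ^ i" using ji by (intro power_increasing) auto
    finally show "Suc (a + 1) * mixing_time G \<le> 2 ^ i" .
  qed
  then have mix: "mixed (a + 2) (2 ^ i)" by simp
  \<comment> \<open>\<open>W * 2 ^ i\<close> is at most \<open>R\<close>, so the guess is at most a
    constant times \<open>k * \<tau>\<close>, and each factor of that is a power of
    \<open>N\<close>.\<close>
  have T: "2 ^ i \<le> N ^ walk_exp"
  proof -
    have "real W * real (2 ^ i) \<le> real (W * (2 ^ Suc i - 1))"
      unfolding of_nat_mult[symmetric] by (intro of_nat_mono mult_le_mono2) simp
    also have "\<dots> \<le> real R" using iR by (rule of_nat_mono)
    also have "\<dots> \<le> 32 * real (k * \<tau>) * real W + 1 * real W"
    proof -
      have "32 * real (k * \<tau>) * (9 * real thin_factor * x ^ 3) \<le> 32 * real (k * \<tau>) * real W"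
        using up by (intro mult_left_mono) auto
      then show ?thesis using R2 W by linarith
    qed
    also have "\<dots> = real W * real (32 * (k * \<tau>) + 1)" by (simp add: algebra_simps)
    finally have "real (2 ^ i) \<le> real (32 * (k * \<tau>) + 1)" using W by simp
    then have "2 ^ i \<le> 32 * (k * \<tau>) + 1" by linarith
    also have "\<dots> \<le> 64 * (k * \<tau>)" using \<tau> by (simp add: k_def)
    also have "\<dots> \<le> N ^ 6 * (N ^ k * N ^ 12)"
      using power_mono[OF N, of 6] le_power_self[OF N, of k] mixing_time_le
      by (intro mult_le_mono) (auto simp: \<tau>_def N_def)
    also have "\<dots> = N ^ walk_exp" unfolding walk_exp_def k_def power_add[symmetric]
      by (rule arg_cong[where f = "\<lambda>e. N ^ e"]) linarith
    finally show ?thesis .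
  qed
  have "seeded_network (num_home N) (num_tokens N) (N ^ walk_exp) (2 ^ i) G (coins N) {..<N ^ d}"
  proof (intro seeded_network.intro seeded_network_axioms.intro token_protocol.intro net)
    show "0 < num_home N" using lg_bounds(4)[OF N] by (simp add: num_home_def slack_def)
    show "pverts G \<subseteq> {..<N ^ d}" using V by (simp add: N_def)
    show "card (pverts G) * ((card (pverts G))\<^sup>2 + 1) < coins N" by (simp add: coins_def N_def)
  qed (use T in \<open>simp_all add: num_tokens_def\<close>)
  then show "space_ok i G" using mix by (simp add: space_ok_def N_def)
qed

end

theorem theorem2:
  fixes lam :: "nat \<Rightarrow> real" and a c d :: nat and K :: real
  assumes lam: "\<And>n. n \<ge> 2 \<Longrightarrow> lam n \<ge> 1 / real n ^ a"
  shows "\<exists>(A :: (nat, gossip_task, gossip_result) congest_alg) (B :: real) (C :: real) (k :: nat).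
    congest_bandwidth A B \<and>
    (\<forall>(G :: network) (task :: nat \<Rightarrow> gossip_task) (n :: nat).
       pair_graph G \<and> Digraph_Component.connected G \<and> card (pverts G) = n \<and> n \<ge> 2 \<and>
       pverts G \<subseteq> {..<n ^ d} \<and> gossip_msg_bound K (pverts G) task \<longrightarrow>
       emulates_gossip_round A G task (lam n) (1 / real n ^ c)
         (nat \<lceil>C * real (mixing_time G) * log 2 (real n) ^ k\<rceil>))"
proof -
  interpret gossip_params a c d K .
  obtain p :: "((nat \<times> nat) \<times> nat \<Rightarrow> nat, gossip_task, gossip_result) seed_prog" where
    seed: "prog_seed p = view_seed"
    and len: "\<And>v a h y. 2 \<le> view_size v \<Longrightarrow>
      real (length (prog_send p v a h y)) \<le> real bandwidth * log 2 (view_size v)"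
    and out: "\<And>i R G t \<omega> x. (G, t, \<omega>) \<in> Good i \<Longrightarrow> i = last_window (9 * thin (card (pverts G))) R \<Longrightarrow>
      9 * thin (card (pverts G)) * (2 ^ Suc i - 1) \<le> R \<Longrightarrow> x \<in> pverts G \<Longrightarrow>
      prog_out p (local_view G t x) (\<omega> x) (hist p G t \<omega> R x) = round_result i G t \<omega> x"
    using program by blast
  show ?thesis
  \<comment> \<open>The algorithm is fixed before the network. The unknown mixing time enters only
    through the number of rounds after which the output is read.\<close>
  proof (intro exI conjI allI impI)
    show "congest_bandwidth (compile p) (real bandwidth)"
      unfolding congest_bandwidth_def using len by (simp add: compile_def)
    fix G :: network and task :: "nat \<Rightarrow> gossip_task" and n :: nat
    assume A: "pair_graph G \<and> Digraph_Component.connected G \<and> card (pverts G) = n \<and> n \<ge> 2 \<and>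
       pverts G \<subseteq> {..<n ^ d} \<and> gossip_msg_bound K (pverts G) task"
    then have n: "card (pverts G) = n" and net: "connected_network G"
      by (auto intro: connected_network.intro)
    let ?R = "nat \<lceil>rounds_factor * real (mixing_time G) * log 2 (real n) ^ 3\<rceil>"
    define i where "i = last_window (9 * thin (card (pverts G))) ?R"
    have V: "pverts G \<subseteq> {..<card (pverts G) ^ d}" using A by simp
    note rc = round_count[OF net V _ i_def, unfolded n, OF refl]
    have "emulates_gossip_round (compile p) G task (lam n) (1 / real (card (pverts G)) ^ c) ?R"
    proof (rule emulation[OF rc(1) seed])
      show "prog_out p (local_view G t x) (\<omega> x) (hist p G t \<omega> ?R x) = round_result i G t \<omega> x"
        if "(G, t, \<omega>) \<in> Good i" "x \<in> pverts G" for t \<omega> x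
        using out[OF that(1) i_def _ that(2)] rc(2) by (simp add: n)
      show "gossip_msg_bound K (pverts G) task" using A by simp
      show "1 / real (card (pverts G)) ^ a \<le> lam n" using lam A by simp
    qed
    then show "emulates_gossip_round (compile p) G task (lam n) (1 / real n ^ c) ?R" by (simp add: n)
  qed
qed

end
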